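(* Let $g:\mathbb{R}\to\mathbb{R}$ be continuous with $|g(t)|\le C(1+|t|^{q-1})$ for all $t$, for some $1\le q\le p_s^*$ and $C>0$. Let $G(t)=\int_0^t g(\sigma)d\sigma$ and $\Phi:X_p^s\to\mathbb{R}$, $\Phi(u)=\frac1p\|u\|_{X_p^s}^p-\int_\Omega G(u)dx$. If there exists $r_1>0$ such that $\Phi(0)\le\Phi(z)$ for all $z\in X_p^s\cap C^0_\delta(\overline\Omega)$ with $\|z\|_{0,\delta}\le r_1$, then there exists $r_2>0$ such that $\Phi(0)\le \Phi(z)$ for all $z\in X_p^s$ with $\|z\|_{X_p^s}\le r_2$.
   Context: $\Omega\subset\mathbb{R}^N$ ($N>1$) is a bounded smooth domain, $s\in(0,1)$, $p>1$, $N>sp$, $p_s^*=\frac{Np}{N-sp}$. $X_p^s=\{u\in W^{s,p}(\mathbb{R}^N): u=0 \text{ a.e. in } \mathbb{R}^N\setminus\Omega\}$ with norm $\|u\|_{X_p^s}=\big(\int_{\mathbb{R}^{2N}}\frac{|u(x)-u(y)|^p}{|x-y|^{N+sp}}dxdy\big)^{1/p}$. $\delta(x)=\mathrm{dist}(x,\partial\Omega)$; $C^0_\delta(\overline\Omega)=\{u\in C^0(\overline\Omega): u/\delta^s \text{ has a continuous extension to }\overline\Omega\}$ with norm $\|u\|_{0,\delta}=\|u/\delta^s\|_{L^\infty(\Omega)}$. *)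

theory Defs
  imports "HOL-Analysis.Analysis"
begin

fun Ck_on :: "nat \<Rightarrow> 'a::euclidean_space set \<Rightarrow> ('a \<Rightarrow> real) \<Rightarrow> bool" where
  "Ck_on 0 U f = continuous_on U f"
| "Ck_on (Suc k) U f = (f differentiable_on U \<and> continuous_on U f \<and>
      (\<forall>i\<in>Basis. Ck_on k U (\<lambda>x. frechet_derivative f (at x) i)))"

definition smooth_on :: "'a::euclidean_space set \<Rightarrow> ('a \<Rightarrow> real) \<Rightarrow> bool" where
  "smooth_on U f \<longleftrightarrow> (\<forall>k. Ck_on k U f)"

text \<open>Bounded smooth domain: nonempty bounded connected open set whose boundary is
  locally the regular zero level set of a C^\<infinity> function, with the domain on the
  negative side.\<close>
definition bounded_smooth_domain :: "'a::euclidean_space set \<Rightarrow> bool" where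
  "bounded_smooth_domain \<Omega> \<longleftrightarrow> open \<Omega> \<and> connected \<Omega> \<and> bounded \<Omega> \<and> \<Omega> \<noteq> {} \<and>
     (\<forall>x\<in>frontier \<Omega>. \<exists>U \<psi>. open U \<and> x \<in> U \<and> smooth_on U \<psi> \<and>
        (\<forall>y\<in>U. frechet_derivative \<psi> (at y) \<noteq> (\<lambda>_. 0)) \<and>
        \<Omega> \<inter> U = {y\<in>U. \<psi> y < 0})"

definition gagliardo :: "real \<Rightarrow> real \<Rightarrow> ('a::euclidean_space \<Rightarrow> real) \<Rightarrow> ennreal" where
  "gagliardo s p u = (\<integral>\<^sup>+ z. ennreal (\<bar>u (fst z) - u (snd z)\<bar> powr p /
        norm (fst z - snd z) powr (real DIM('a) + s * p)) \<partial>(lborel \<Otimes>\<^sub>M lborel))"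

definition W_sp :: "real \<Rightarrow> real \<Rightarrow> ('a::euclidean_space \<Rightarrow> real) set" where
  "W_sp s p = {u. u \<in> borel_measurable lborel \<and>
      (\<integral>\<^sup>+ x. ennreal (\<bar>u x\<bar> powr p) \<partial>lborel) < \<infinity> \<and> gagliardo s p u < \<infinity>}"

definition X_sp :: "'a::euclidean_space set \<Rightarrow> real \<Rightarrow> real \<Rightarrow> ('a \<Rightarrow> real) set" where
  "X_sp \<Omega> s p = {u \<in> W_sp s p. AE x in lborel. x \<notin> \<Omega> \<longrightarrow> u x = 0}"

definition X_norm :: "real \<Rightarrow> real \<Rightarrow> ('a::euclidean_space \<Rightarrow> real) \<Rightarrow> real" where
  "X_norm s p u = (enn2real (gagliardo s p u)) powr (1 / p)"

definition dist_bd :: "'a::euclidean_space set \<Rightarrow> 'a \<Rightarrow> real" where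
  "dist_bd \<Omega> x = infdist x (frontier \<Omega>)"

definition C0_delta :: "'a::euclidean_space set \<Rightarrow> real \<Rightarrow> ('a \<Rightarrow> real) set" where
  "C0_delta \<Omega> s = {u. continuous_on (closure \<Omega>) u \<and>
      (\<exists>h. continuous_on (closure \<Omega>) h \<and> (\<forall>x\<in>\<Omega>. h x = u x / dist_bd \<Omega> x powr s))}"

definition C0_delta_norm :: "'a::euclidean_space set \<Rightarrow> real \<Rightarrow> ('a \<Rightarrow> real) \<Rightarrow> real" where
  "C0_delta_norm \<Omega> s u = (SUP x\<in>\<Omega>. \<bar>u x / dist_bd \<Omega> x powr s\<bar>)"

definition prim :: "(real \<Rightarrow> real) \<Rightarrow> real \<Rightarrow> real" where
  "prim g t = (LBINT \<sigma>=0..t. g \<sigma>)"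

definition energy :: "'a::euclidean_space set \<Rightarrow> real \<Rightarrow> real \<Rightarrow> (real \<Rightarrow> real) \<Rightarrow> ('a \<Rightarrow> real) \<Rightarrow> real" where
  "energy \<Omega> s p g u = 1 / p * (X_norm s p u) powr p - (LINT x:\<Omega>|lborel. prim g (u x))"

end

theory Submission
  imports Defs
begin

text \<open>
  The argument is a direct comparison of competitors and uses no regularity theory for the fractional
  \<open>p\<close>-Laplacian. Given \<open>z\<close> of small norm with negative energy, three modifications that keep the energy
  negative turn it into an admissible competitor, contradicting the hypothesis.

  (1) Truncate \<open>z\<close> at a small constant level \<open>\<tau>\<close>. The set \<open>{\<bar>z\<bar> > \<tau>/2}\<close> has tiny measure, so the nonlocal
  interaction with its complement yields a gain that is a large multiple of the integral of the cut-off part \<open>v\<close>; this beats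
  the bounded part of \<open>g\<close>. The critical growth is absorbed by the Sobolev inequality for \<open>v\<close>.

  (2) The hypothesis forces \<open>g 0 = 0\<close>, hence \<open>g\<close> is as small as we like on \<open>[-\<tau>, \<tau>]\<close>. Truncate below the barrier
  \<open>\<eta> = A D\<^sup>s\<close>, where \<open>D\<close> is an infimum of quadratic functions that vanish on balls exterior to the domain, capped at a small
  height. Near the boundary \<open>\<eta>\<close> is a strict supersolution: on the half-line \<open>t\<^sup>s\<close> is harmonic for the fractional
  \<open>p\<close>-Laplacian, capping it produces a fixed positive amount, and the curvature of the ball is a small perturbation.

  (3) The result is bounded by a multiple of \<open>\<delta>\<^sup>s\<close>. Lowering it slightly makes the support compact in the domain, and averaging over
  small balls makes it continuous; neither operation increases the Gagliardo energy.
\<close>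

section \<open>The kernel measure\<close>

text \<open>Both truncations gain a constant times \<open>\<integral>\<bar>u - w\<bar>\<close> in
  energy, while on bounded values the primitive of \<open>g\<close> changes by at most a constant
  times the same integral. So only constants have to be compared, and no limit of minimisers is
  taken. This dictates their order: the strictness \<open>F\<close> of the barrier is independent of
  the truncation height, so the slope \<open>A\<close> comes from \<open>r1\<close>, then the
  admissible size \<epsilon> of \<open>g\<close>, then \<tau>. The obstacle is curvature. Increments
  of the barrier are controlled by \<theta>(z) = z . b + M |z|^2. Under the kernel measure with
  \<gamma> = s p, the linear part has tails proportional to a^(-\<gamma>); the quadratic part
  perturbs them by a multiple of M^\<sigma> a^(\<sigma> - \<gamma>), for any \<sigma> < min(1,
  \<gamma>). Weighted with the increments of t^s, of order a^(s(p-1)), this error is integrable at a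
  = 0 exactly when \<sigma> > s. Since p > 1 and s < 1, there is room for such a \<sigma>. The error
  then scales like (M L)^\<sigma> L^(-s), against a gain of order L^(-s) from the cap at height L: a
  low cap wins.\<close>

definition rker :: "real \<Rightarrow> 'a::euclidean_space \<Rightarrow> real" where
  "rker \<gamma> z = norm z powr (- (real DIM('a) + \<gamma>))"

text \<open>The convention \<open>0 powr a = 0\<close> gives the origin density 0, so the density is
  finite everywhere and the measure is sigma-finite, although small balls have infinite mass for
  positive \<gamma>.\<close>

definition kmeas :: "real \<Rightarrow> 'a::euclidean_space measure" where
  "kmeas \<gamma> = density lborel (\<lambda>z. ennreal (rker \<gamma> z))"

lemma rker_nonneg [simp]: "rker \<gamma> z \<ge> 0"
  by (simp add: rker_def)

lemma rker_minus [simp]: "rker \<gamma> (- z) = rker \<gamma> z"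
  by (simp add: rker_def)

lemma rker_measurable [measurable]: "rker \<gamma> \<in> borel_measurable borel"
  unfolding rker_def by measurable

lemma sets_kmeas [measurable_cong, simp]: "sets (kmeas \<gamma>) = sets borel"
  by (simp add: kmeas_def)

lemma space_kmeas [simp]: "space (kmeas \<gamma>) = UNIV"
  by (simp add: kmeas_def)

lemma emeasure_kmeas:
  "S \<in> sets borel \<Longrightarrow> emeasure (kmeas \<gamma>) S = (\<integral>\<^sup>+z. ennreal (rker \<gamma> z) * indicator S z \<partial>lborel)"
  unfolding kmeas_def by (subst emeasure_density) auto

lemma nn_integral_kmeas:
  "f \<in> borel_measurable borel \<Longrightarrow>
    (\<integral>\<^sup>+z. f z \<partial>kmeas \<gamma>) = (\<integral>\<^sup>+z. ennreal (rker \<gamma> z) * f z \<partial>lborel)"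
  unfolding kmeas_def by (subst nn_integral_density) auto

text \<open>On a dyadic shell of radius R the density is at most R^(-(N+\<gamma>)), so the volume
  bound leaves R^(\<beta>-\<gamma>), and \<beta> < \<gamma> makes the shells a geometric series.
  Full shells use \<beta> = 0, thin slabs a positive \<beta>.\<close>

lemma kmeas_shells:
  fixes S :: "'a::euclidean_space set"
  assumes [measurable]: "S \<in> sets borel" and "r0 > 0" "\<beta> < \<gamma>" "C \<ge> 0" "\<gamma> > 0"
    and vol: "\<And>r. r \<ge> r0 \<Longrightarrow> emeasure lborel (S \<inter> {z. r \<le> norm z \<and> norm z < 2 * r})
      \<le> ennreal (C * r powr (real DIM('a) + \<beta>))"
  shows "emeasure (kmeas \<gamma>) (S \<inter> {z. r0 \<le> norm z}) \<le> ennreal (C * r0 powr (\<beta> - \<gamma>) / (1 - 2 powr (\<beta> - \<gamma>)))"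
proof -
  define R where "R k = r0 * 2 ^ k" for k :: nat
  define T where "T k = S \<inter> {z. R k \<le> norm z \<and> norm z < 2 * R k}" for k
  have R_pos: "R k > 0" for k using assms by (simp add: R_def)
  have R_ge: "R k \<ge> r0" for k using assms by (simp add: R_def mult_le_cancel_left1)
  have T_meas[measurable]: "T k \<in> sets borel" for k unfolding T_def by measurable
  have cov: "S \<inter> {z. r0 \<le> norm z} \<subseteq> (\<Union>k. T k)"
  proof
    fix z assume z: "z \<in> S \<inter> {z. r0 \<le> norm z}"
    obtain n where n: "norm z / r0 < 2 ^ n" using real_arch_pow[of 2 "norm z / r0"] by auto
    define k where "k = (LEAST k. norm z < r0 * 2 ^ k)"
    have ex: "norm z < r0 * 2 ^ n" using n \<open>r0 > 0\<close> by (simp add: field_simps)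
    have 1: "norm z < r0 * 2 ^ k" unfolding k_def by (rule LeastI[of "\<lambda>k. norm z < r0 * 2 ^ k", OF ex])
    have "k \<noteq> 0"
    proof
      assume "k = 0" then show False using 1 z by simp
    qed
    then obtain j where j: "k = Suc j" by (cases k) auto
    have "\<not> norm z < r0 * 2 ^ j" unfolding j using not_less_Least[of j "\<lambda>k. norm z < r0 * 2 ^ k"] j k_def by auto
    then have "z \<in> T j" using 1 z j by (auto simp: T_def R_def)
    then show "z \<in> (\<Union>k. T k)" by auto
  qed
  have b1: "emeasure (kmeas \<gamma>) (T k) \<le> ennreal (C * r0 powr (\<beta> - \<gamma>) * (2 powr (\<beta> - \<gamma>)) ^ k)" for k
  proof -
    have "emeasure (kmeas \<gamma>) (T k) = (\<integral>\<^sup>+z. ennreal (rker \<gamma> z) * indicator (T k) z \<partial>lborel)"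
      by (rule emeasure_kmeas) simp
    also have "\<dots> \<le> (\<integral>\<^sup>+z. ennreal (R k powr (- (real DIM('a) + \<gamma>))) * indicator (T k) z \<partial>lborel)"
    proof (rule nn_integral_mono)
      fix z :: 'a
      show "ennreal (rker \<gamma> z) * indicator (T k) z \<le> ennreal (R k powr (- (real DIM('a) + \<gamma>))) * indicator (T k) z"
      proof (cases "z \<in> T k")
        case True
        have "norm z powr (- (real DIM('a) + \<gamma>)) \<le> R k powr (- (real DIM('a) + \<gamma>))"
          using True R_pos[of k] \<open>\<gamma> > 0\<close> by (intro powr_mono2') (auto simp: T_def)
        then show ?thesis using True by (auto simp: rker_def intro!: ennreal_leI)
      qed simp
    qed
    also have "\<dots> = ennreal (R k powr (- (real DIM('a) + \<gamma>))) * emeasure lborel (T k)"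
      by (subst nn_integral_cmult) auto
    also have "\<dots> \<le> ennreal (R k powr (- (real DIM('a) + \<gamma>))) * ennreal (C * R k powr (real DIM('a) + \<beta>))"
      unfolding T_def by (intro mult_left_mono vol R_ge) auto
    also have "\<dots> = ennreal (C * R k powr (\<beta> - \<gamma>))"
      using assms by (subst ennreal_mult[symmetric]) (auto simp: powr_add[symmetric])
    also have "C * R k powr (\<beta> - \<gamma>) = C * r0 powr (\<beta> - \<gamma>) * (2 powr (\<beta> - \<gamma>)) ^ k"
      using \<open>r0 > 0\<close> by (simp add: R_def powr_mult powr_realpow[symmetric] powr_powr mult.commute)
    finally show ?thesis .
  qed
  have lt1: "2 powr (\<beta> - \<gamma>) < 1" using \<open>\<beta> < \<gamma>\<close> by (simp add: powr_less_one)
  have "emeasure (kmeas \<gamma>) (S \<inter> {z. r0 \<le> norm z}) \<le> emeasure (kmeas \<gamma>) (\<Union>k. T k)"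
    by (rule emeasure_mono[OF cov]) auto
  also have "\<dots> \<le> (\<Sum>k. emeasure (kmeas \<gamma>) (T k))"
    by (rule emeasure_subadditive_countably) auto
  also have "\<dots> \<le> (\<Sum>k. ennreal (C * r0 powr (\<beta> - \<gamma>) * (2 powr (\<beta> - \<gamma>)) ^ k))"
    by (intro suminf_le b1) auto
  also have "\<dots> = ennreal (\<Sum>k. C * r0 powr (\<beta> - \<gamma>) * (2 powr (\<beta> - \<gamma>)) ^ k)"
    using assms lt1 by (intro suminf_ennreal2) (auto intro!: summable_mult summable_geometric)
  also have "(\<Sum>k. C * r0 powr (\<beta> - \<gamma>) * (2 powr (\<beta> - \<gamma>)) ^ k) = C * r0 powr (\<beta> - \<gamma>) / (1 - 2 powr (\<beta> - \<gamma>))"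
    using lt1 by (subst suminf_mult) (auto simp: suminf_geometric intro!: summable_geometric)
  finally show ?thesis .
qed

text \<open>Packing replaces Fubini and rotations. Translates of the slab along \<open>b\<close>
  with step \<open>3 * w\<close> are disjoint, because \<open>norm b \<ge> 1\<close> shifts
  \<open>z \<bullet> b\<close> by at least \<open>3 * w\<close>, more than the width
  \<open>2 * w\<close>. About \<open>r / (3 * w)\<close> of them fit into the ball of radius
  \<open>6 * r\<close>. For \<open>w \<ge> r\<close> the volume of the ball of radius
  \<open>2 * r\<close> is already small enough.\<close>

lemma slab_volume:
  fixes b :: "'a::euclidean_space"
  assumes "norm b \<ge> 1" "r > 0" "w > 0"
  shows "emeasure lborel {z. norm z < 2 * r \<and> \<bar>z \<bullet> b - a\<bar> \<le> w}
    \<le> ennreal (3 * 6 ^ DIM('a) * unit_ball_vol (real DIM('a)) * r ^ DIM('a) * (w / r))" (is "emeasure lborel ?S \<le> _")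
proof -
  define V where "V = unit_ball_vol (real DIM('a))"
  have V: "V \<ge> 0" by (simp add: V_def)
  have Sm[measurable]: "?S \<in> sets borel" by measurable
  show ?thesis
  proof (cases "w \<ge> r")
    case True
    have "emeasure lborel ?S \<le> emeasure lborel (ball (0::'a) (2 * r))"
      by (rule emeasure_mono) auto
    also have "\<dots> = ennreal (V * (2 * r) ^ DIM('a))"
      using assms by (subst emeasure_ball) (auto simp: V_def)
    also have "\<dots> \<le> ennreal (3 * 6 ^ DIM('a) * V * r ^ DIM('a) * (w / r))"
    proof (rule ennreal_leI)
      have "(2::real) ^ DIM('a) \<le> 6 ^ DIM('a)" by (rule power_mono) auto
      then have "V * r ^ DIM('a) * 2 ^ DIM('a) * 1 \<le> V * r ^ DIM('a) * 6 ^ DIM('a) * (3 * (w / r))"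
        using True assms V by (intro mult_mono) (auto simp: field_simps)
      then show "V * (2 * r) ^ DIM('a) \<le> 3 * 6 ^ DIM('a) * V * r ^ DIM('a) * (w / r)"
        by (simp add: power_mult_distrib mult_ac)
    qed
    finally show ?thesis by (simp add: V_def)
  next
    case False
    define n where "n = nat \<lceil>r / (3 * w)\<rceil>"
    have n1: "real n \<ge> r / (3 * w)" unfolding n_def by linarith
    have n2: "real n \<le> r / (3 * w) + 1" unfolding n_def using assms by (auto simp: of_nat_nat)
    define h where "h j = (3 * w * real j / norm b) *\<^sub>R b" for j :: nat
    define T where "T j = (+) (- h j) -` ?S" for j
    have Tm[measurable]: "T j \<in> sets borel" for j
      using measurable_sets[of "(+) (- h j)" borel borel ?S] unfolding T_def by auto
    have eT: "emeasure lborel (T j) = emeasure lborel ?S" for j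
    proof -
      have "emeasure lborel ?S = emeasure (distr lborel borel ((+) (- h j))) ?S"
        using lborel_distr_plus[of "- h j"] by simp
      also have "\<dots> = emeasure lborel (T j)" unfolding T_def by (subst emeasure_distr) auto
      finally show ?thesis by simp
    qed
    have hb: "h j \<bullet> b = 3 * w * real j * norm b" for j
      using assms by (simp add: h_def dot_square_norm power2_eq_square)
    have b0: "b \<noteq> 0" using assms by auto
    have disj: "disjoint_family_on T {..<n}"
    proof -
      have "False" if "i < j" "z \<in> T i" "z \<in> T j" for i j z
      proof -
        have "\<bar>z \<bullet> b - h i \<bullet> b - a\<bar> \<le> w" "\<bar>z \<bullet> b - h j \<bullet> b - a\<bar> \<le> w"
          using that by (auto simp: T_def inner_diff_left inner_add_left)
        then have "h j \<bullet> b - h i \<bullet> b \<le> 2 * w" by linarith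
        moreover have "h j \<bullet> b - h i \<bullet> b = 3 * w * (real j - real i) * norm b" by (simp add: hb algebra_simps)
        moreover have "3 * w * (real j - real i) * norm b \<ge> 3 * w * 1 * 1"
          using that assms by (intro mult_mono) auto
        ultimately show False using assms by linarith
      qed
      then show ?thesis unfolding disjoint_family_on_def by (metis Int_emptyI linorder_neqE_nat)
    qed
    have sub: "(\<Union>j<n. T j) \<subseteq> ball 0 (6 * r)"
    proof
      fix z assume "z \<in> (\<Union>j<n. T j)"
      then obtain j where j: "j < n" "z \<in> T j" by auto
      have "norm (h j) = 3 * w * real j" using assms b0 by (simp add: h_def)
      also have "\<dots> \<le> 3 * w * real n" using j assms by (intro mult_left_mono) auto
      also have "\<dots> \<le> 3 * w * (r / (3 * w) + 1)" using n2 assms by (intro mult_left_mono) auto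
      also have "\<dots> = r + 3 * w" using assms by (simp add: field_simps)
      finally have "norm (h j) \<le> 4 * r" using False by linarith
      moreover have "norm (z - h j) < 2 * r" using j by (auto simp: T_def)
      moreover have "norm z \<le> norm (z - h j) + norm (h j)" by (metis diff_add_cancel norm_triangle_ineq)
      ultimately show "z \<in> ball 0 (6 * r)" by simp
    qed
    have "ennreal (real n) * emeasure lborel ?S = (\<Sum>j<n. emeasure lborel (T j))"
      by (simp add: eT ennreal_of_nat_eq_real_of_nat)
    also have "\<dots> = emeasure lborel (\<Union>j<n. T j)"
      using disj by (intro sum_emeasure) auto
    also have "\<dots> \<le> emeasure lborel (ball (0::'a) (6 * r))"
      by (rule emeasure_mono[OF sub]) auto
    also have "\<dots> = ennreal (V * (6 * r) ^ DIM('a))"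
      using assms by (subst emeasure_ball) (auto simp: V_def)
    finally have 1: "ennreal (real n) * emeasure lborel ?S \<le> ennreal (V * (6 * r) ^ DIM('a))" .
    have "emeasure lborel ?S = ennreal (3 * w / r) * (ennreal (r / (3 * w)) * emeasure lborel ?S)"
      using assms by (simp add: mult.assoc[symmetric] ennreal_mult[symmetric])
    also have "\<dots> \<le> ennreal (3 * w / r) * (ennreal (real n) * emeasure lborel ?S)"
      using n1 by (intro mult_left_mono mult_right_mono ennreal_leI) auto
    also have "\<dots> \<le> ennreal (3 * w / r) * ennreal (V * (6 * r) ^ DIM('a))"
      by (intro mult_left_mono 1) auto
    also have "\<dots> = ennreal (3 * 6 ^ DIM('a) * V * r ^ DIM('a) * (w / r))"
      using assms V by (subst ennreal_mult[symmetric]) (auto simp: power_mult_distrib mult_ac)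
    finally show ?thesis by (simp add: V_def)
  qed
qed

lemma kmeas_tail_finite:
  assumes "\<gamma> > 0" "r > 0"
  shows "emeasure (kmeas \<gamma> :: 'a::euclidean_space measure) {z. r \<le> norm z}
    \<le> ennreal (2 ^ DIM('a) * unit_ball_vol (real DIM('a)) * r powr (- \<gamma>) / (1 - 2 powr (- \<gamma>)))"
proof -
  have "emeasure (kmeas \<gamma> :: 'a measure) (UNIV \<inter> {z. r \<le> norm z})
    \<le> ennreal (2 ^ DIM('a) * unit_ball_vol (real DIM('a)) * r powr (0 - \<gamma>) / (1 - 2 powr (0 - \<gamma>)))"
  proof (rule kmeas_shells)
    fix \<rho> assume "r \<le> \<rho>"
    have "emeasure lborel (UNIV \<inter> {z::'a. \<rho> \<le> norm z \<and> norm z < 2 * \<rho>}) \<le> emeasure lborel (ball (0::'a) (2 * \<rho>))"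
      by (rule emeasure_mono) auto
    also have "\<dots> = ennreal (2 ^ DIM('a) * unit_ball_vol (real DIM('a)) * \<rho> powr (real DIM('a) + 0))"
      using assms \<open>r \<le> \<rho>\<close> by (subst emeasure_ball) (auto simp: power_mult_distrib powr_realpow mult_ac)
    finally show "emeasure lborel (UNIV \<inter> {z::'a. \<rho> \<le> norm z \<and> norm z < 2 * \<rho>})
      \<le> ennreal (2 ^ DIM('a) * unit_ball_vol (real DIM('a)) * \<rho> powr (real DIM('a) + 0))" .
  qed (use assms in auto)
  then show ?thesis by simp
qed

text \<open>At distance r the slab has thickness of order m r^2, hence fills a fraction at most
  min(1, 4 m r) of the shell, up to a constant. Bounding this by (4 m r)^\<sigma> trades decay in m
  for convergence at infinity: the linear bound alone would not be summable when \<gamma> \<le> 1.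
  Near the origin the set is empty, since |z . b| \<le> 1/2 and m |z|^2 \<le> 1/16 for |z| <
  1/4.\<close>

lemma kmeas_parabolic_slab:
  fixes b :: "'a::euclidean_space"
  assumes "1 \<le> norm b" "norm b \<le> 2" "0 < m" "m \<le> 1" "0 < \<sigma>" "\<sigma> < 1" "\<sigma> < \<gamma>"
  shows "emeasure (kmeas \<gamma>) {z. \<bar>z \<bullet> b - 1\<bar> \<le> m * (norm z)\<^sup>2}
    \<le> ennreal (12 * 6 ^ DIM('a) * unit_ball_vol (real DIM('a)) * (1/4) powr (\<sigma> - \<gamma>) / (1 - 2 powr (\<sigma> - \<gamma>)) * m powr \<sigma>)"
    (is "emeasure _ ?S \<le> _")
proof -
  define V where "V = unit_ball_vol (real DIM('a))"
  have V: "V \<ge> 0" by (simp add: V_def)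
  have "?S \<subseteq> {z. 1/4 \<le> norm z}"
  proof
    fix z assume z: "z \<in> ?S"
    show "z \<in> {z. 1/4 \<le> norm z}"
    proof (rule ccontr)
      assume "z \<notin> {z. 1/4 \<le> norm z}"
      then have lt: "norm z < 1/4" by simp
      have "\<bar>z \<bullet> b\<bar> \<le> norm z * norm b" by (rule Cauchy_Schwarz_ineq2)
      also have "\<dots> \<le> 1/4 * 2" using lt assms by (intro mult_mono) auto
      finally have "\<bar>z \<bullet> b - 1\<bar> \<ge> 1/2" by linarith
      moreover have "m * (norm z)\<^sup>2 \<le> 1 * (1/4)\<^sup>2" using lt assms by (intro mult_mono power_mono) auto
      ultimately show False using z by (auto simp: power2_eq_square)
    qed
  qed
  then have eq: "?S = ?S \<inter> {z. 1/4 \<le> norm z}" by auto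
  have "emeasure (kmeas \<gamma>) (?S \<inter> {z. 1/4 \<le> norm z})
    \<le> ennreal ((12 * 6 ^ DIM('a) * V * m powr \<sigma>) * (1/4) powr (\<sigma> - \<gamma>) / (1 - 2 powr (\<sigma> - \<gamma>)))"
  proof (rule kmeas_shells)
    fix r :: real assume r: "1/4 \<le> r"
    define x where "x = 4 * m * r"
    have x: "x > 0" using r assms by (simp add: x_def)
    let ?A = "?S \<inter> {z. r \<le> norm z \<and> norm z < 2 * r}"
    have A1: "emeasure lborel ?A \<le> ennreal (3 * 6 ^ DIM('a) * V * r ^ DIM('a) * x)"
    proof -
      have "emeasure lborel ?A \<le> emeasure lborel {z. norm z < 2 * r \<and> \<bar>z \<bullet> b - 1\<bar> \<le> 4 * m * r\<^sup>2}"
      proof (intro emeasure_mono subsetI)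
        fix z assume z: "z \<in> ?A"
        have "m * (norm z)\<^sup>2 \<le> m * (2 * r)\<^sup>2" using z assms by (intro mult_left_mono power_mono) auto
        then show "z \<in> {z. norm z < 2 * r \<and> \<bar>z \<bullet> b - 1\<bar> \<le> 4 * m * r\<^sup>2}" using z by (auto simp: power_mult_distrib)
      qed auto
      also have "\<dots> \<le> ennreal (3 * 6 ^ DIM('a) * V * r ^ DIM('a) * (4 * m * r\<^sup>2 / r))"
        unfolding V_def by (rule slab_volume) (use r assms in auto)
      also have "4 * m * r\<^sup>2 / r = x" using r by (simp add: x_def power2_eq_square)
      finally show ?thesis .
    qed
    have A2: "emeasure lborel ?A \<le> ennreal (3 * 6 ^ DIM('a) * V * r ^ DIM('a) * 1)"
    proof -
      have "emeasure lborel ?A \<le> emeasure lborel (ball (0::'a) (2 * r))"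
        by (rule emeasure_mono) auto
      also have "\<dots> = ennreal (V * (2 * r) ^ DIM('a))"
        using r by (subst emeasure_ball) (auto simp: V_def)
      also have "\<dots> \<le> ennreal (3 * 6 ^ DIM('a) * V * r ^ DIM('a) * 1)"
      proof (rule ennreal_leI)
        have "(2::real) ^ DIM('a) \<le> 6 ^ DIM('a)" by (rule power_mono) auto
        also have "\<dots> \<le> 3 * 6 ^ DIM('a)" by simp
        finally have "(2::real) ^ DIM('a) \<le> 3 * 6 ^ DIM('a)" .
        then have "V * r ^ DIM('a) * 2 ^ DIM('a) \<le> V * r ^ DIM('a) * (3 * 6 ^ DIM('a))"
          using r V by (intro mult_left_mono) auto
        then show "V * (2 * r) ^ DIM('a) \<le> 3 * 6 ^ DIM('a) * V * r ^ DIM('a) * 1"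
          by (simp add: power_mult_distrib mult_ac)
      qed
      finally show ?thesis .
    qed
    have "emeasure lborel ?A \<le> ennreal (3 * 6 ^ DIM('a) * V * r ^ DIM('a) * x powr \<sigma>)"
    proof (cases "x \<le> 1")
      case True
      have "x powr 1 \<le> x powr \<sigma>" using True x assms by (intro powr_mono') auto
      then have "3 * 6 ^ DIM('a) * V * r ^ DIM('a) * x \<le> 3 * 6 ^ DIM('a) * V * r ^ DIM('a) * x powr \<sigma>"
        using x V r by (intro mult_left_mono) auto
      then show ?thesis using A1 by (meson ennreal_leI order_trans)
    next
      case False
      have "1 \<le> x powr \<sigma>" using False assms by (intro ge_one_powr_ge_zero) auto
      then have "3 * 6 ^ DIM('a) * V * r ^ DIM('a) * 1 \<le> 3 * 6 ^ DIM('a) * V * r ^ DIM('a) * x powr \<sigma>"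
        using V r by (intro mult_left_mono) auto
      then show ?thesis using A2 by (meson ennreal_leI order_trans)
    qed
    also have "\<dots> \<le> ennreal (12 * 6 ^ DIM('a) * V * m powr \<sigma> * r powr (real DIM('a) + \<sigma>))"
    proof (rule ennreal_leI)
      have "(4::real) powr \<sigma> \<le> 4 powr 1" using assms by (intro powr_mono) auto
      then have "3 * 6 ^ DIM('a) * V * r ^ DIM('a) * (m powr \<sigma> * r powr \<sigma>) * 4 powr \<sigma>
        \<le> 3 * 6 ^ DIM('a) * V * r ^ DIM('a) * (m powr \<sigma> * r powr \<sigma>) * 4"
        using V r by (intro mult_left_mono) auto
      then show "3 * 6 ^ DIM('a) * V * r ^ DIM('a) * x powr \<sigma> \<le> 12 * 6 ^ DIM('a) * V * m powr \<sigma> * r powr (real DIM('a) + \<sigma>)"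
        using r assms by (simp add: x_def powr_mult powr_add powr_realpow mult_ac)
    qed
    finally show "emeasure lborel ?A \<le> ennreal (12 * 6 ^ DIM('a) * V * m powr \<sigma> * r powr (real DIM('a) + \<sigma>))" .
  qed (use assms V in auto)
  then show ?thesis using eq by (simp add: V_def mult_ac)
qed

lemma nn_integral_kmeas_scale:
  fixes f :: "'a::euclidean_space \<Rightarrow> ennreal"
  assumes [measurable]: "f \<in> borel_measurable borel" and "c > 0"
  shows "(\<integral>\<^sup>+z. f z \<partial>kmeas \<gamma>) = ennreal (c powr (- \<gamma>)) * (\<integral>\<^sup>+z. f (c *\<^sub>R z) \<partial>kmeas \<gamma>)"
proof -
  have "(\<integral>\<^sup>+z. f z \<partial>kmeas \<gamma>) = (\<integral>\<^sup>+z. ennreal (rker \<gamma> z) * f z \<partial>lborel)"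
    by (rule nn_integral_kmeas) simp
  also have "\<dots> = (\<integral>\<^sup>+z. ennreal (rker \<gamma> z) * f z \<partial>density (distr lborel borel (\<lambda>x. 0 + c *\<^sub>R x)) (\<lambda>_. ennreal (\<bar>c\<bar> ^ DIM('a))))"
    using lborel_affine[of c "0::'a"] assms by simp
  also have "\<dots> = (\<integral>\<^sup>+z. ennreal (c ^ DIM('a)) * (ennreal (rker \<gamma> (c *\<^sub>R z)) * f (c *\<^sub>R z)) \<partial>lborel)"
    using assms by (subst nn_integral_density) (auto simp: nn_integral_distr)
  also have "\<dots> = (\<integral>\<^sup>+z. ennreal (c powr (- \<gamma>)) * (ennreal (rker \<gamma> z) * f (c *\<^sub>R z)) \<partial>lborel)"
  proof (rule nn_integral_cong)
    fix z :: 'a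
    have "c ^ DIM('a) * rker \<gamma> (c *\<^sub>R z) = c powr (- \<gamma>) * rker \<gamma> z"
    proof -
      have "c ^ DIM('a) * c powr (- (real DIM('a) + \<gamma>)) = c powr (- \<gamma>)"
        using assms by (simp add: powr_realpow[symmetric] powr_add[symmetric])
      then show ?thesis using assms by (simp add: rker_def powr_mult mult.assoc[symmetric])
    qed
    then have "ennreal (c ^ DIM('a)) * ennreal (rker \<gamma> (c *\<^sub>R z)) = ennreal (c powr (- \<gamma>)) * ennreal (rker \<gamma> z)"
      using assms by (simp add: ennreal_mult[symmetric])
    then show "ennreal (c ^ DIM('a)) * (ennreal (rker \<gamma> (c *\<^sub>R z)) * f (c *\<^sub>R z)) = ennreal (c powr (- \<gamma>)) * (ennreal (rker \<gamma> z) * f (c *\<^sub>R z))"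
      by (simp add: mult.assoc[symmetric])
  qed
  also have "\<dots> = ennreal (c powr (- \<gamma>)) * (\<integral>\<^sup>+z. f (c *\<^sub>R z) \<partial>kmeas \<gamma>)"
    by (subst nn_integral_cmult) (auto simp: nn_integral_kmeas)
  finally show ?thesis .
qed

lemma emeasure_kmeas_scale:
  fixes S :: "'a::euclidean_space set"
  assumes [measurable]: "S \<in> sets borel" and "c > 0"
  shows "emeasure (kmeas \<gamma>) S = ennreal (c powr (- \<gamma>)) * emeasure (kmeas \<gamma>) {z. c *\<^sub>R z \<in> S}"
proof -
  have m: "{z. c *\<^sub>R z \<in> S} \<in> sets borel"
    using measurable_sets[of "\<lambda>z. c *\<^sub>R z" borel borel S] by (auto simp: vimage_def)
  have "emeasure (kmeas \<gamma>) S = (\<integral>\<^sup>+z. indicator S z \<partial>kmeas \<gamma>)" by simp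
  also have "\<dots> = ennreal (c powr (- \<gamma>)) * (\<integral>\<^sup>+z. indicator S (c *\<^sub>R z) \<partial>kmeas \<gamma>)"
    by (rule nn_integral_kmeas_scale) (use assms in auto)
  also have "(\<integral>\<^sup>+z. indicator S (c *\<^sub>R z) \<partial>kmeas \<gamma>) = (\<integral>\<^sup>+z. indicator {z. c *\<^sub>R z \<in> S} z \<partial>kmeas \<gamma>)"
    by (rule nn_integral_cong) (auto simp: indicator_def)
  also have "\<dots> = emeasure (kmeas \<gamma>) {z. c *\<^sub>R z \<in> S}" using m by simp
  finally show ?thesis .
qed

lemma emeasure_kmeas_uminus:
  fixes S :: "'a::euclidean_space set"
  assumes [measurable]: "S \<in> sets borel"
  shows "emeasure (kmeas \<gamma>) {z. - z \<in> S} = emeasure (kmeas \<gamma>) S"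
proof -
  have m: "{z. - z \<in> S} \<in> sets borel"
    using measurable_sets[of "uminus" borel borel S] by (auto simp: vimage_def)
  have "distr lborel borel uminus = (lborel :: 'a measure)"
    using lborel_affine_euclidean[of "\<lambda>_. -1" "0::'a"]
    by (simp add: euclidean_representation sum_negf density_1)
  then have "emeasure (kmeas \<gamma>) S = (\<integral>\<^sup>+z. ennreal (rker \<gamma> z) * indicator S z \<partial>distr lborel borel uminus)"
    by (simp add: emeasure_kmeas)
  also have "\<dots> = (\<integral>\<^sup>+z. ennreal (rker \<gamma> z) * indicator {z. - z \<in> S} z \<partial>lborel)"
    by (subst nn_integral_distr) (auto simp: indicator_def)
  also have "\<dots> = emeasure (kmeas \<gamma>) {z. - z \<in> S}" using m by (simp add: emeasure_kmeas)
  finally show ?thesis by simp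
qed

lemma powr_add_le:
  fixes x y s :: real
  assumes "x \<ge> 0" "y \<ge> 0" "0 < s" "s \<le> 1"
  shows "(x + y) powr s \<le> x powr s + y powr s"
proof (cases "x + y = 0")
  case False
  define u where "u = x + y"
  have u: "u > 0" using False assms by (simp add: u_def)
  have "w / u \<le> (w / u) powr s" if "0 \<le> w" "w \<le> u" for w
    using that u assms powr_mono'[of s 1 "w / u"] by (cases "w = 0") auto
  from this[of x] this[of y] have "x / u + y / u \<le> (x / u) powr s + (y / u) powr s"
    using assms by (auto simp: u_def)
  also have "x / u + y / u = 1" using u by (simp add: u_def add_divide_distrib[symmetric])
  also have "(x / u) powr s + (y / u) powr s = (x powr s + y powr s) / u powr s"
    using assms u by (simp add: powr_divide add_divide_distrib)
  finally show ?thesis using u by (simp add: u_def field_simps)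
qed (use assms in auto)

lemma powr_add_ge:
  fixes x y p :: real
  assumes "x \<ge> 0" "y \<ge> 0" "1 \<le> p"
  shows "x powr p + y powr p \<le> (x + y) powr p"
proof (cases "x + y = 0")
  case False
  define u where "u = x + y"
  have u: "u > 0" using False assms by (simp add: u_def)
  have "(w / u) powr p \<le> w / u" if "0 \<le> w" "w \<le> u" for w
    using that u assms powr_mono'[of 1 p "w / u"] by (cases "w = 0") auto
  from this[of x] this[of y] have "(x / u) powr p + (y / u) powr p \<le> x / u + y / u"
    using assms by (auto simp: u_def)
  also have "x / u + y / u = 1" using u by (simp add: u_def add_divide_distrib[symmetric])
  also have "(x / u) powr p + (y / u) powr p = (x powr p + y powr p) / u powr p"
    using assms u by (simp add: powr_divide add_divide_distrib)
  finally show ?thesis using u by (simp add: u_def field_simps)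
next
  case True
  then have "x = 0" "y = 0" using assms by auto
  then show ?thesis by simp
qed

lemma sigma_finite_kmeas: "sigma_finite_measure (kmeas \<gamma>)"
  unfolding kmeas_def by (subst sigma_finite_measure.sigma_finite_iff_density_finite'[OF lborel.sigma_finite_measure_axioms]) auto

section \<open>Layer cake formula and comparison of integrals through tails\<close>

lemma nn_integral_layer_cake:
  fixes f :: "'b \<Rightarrow> real"
  assumes "sigma_finite_measure M" and [measurable]: "f \<in> borel_measurable M"
  shows "(\<integral>\<^sup>+z. ennreal (f z) \<partial>M)
    = (\<integral>\<^sup>+l. indicator {0<..} l * emeasure M {z \<in> space M. f z > l} \<partial>lborel)"
proof -
  interpret sigma_finite_measure M by fact
  interpret pair_sigma_finite M "lborel :: real measure" ..
  have [measurable]: "Measurable.pred (M \<Otimes>\<^sub>M lborel) (\<lambda>w. 0 < snd w \<and> snd w < f (fst w))"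
    by measurable
  have "(\<integral>\<^sup>+z. ennreal (f z) \<partial>M) = (\<integral>\<^sup>+z. \<integral>\<^sup>+l. indicator {w. 0 < snd w \<and> snd w < f (fst w)} (z, l) \<partial>lborel \<partial>M)"
  proof (rule nn_integral_cong)
    fix z
    have "(\<integral>\<^sup>+l. indicator {w. 0 < snd w \<and> snd w < f (fst w)} (z, l) \<partial>lborel) = (\<integral>\<^sup>+l. indicator {0<..<f z} l \<partial>lborel)"
      by (rule nn_integral_cong) (auto simp: indicator_def)
    also have "\<dots> = ennreal (f z)" by (cases "f z \<ge> 0") (auto simp: ennreal_neg)
    finally show "ennreal (f z) = (\<integral>\<^sup>+l. indicator {w. 0 < snd w \<and> snd w < f (fst w)} (z, l) \<partial>lborel)" by simp
  qed
  also have "\<dots> = (\<integral>\<^sup>+l. \<integral>\<^sup>+z. indicator {w. 0 < snd w \<and> snd w < f (fst w)} (z, l) \<partial>M \<partial>lborel)"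
    proof (rule Fubini'[symmetric])
    have "(\<lambda>(x, y). indicator {w. 0 < snd w \<and> snd w < f (fst w)} (x, y) :: ennreal)
      = (\<lambda>w. if 0 < snd w \<and> snd w < f (fst w) then 1 else 0)"
      by (auto simp: indicator_def fun_eq_iff)
    then show "(\<lambda>(x, y). indicator {w. 0 < snd w \<and> snd w < f (fst w)} (x, y) :: ennreal) \<in> borel_measurable (M \<Otimes>\<^sub>M lborel)"
      by simp
  qed
  also have "\<dots> = (\<integral>\<^sup>+l. indicator {0<..} l * emeasure M {z \<in> space M. f z > l} \<partial>lborel)"
  proof (rule nn_integral_cong)
    fix l :: real
    have "(\<integral>\<^sup>+z. indicator {w. 0 < snd w \<and> snd w < f (fst w)} (z, l) \<partial>M)
      = (\<integral>\<^sup>+z. indicator {0<..} l * indicator {z \<in> space M. f z > l} z \<partial>M)"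
      by (rule nn_integral_cong) (auto simp: indicator_def)
    also have "\<dots> = indicator {0<..} l * emeasure M {z \<in> space M. f z > l}"
      by (subst nn_integral_cmult) auto
    finally show "(\<integral>\<^sup>+z. indicator {w. 0 < snd w \<and> snd w < f (fst w)} (z, l) \<partial>M) = indicator {0<..} l * emeasure M {z \<in> space M. f z > l}" .
  qed
  finally show ?thesis .
qed

text \<open>By the layer cake formula only the sets where \<open>H (f z) > l\<close> matter, and for
  monotone \<open>H\<close> they are half-lines in the value of \<open>f\<close>. Such a half-line
  may or may not contain its endpoint, hence the closed tail on the left and the open tails on the
  right. Its endpoint lies in \<open>[a0, L]\<close> because \<open>H\<close> vanishes below
  \<open>a0\<close> and is constant from \<open>L\<close> on; so tail estimates valid only up to the
  cap are enough.\<close>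

lemma nn_integral_mono_tails:
  fixes H :: "real \<Rightarrow> real"
  assumes sf: "sigma_finite_measure M1" "sigma_finite_measure M2" "sigma_finite_measure M3"
    and [measurable]: "f1 \<in> borel_measurable M1" "f2 \<in> borel_measurable M2" "f3 \<in> borel_measurable M3"
    and H: "mono H" "\<And>a. a < a0 \<Longrightarrow> H a = 0" "\<And>a. L \<le> a \<Longrightarrow> H a = H L"
    and tails: "\<And>a. a0 \<le> a \<Longrightarrow> a \<le> L \<Longrightarrow> c1 * emeasure M1 {z \<in> space M1. a \<le> f1 z}
      \<le> c2 * emeasure M2 {z \<in> space M2. a < f2 z} + c3 * emeasure M3 {z \<in> space M3. a < f3 z}"
  shows "c1 * (\<integral>\<^sup>+z. ennreal (H (f1 z)) \<partial>M1)
    \<le> c2 * (\<integral>\<^sup>+z. ennreal (H (f2 z)) \<partial>M2) + c3 * (\<integral>\<^sup>+z. ennreal (H (f3 z)) \<partial>M3)"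
proof -
  have [measurable]: "H \<in> borel_measurable borel" by (rule borel_measurable_mono) fact
  interpret m1: sigma_finite_measure M1 by fact
  interpret m2: sigma_finite_measure M2 by fact
  interpret m3: sigma_finite_measure M3 by fact
  have em: "(\<lambda>l. emeasure M {z \<in> space M. l < H (f z)}) \<in> borel_measurable lborel"
    if "sigma_finite_measure M" and [measurable]: "f \<in> borel_measurable M" for f :: "'z \<Rightarrow> real" and M
  proof -
    interpret sigma_finite_measure M by fact
    have "{w \<in> space (lborel \<Otimes>\<^sub>M M). fst w < H (f (snd w))} \<in> sets (lborel \<Otimes>\<^sub>M M)" by measurable
    from measurable_emeasure_Pair[OF this]
    have "(\<lambda>l. emeasure M (Pair l -` {w \<in> space (lborel \<Otimes>\<^sub>M M). fst w < H (f (snd w))})) \<in> borel_measurable lborel" .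
    moreover have "Pair l -` {w \<in> space (lborel \<Otimes>\<^sub>M M). fst w < H (f (snd w))} = {z \<in> space M. l < H (f z)}" for l
      by (auto simp: space_pair_measure)
    ultimately show ?thesis by simp
  qed
  have key: "c1 * emeasure M1 {z \<in> space M1. l < H (f1 z)}
    \<le> c2 * emeasure M2 {z \<in> space M2. l < H (f2 z)} + c3 * emeasure M3 {z \<in> space M3. l < H (f3 z)}"
    if l: "l > 0" for l
  proof (cases "H L > l")
    case False
    have "H x \<le> l" for x
    proof (cases "x \<le> L")
      case True
      then show ?thesis using monoD[OF H(1) True] False by linarith
    next
      case False
      then have "H x = H L" by (intro H(3)) linarith
      then show ?thesis using \<open>\<not> l < H L\<close> by simp
    qed
    then have e: "{z \<in> space M1. l < H (f1 z)} = {}" by (auto simp: not_less)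
    show ?thesis unfolding e by simp
  next
    case True
    define A where "A = {x. H x > l}"
    have A: "x \<ge> a0" if "x \<in> A" for x
    proof (rule ccontr)
      assume "\<not> x \<ge> a0"
      then show False using H(2)[of x] that l by (auto simp: A_def)
    qed
    have lA: "L \<in> A" using True by (simp add: A_def)
    have bdd: "bdd_below A" using A by (auto simp: bdd_below_def)
    define a where "a = Inf A"
    have a0a: "a0 \<le> a" unfolding a_def using lA A by (intro cInf_greatest) auto
    have al: "a \<le> L" unfolding a_def using lA bdd by (rule cInf_lower)
    have up: "H x > l" if xa: "x > a" for x
    proof -
      obtain y where "y \<in> A" "y < x" using xa lA unfolding a_def by (metis cInf_lessD empty_iff)
      then show ?thesis using monoD[OF H(1), of y x] by (auto simp: A_def)
    qed
    have lo: "x \<ge> a" if "H x > l" for x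
      unfolding a_def using that bdd by (intro cInf_lower) (auto simp: A_def)
    have "c1 * emeasure M1 {z \<in> space M1. l < H (f1 z)} \<le> c1 * emeasure M1 {z \<in> space M1. a \<le> f1 z}"
      using lo by (intro mult_left_mono emeasure_mono) auto
    also have "\<dots> \<le> c2 * emeasure M2 {z \<in> space M2. a < f2 z} + c3 * emeasure M3 {z \<in> space M3. a < f3 z}"
      by (rule tails[OF a0a al])
    also have "\<dots> \<le> c2 * emeasure M2 {z \<in> space M2. l < H (f2 z)} + c3 * emeasure M3 {z \<in> space M3. l < H (f3 z)}"
      using up by (intro add_mono mult_left_mono emeasure_mono) auto
    finally show ?thesis .
  qed
  define E1 where "E1 l = indicator {0<..} l * emeasure M1 {z \<in> space M1. l < H (f1 z)}" for l :: real
  define E2 where "E2 l = indicator {0<..} l * emeasure M2 {z \<in> space M2. l < H (f2 z)}" for l :: real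
  define E3 where "E3 l = indicator {0<..} l * emeasure M3 {z \<in> space M3. l < H (f3 z)}" for l :: real
  have m1: "E1 \<in> borel_measurable lborel"
    unfolding E1_def[abs_def] by (intro borel_measurable_times_ennreal em sf) auto
  have m2: "E2 \<in> borel_measurable lborel"
    unfolding E2_def[abs_def] by (intro borel_measurable_times_ennreal em sf) auto
  have m3: "E3 \<in> borel_measurable lborel"
    unfolding E3_def[abs_def] by (intro borel_measurable_times_ennreal em sf) auto
  have i1: "(\<integral>\<^sup>+z. ennreal (H (f1 z)) \<partial>M1) = (\<integral>\<^sup>+l. E1 l \<partial>lborel)"
    unfolding E1_def by (rule nn_integral_layer_cake[OF sf(1)]) measurable
  have i2: "(\<integral>\<^sup>+z. ennreal (H (f2 z)) \<partial>M2) = (\<integral>\<^sup>+l. E2 l \<partial>lborel)"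
    unfolding E2_def by (rule nn_integral_layer_cake[OF sf(2)]) measurable
  have i3: "(\<integral>\<^sup>+z. ennreal (H (f3 z)) \<partial>M3) = (\<integral>\<^sup>+l. E3 l \<partial>lborel)"
    unfolding E3_def by (rule nn_integral_layer_cake[OF sf(3)]) measurable
  have "c1 * (\<integral>\<^sup>+l. E1 l \<partial>lborel) = (\<integral>\<^sup>+l. c1 * E1 l \<partial>lborel)"
    using m1 by (rule nn_integral_cmult[symmetric])
  also have "\<dots> \<le> (\<integral>\<^sup>+l. c2 * E2 l + c3 * E3 l \<partial>lborel)"
    using key by (intro nn_integral_mono) (auto simp: indicator_def E1_def E2_def E3_def)
  also have "\<dots> = (\<integral>\<^sup>+l. c2 * E2 l \<partial>lborel) + (\<integral>\<^sup>+l. c3 * E3 l \<partial>lborel)"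
    using m2 m3 by (intro nn_integral_add borel_measurable_times_ennreal) auto
  also have "\<dots> = c2 * (\<integral>\<^sup>+l. E2 l \<partial>lborel) + c3 * (\<integral>\<^sup>+l. E3 l \<partial>lborel)"
    using m2 m3 by (simp add: nn_integral_cmult)
  finally show ?thesis by (simp only: i1 i2 i3)
qed

text \<open>The measure on the half-line with tails \<open>a\<^bsup>-\<gamma>\<^esup>\<close>, against which the images of the kernel measure are compared.\<close>
definition powm :: "real \<Rightarrow> real measure" where
  "powm \<gamma> = density lborel (\<lambda>a. ennreal (\<gamma> * a powr (- \<gamma> - 1)) * indicator {0<..} a)"

lemma sets_powm [measurable_cong, simp]: "sets (powm \<gamma>) = sets borel"
  by (simp add: powm_def)

lemma space_powm [simp]: "space (powm \<gamma>) = UNIV"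
  by (simp add: powm_def)

lemma sigma_finite_powm: "sigma_finite_measure (powm \<gamma>)"
  unfolding powm_def by (subst sigma_finite_measure.sigma_finite_iff_density_finite'[OF lborel.sigma_finite_measure_axioms]) (auto simp: ennreal_mult_eq_top_iff indicator_def)

lemma nn_integral_powm:
  "f \<in> borel_measurable borel \<Longrightarrow>
    (\<integral>\<^sup>+a. f a \<partial>powm \<gamma>) = (\<integral>\<^sup>+a. ennreal (\<gamma> * a powr (- \<gamma> - 1)) * indicator {0<..} a * f a \<partial>lborel)"
  unfolding powm_def by (subst nn_integral_density) auto

lemma emeasure_powm_atLeast:
  assumes "\<gamma> > 0" "x > 0"
  shows "emeasure (powm \<gamma>) {x..} = ennreal (x powr (- \<gamma>))"
proof -
  have "emeasure (powm \<gamma>) {x..} = (\<integral>\<^sup>+a. ennreal (\<gamma> * a powr (- \<gamma> - 1)) * indicator {0<..} a * indicator {x..} a \<partial>lborel)"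
    unfolding powm_def by (subst emeasure_density) auto
  also have "\<dots> = (\<integral>\<^sup>+a. ennreal (\<gamma> * a powr (- \<gamma> - 1)) * indicator {x..} a \<partial>lborel)"
    using assms by (intro nn_integral_cong) (auto simp: indicator_def)
  also have "\<dots> = ennreal (0 - (- (x powr (- \<gamma>))))"
  proof (rule nn_integral_FTC_atLeast)
    show "((\<lambda>a. - (a powr (- \<gamma>))) has_real_derivative \<gamma> * a powr (- \<gamma> - 1)) (at a)" if "x \<le> a" for a
      using that assms by (auto intro!: derivative_eq_intros)
    have "((\<lambda>a. a powr (- \<gamma>)) \<longlongrightarrow> 0) at_top"
      using assms by (intro tendsto_neg_powr filterlim_ident) auto
    from tendsto_minus[OF this] show "((\<lambda>a. - (a powr (- \<gamma>))) \<longlongrightarrow> 0) at_top" by simp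
  qed (use assms in auto)
  finally show ?thesis by simp
qed

lemma emeasure_powm_greaterThan:
  assumes "\<gamma> > 0" "x > 0"
  shows "emeasure (powm \<gamma>) {x<..} = ennreal (x powr (- \<gamma>))"
proof -
  have "emeasure (powm \<gamma>) {x} = (\<integral>\<^sup>+a. ennreal (\<gamma> * a powr (- \<gamma> - 1)) * indicator {0<..} a * indicator {x} a \<partial>lborel)"
    unfolding powm_def by (subst emeasure_density) auto
  also have "\<dots> = 0"
    by (subst nn_integral_0_iff_AE) (auto intro!: AE_I[of _ _ "{x}"])
  finally have 0: "emeasure (powm \<gamma>) {x} = 0" .
  have "emeasure (powm \<gamma>) {x..} = emeasure (powm \<gamma>) ({x<..} \<union> {x})"
    by (rule arg_cong[of _ _ "emeasure _"]) auto
  also have "\<dots> = emeasure (powm \<gamma>) {x<..}"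
    using 0 by (intro emeasure_Un_null_set) auto
  finally show ?thesis using emeasure_powm_atLeast[OF assms] by simp
qed

section \<open>The half-line profile\<close>

text \<open>This is the harmonicity of t^s on the half-line for the fractional p-Laplacian, with one
  sign kept. The inversion that exchanges the points t / \<rho> and t \<rho> matches the outer and
  the inner part of the integral and respects the cut-off \<rho> \<le> q, so both sides become
  integrals over the same interval and can be compared by an explicit antiderivative. Inequality
  instead of equality comes from a nonnegative boundary term at \<rho> = q that is dropped.\<close>

lemma powm_half_line_harmonic:
  fixes s p q t :: real
  assumes s: "0 < s" "s < 1" and p: "p > 1" and t: "t > 0" and q: "0 < q" "q < 1"
  shows "(\<integral>\<^sup>+a. ennreal (if (1 / q - 1) * t \<le> a then ((t + a) powr s - t powr s) powr (p - 1) else 0) \<partial>powm (s * p))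
    \<le> (\<integral>\<^sup>+a. ennreal (if (1 - q) * t \<le> a then (t powr s - max 0 (t - a) powr s) powr (p - 1) else 0) \<partial>powm (s * p))"
    (is "?L \<le> ?R")
proof -
  define \<gamma> where "\<gamma> = s * p"
  have \<gamma>: "\<gamma> > 0" using s p by (simp add: \<gamma>_def)
  define A where "A r = t powr (- s) * \<gamma> * (1 - r powr s) powr (p - 1) * (1 - r) powr (- \<gamma> - 1)" for r :: real
  define fL where "fL a = ennreal (\<gamma> * a powr (- \<gamma> - 1) * ((t + a) powr s - t powr s) powr (p - 1))" for a
  define fR where "fR a = ennreal (\<gamma> * a powr (- \<gamma> - 1) * (t powr s - (t - a) powr s) powr (p - 1))" for a
  have [measurable]: "A \<in> borel_measurable borel" "fL \<in> borel_measurable borel" "fR \<in> borel_measurable borel"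
    unfolding A_def[abs_def] fL_def[abs_def] fR_def[abs_def] by measurable
  \<comment> \<open>The outer substitution is singular at \<rho> = 0, which corresponds to infinity;
    the cut-offs \<open>e n\<close> exhaust \<open>(0, q)\<close> from below and are removed by
    monotone convergence.\<close>
  define e where "e n = q / (real n + 2)" for n :: nat
  have e: "0 < e n" "e n < q" for n
  proof -
    show "0 < e n" using q by (simp add: e_def)
    have "q / (real n + 2) < q / 1" using q by (intro divide_strict_left_mono) auto
    then show "e n < q" by (simp add: e_def)
  qed
  \<comment> \<open>With \<rho> = -x these read \<open>t + gL x = t / \<rho>\<close> and
    \<open>t - gR x = t * \<rho>\<close>. The variable x = -\<rho> is used instead of \<rho> so that
    both substitutions are increasing.\<close>
  define gL where "gL x = t * (- 1 / x - 1)" for x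
  define gR where "gR x = t * (1 + x)" for x
  have r: "0 < r powr s" "r powr s < 1" if "0 < r" "r < 1" for r :: real
    using that s powr_less_mono2[of s r 1] by auto
  have subL: "fL (gL x) * ennreal (t / x\<^sup>2) = ennreal (A (- x) * (- x) powr (s - 1))" if x: "- q \<le> x" "x < 0" for x
  proof -
    define \<rho> where "\<rho> = - x"
    have \<rho>: "0 < \<rho>" "\<rho> < 1" using x q by (auto simp: \<rho>_def)
    have x_eq: "x = - \<rho>" by (simp add: \<rho>_def)
    have g: "gL x = t * ((1 - \<rho>) / \<rho>)" using \<rho> by (simp add: gL_def x_eq field_simps)
    have 1: "t + gL x = t / \<rho>" using \<rho> by (simp add: g field_simps)
    have 2: "(t + gL x) powr s - t powr s = t powr s * \<rho> powr (- s) * (1 - \<rho> powr s)"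
      using \<rho> t unfolding 1 by (simp add: powr_divide powr_minus field_simps)
    have 3: "((t + gL x) powr s - t powr s) powr (p - 1) = t powr (s * (p - 1)) * \<rho> powr (- s * (p - 1)) * (1 - \<rho> powr s) powr (p - 1)"
      unfolding 2 using \<rho> t r[of \<rho>] by (simp add: powr_mult powr_powr)
    have 4: "gL x powr (- \<gamma> - 1) = t powr (- \<gamma> - 1) * (1 - \<rho>) powr (- \<gamma> - 1) * \<rho> powr (\<gamma> + 1)"
    proof -
      have "\<rho> powr (\<gamma> + 1) = 1 / \<rho> powr (- \<gamma> - 1)"
        using powr_minus_divide[of \<rho> "- \<gamma> - 1"] by (simp add: add.commute)
      moreover have "(t * ((1 - \<rho>) / \<rho>)) powr (- \<gamma> - 1) = t powr (- \<gamma> - 1) * ((1 - \<rho>) / \<rho>) powr (- \<gamma> - 1)"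
        by (rule powr_mult)
      moreover have "((1 - \<rho>) / \<rho>) powr (- \<gamma> - 1) = (1 - \<rho>) powr (- \<gamma> - 1) / \<rho> powr (- \<gamma> - 1)"
        by (rule powr_divide)
      ultimately show ?thesis unfolding g by simp
    qed
    have 5: "t / x\<^sup>2 = t powr 1 * \<rho> powr (- 2)" using \<rho> t by (simp add: x_eq powr_minus powr_numeral field_simps)
    have "\<gamma> * gL x powr (- \<gamma> - 1) * ((t + gL x) powr s - t powr s) powr (p - 1) * (t / x\<^sup>2)
      = \<gamma> * (1 - \<rho> powr s) powr (p - 1) * (1 - \<rho>) powr (- \<gamma> - 1)
        * (t powr (- \<gamma> - 1) * t powr (s * (p - 1)) * t powr 1)
        * (\<rho> powr (\<gamma> + 1) * \<rho> powr (- s * (p - 1)) * \<rho> powr (- 2))"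
      unfolding 3 4 5 by (simp only: mult_ac)
    also have "t powr (- \<gamma> - 1) * t powr (s * (p - 1)) * t powr 1 = t powr (- s)"
      by (simp only: powr_add[symmetric]) (simp add: \<gamma>_def algebra_simps)
    also have "\<rho> powr (\<gamma> + 1) * \<rho> powr (- s * (p - 1)) * \<rho> powr (- 2) = \<rho> powr (s - 1)"
      by (simp only: powr_add[symmetric]) (simp add: \<gamma>_def algebra_simps)
    finally have "\<gamma> * gL x powr (- \<gamma> - 1) * ((t + gL x) powr s - t powr s) powr (p - 1) * (t / x\<^sup>2) = A (- x) * (- x) powr (s - 1)"
      by (simp add: A_def \<rho>_def mult_ac)
    then show ?thesis unfolding fL_def using t \<gamma> by (simp add: ennreal_mult[symmetric])
  qed
  have subR: "fR (gR x) * ennreal t = ennreal (A (- x))" if x: "- q \<le> x" "x \<le> 0" for x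
  proof -
    define \<rho> where "\<rho> = - x"
    have \<rho>: "0 \<le> \<rho>" "\<rho> < 1" using x q by (auto simp: \<rho>_def)
    have x_eq: "x = - \<rho>" by (simp add: \<rho>_def)
    have rs: "\<rho> powr s \<le> 1" using \<rho> s by (simp add: powr_le1)
    have g: "gR x = t * (1 - \<rho>)" by (simp add: gR_def x_eq)
    have 1: "t - gR x = t * \<rho>" by (simp add: g algebra_simps)
    have 2: "t powr s - (t - gR x) powr s = t powr s * (1 - \<rho> powr s)"
      using \<rho> t unfolding 1 by (simp add: powr_mult algebra_simps)
    have 3: "(t powr s - (t - gR x) powr s) powr (p - 1) = t powr (s * (p - 1)) * (1 - \<rho> powr s) powr (p - 1)"
      unfolding 2 using \<rho> t rs by (simp add: powr_mult powr_powr)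
    have 4: "gR x powr (- \<gamma> - 1) = t powr (- \<gamma> - 1) * (1 - \<rho>) powr (- \<gamma> - 1)"
      using \<rho> t unfolding g by (simp add: powr_mult)
    have "\<gamma> * gR x powr (- \<gamma> - 1) * (t powr s - (t - gR x) powr s) powr (p - 1) * t powr 1
      = \<gamma> * (1 - \<rho> powr s) powr (p - 1) * (1 - \<rho>) powr (- \<gamma> - 1)
        * (t powr (- \<gamma> - 1) * t powr (s * (p - 1)) * t powr 1)"
      unfolding 3 4 by (simp only: mult_ac)
    also have "t powr (- \<gamma> - 1) * t powr (s * (p - 1)) * t powr 1 = t powr (- s)"
      by (simp only: powr_add[symmetric]) (simp add: \<gamma>_def algebra_simps)
    finally have "\<gamma> * gR x powr (- \<gamma> - 1) * (t powr s - (t - gR x) powr s) powr (p - 1) * t = A (- x)"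
      using t by (simp add: A_def \<rho>_def mult_ac)
    then show ?thesis unfolding fR_def using t \<gamma> by (simp add: ennreal_mult[symmetric])
  qed
  have Rge: "(\<integral>\<^sup>+x. ennreal (A (- x)) * indicator {- q..0} x \<partial>lborel) + ennreal (t powr (- s)) \<le> ?R"
  proof -
    have "(\<integral>\<^sup>+x. ennreal (A (- x)) * indicator {- q..0} x \<partial>lborel) = (\<integral>\<^sup>+x. fR (gR x) * ennreal t * indicator {- q..0} x \<partial>lborel)"
      using subR by (intro nn_integral_cong) (auto simp: indicator_def)
    also have "\<dots> = (\<integral>\<^sup>+a. fR a * indicator {gR (- q)..gR 0} a \<partial>lborel)"
      using t q by (intro nn_integral_substitution_aux[symmetric]) (auto simp: gR_def[abs_def] intro!: derivative_eq_intros)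
    finally have 1: "(\<integral>\<^sup>+x. ennreal (A (- x)) * indicator {- q..0} x \<partial>lborel) = (\<integral>\<^sup>+a. fR a * indicator {gR (- q)..gR 0} a \<partial>lborel)" .
    \<comment> \<open>Increments a > t reach beyond the boundary point, where the profile is 0: the
      increment is then the full t^s, and the tail mass t^(-\<gamma>) times t^(s(p-1)) equals
      t^(-s).\<close>
    have "ennreal (t powr (- s)) = ennreal (t powr (s * (p - 1))) * emeasure (powm \<gamma>) {t<..}"
      using t \<gamma> by (simp add: emeasure_powm_greaterThan ennreal_mult[symmetric] powr_add[symmetric]) (simp add: \<gamma>_def algebra_simps)
    also have "\<dots> = (\<integral>\<^sup>+a. ennreal (t powr (s * (p - 1))) * indicator {t<..} a \<partial>powm \<gamma>)"
      by (simp add: nn_integral_cmult)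
    also have "\<dots> = (\<integral>\<^sup>+a. ennreal (\<gamma> * a powr (- \<gamma> - 1)) * indicator {0<..} a * (ennreal (t powr (s * (p - 1))) * indicator {t<..} a) \<partial>lborel)"
      by (rule nn_integral_powm) measurable
    finally have 2: "ennreal (t powr (- s)) = \<dots>" .
    have "(\<integral>\<^sup>+x. ennreal (A (- x)) * indicator {- q..0} x \<partial>lborel) + ennreal (t powr (- s))
      = (\<integral>\<^sup>+a. fR a * indicator {gR (- q)..gR 0} a + ennreal (\<gamma> * a powr (- \<gamma> - 1)) * indicator {0<..} a * (ennreal (t powr (s * (p - 1))) * indicator {t<..} a) \<partial>lborel)"
      unfolding 1 2 by (subst nn_integral_add) auto
    also have "\<dots> \<le> (\<integral>\<^sup>+a. ennreal (\<gamma> * a powr (- \<gamma> - 1)) * indicator {0<..} a * ennreal (if (1 - q) * t \<le> a then (t powr s - max 0 (t - a) powr s) powr (p - 1) else 0) \<partial>lborel)"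
    proof (rule nn_integral_mono)
      fix a :: real
      have g: "gR (- q) = (1 - q) * t" "gR 0 = t" "0 < (1 - q) * t" "(1 - q) * t < t" using t q by (auto simp: gR_def)
      show "fR a * indicator {gR (- q)..gR 0} a + ennreal (\<gamma> * a powr (- \<gamma> - 1)) * indicator {0<..} a * (ennreal (t powr (s * (p - 1))) * indicator {t<..} a)
         \<le> ennreal (\<gamma> * a powr (- \<gamma> - 1)) * indicator {0<..} a * ennreal (if (1 - q) * t \<le> a then (t powr s - max 0 (t - a) powr s) powr (p - 1) else 0)"
      proof (cases "a \<in> {(1 - q) * t..t}")
        case True
        then have "a > 0" using g by auto
        then show ?thesis using True g \<gamma> by (simp add: fR_def ennreal_mult[symmetric])
      next
        case False
        show ?thesis
        proof (cases "a > t")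
          case True
          then have "a > 0" "(1 - q) * t \<le> a" using g(4) t by linarith+
          moreover have "max 0 (t - a) = 0" using True by simp
          ultimately show ?thesis using True g(1,2) by (simp only: if_True) (simp add: powr_powr)
        qed (use False g in auto)
      qed
    qed
    also have "\<dots> = ?R"
      unfolding \<gamma>_def[symmetric] by (rule nn_integral_powm[symmetric]) measurable
    finally show ?thesis .
  qed
  have Ln: "(\<integral>\<^sup>+a. fL a * indicator {gL (- q)..gL (- e n)} a \<partial>lborel)
    \<le> (\<integral>\<^sup>+x. ennreal (A (- x)) * indicator {- q..0} x \<partial>lborel) + ennreal (t powr (- s))" for n
  proof -
    \<comment> \<open>After the substitution \<open>y \<mapsto> 1/y\<close> of the outer half, the difference of the two integrands is the derivative of \<open>F\<close>.\<close>
    define F where "F x = t powr (- s) * ((1 - (- x) powr s) powr p * (1 + x) powr (- \<gamma>))" for x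
    have F: "(F has_real_derivative A (- x) * ((- x) powr (s - 1) - 1)) (at x)" if x: "x \<in> {- q..- e n}" for x
    proof -
      define \<rho> where "\<rho> = - x"
      have \<rho>: "0 < \<rho>" "\<rho> < 1" using x q e[of n] by (auto simp: \<rho>_def)
      have x_eq: "x = - \<rho>" by (simp add: \<rho>_def)
      have 1: "1 - (- x) powr s > 0" using r[of \<rho>] \<rho> by (simp add: x_eq)
      have 2: "1 + x > 0" using \<rho> by (simp add: x_eq)
      have "(F has_real_derivative t powr (- s) * ((p * (1 - (- x) powr s) powr (p - 1) * (s * (- x) powr (s - 1))) * (1 + x) powr (- \<gamma>)
        + (1 - (- x) powr s) powr p * ((- \<gamma>) * (1 + x) powr (- \<gamma> - 1)))) (at x)"
        unfolding F_def using 1 2 \<rho> by (auto intro!: derivative_eq_intros simp: x_eq)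
      moreover have "(1 - \<rho> powr s) powr p = (1 - \<rho> powr s) powr (p - 1) * (1 - \<rho> powr s)"
        using 1 by (simp add: x_eq powr_diff)
      moreover have "(1 - \<rho>) powr (- \<gamma>) = (1 - \<rho>) powr (- \<gamma> - 1) * (1 - \<rho>)"
        using \<rho> by (simp add: powr_diff)
      moreover have "\<rho> powr s = \<rho> powr (s - 1) * \<rho>"
        using \<rho> by (simp add: powr_diff)
      ultimately show ?thesis
      proof -
        assume d: "(F has_real_derivative t powr (- s) * ((p * (1 - (- x) powr s) powr (p - 1) * (s * (- x) powr (s - 1))) * (1 + x) powr (- \<gamma>)
          + (1 - (- x) powr s) powr p * ((- \<gamma>) * (1 + x) powr (- \<gamma> - 1)))) (at x)"
          and a: "(1 - \<rho> powr s) powr p = (1 - \<rho> powr s) powr (p - 1) * (1 - \<rho> powr s)"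
          and b: "(1 - \<rho>) powr (- \<gamma>) = (1 - \<rho>) powr (- \<gamma> - 1) * (1 - \<rho>)"
          and c: "\<rho> powr s = \<rho> powr (s - 1) * \<rho>"
        define B where "B = (1 - \<rho> powr s) powr (p - 1)"
        define D where "D = (1 - \<rho>) powr (- \<gamma> - 1)"
        define Z where "Z = \<rho> powr (s - 1)"
        have "t powr (- s) * ((p * B * (s * Z)) * (D * (1 - \<rho>)) + B * (1 - Z * \<rho>) * ((- \<gamma>) * D))
          = t powr (- s) * \<gamma> * B * D * (Z - 1)"
          by (simp add: \<gamma>_def algebra_simps)
        then have "t powr (- s) * ((p * (1 - (- x) powr s) powr (p - 1) * (s * (- x) powr (s - 1))) * (1 + x) powr (- \<gamma>)
          + (1 - (- x) powr s) powr p * ((- \<gamma>) * (1 + x) powr (- \<gamma> - 1))) = A (- x) * ((- x) powr (s - 1) - 1)"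
          unfolding A_def x_eq minus_minus using a b c by (simp add: B_def D_def Z_def)
        then show ?thesis using d by simp
      qed
    qed
    have Z1: "(- x) powr (s - 1) \<ge> 1" if "x \<in> {- q..- e n}" for x
      using that e[of n] q s powr_mono2'[of "s - 1" "- x" 1] by auto
    have A0: "A x \<ge> 0" for x unfolding A_def using \<gamma> by simp
    have "(\<integral>\<^sup>+a. fL a * indicator {gL (- q)..gL (- e n)} a \<partial>lborel) = (\<integral>\<^sup>+x. fL (gL x) * ennreal (t / x\<^sup>2) * indicator {- q..- e n} x \<partial>lborel)"
    proof (rule nn_integral_substitution_aux)
      fix x assume x: "x \<in> {- q..- e n}"
      then have "x \<noteq> 0" using e[of n] by auto
      then show "(gL has_real_derivative t / x\<^sup>2) (at x)"
        unfolding gL_def[abs_def] by (auto intro!: derivative_eq_intros simp: power2_eq_square)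
      show "0 \<le> t / x\<^sup>2" using t by simp
    next
      show "continuous_on {- q..- e n} (\<lambda>x. t / x\<^sup>2)"
        using e[of n] by (auto intro!: continuous_intros)
    qed (use e[of n] in auto)
    also have "\<dots> = (\<integral>\<^sup>+x. ennreal (A (- x)) * indicator {- q..- e n} x + ennreal (A (- x) * ((- x) powr (s - 1) - 1)) * indicator {- q..- e n} x \<partial>lborel)"
    proof (rule nn_integral_cong)
      fix x
      show "fL (gL x) * ennreal (t / x\<^sup>2) * indicator {- q..- e n} x = ennreal (A (- x)) * indicator {- q..- e n} x + ennreal (A (- x) * ((- x) powr (s - 1) - 1)) * indicator {- q..- e n} x"
      proof (cases "x \<in> {- q..- e n}")
        case True
        then have "- q \<le> x" "x < 0" using e[of n] by auto
        from subL[OF this] show ?thesis using True A0[of "- x"] Z1[OF True]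
          by (simp add: ennreal_plus[symmetric] del: ennreal_plus) (simp add: algebra_simps)
      qed simp
    qed
    also have "\<dots> = (\<integral>\<^sup>+x. ennreal (A (- x)) * indicator {- q..- e n} x \<partial>lborel) + (\<integral>\<^sup>+x. ennreal (A (- x) * ((- x) powr (s - 1) - 1)) * indicator {- q..- e n} x \<partial>lborel)"
      by (rule nn_integral_add) auto
    also have "(\<integral>\<^sup>+x. ennreal (A (- x) * ((- x) powr (s - 1) - 1)) * indicator {- q..- e n} x \<partial>lborel) = ennreal (F (- e n) - F (- q))"
      using F Z1 A0 e[of n] by (intro nn_integral_FTC_Icc) (auto intro!: mult_nonneg_nonneg)
    \<comment> \<open>The limit of \<open>F\<close> at \<rho> = 0 is t^(-s), exactly what the region
      beyond the boundary contributes on the other side. That \<open>F\<close> stays below it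
      follows from \<rho> \<le> \<rho>^s and \<gamma> = s p < p.\<close>
    also have "\<dots> \<le> ennreal (t powr (- s))"
    proof (rule ennreal_leI)
      have en: "0 < e n" "e n < 1" using e[of n] q by auto
      have "e n powr 1 \<le> e n powr s" using en s by (intro powr_mono') auto
      then have "(1 - e n powr s) powr p \<le> (1 - e n) powr p"
        using en p r[of "e n"] by (intro powr_mono2) auto
      also have "\<dots> \<le> (1 - e n) powr \<gamma>"
        using en s p by (intro powr_mono') (auto simp: \<gamma>_def)
      finally have "(1 - e n powr s) powr p * (1 - e n) powr (- \<gamma>) \<le> (1 - e n) powr \<gamma> * (1 - e n) powr (- \<gamma>)"
        by (intro mult_right_mono) auto
      also have "\<dots> = 1" using en by (simp add: powr_add[symmetric])
      finally have "F (- e n) \<le> t powr (- s) * 1" unfolding F_def by (intro mult_left_mono) auto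
      moreover have "F (- q) \<ge> 0" unfolding F_def by simp
      ultimately show "F (- e n) - F (- q) \<le> t powr (- s)" by simp
    qed
    also have "(\<integral>\<^sup>+x. ennreal (A (- x)) * indicator {- q..- e n} x \<partial>lborel) \<le> (\<integral>\<^sup>+x. ennreal (A (- x)) * indicator {- q..0} x \<partial>lborel)"
      using e[of n] by (intro nn_integral_mono) (auto simp: indicator_def)
    finally show ?thesis by (simp add: add_mono)
  qed
  have "?L = (\<integral>\<^sup>+a. fL a * indicator {gL (- q)..} a \<partial>lborel)"
  proof -
    have "?L = (\<integral>\<^sup>+a. ennreal (\<gamma> * a powr (- \<gamma> - 1)) * indicator {0<..} a * ennreal (if (1 / q - 1) * t \<le> a then ((t + a) powr s - t powr s) powr (p - 1) else 0) \<partial>lborel)"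
      unfolding \<gamma>_def[symmetric] by (rule nn_integral_powm) measurable
    also have "\<dots> = (\<integral>\<^sup>+a. fL a * indicator {gL (- q)..} a \<partial>lborel)"
    proof (rule nn_integral_cong)
      fix a :: real
      have g: "gL (- q) = (1 / q - 1) * t" "0 < (1 / q - 1) * t" using t q by (auto simp: gL_def)
      show "ennreal (\<gamma> * a powr (- \<gamma> - 1)) * indicator {0<..} a * ennreal (if (1 / q - 1) * t \<le> a then ((t + a) powr s - t powr s) powr (p - 1) else 0)
        = fL a * indicator {gL (- q)..} a"
        using g \<gamma> by (auto simp: indicator_def fL_def ennreal_mult[symmetric])
    qed
    finally show ?thesis .
  qed
  also have "\<dots> = (\<integral>\<^sup>+a. (SUP n. fL a * indicator {gL (- q)..gL (- e n)} a) \<partial>lborel)"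
  proof (rule nn_integral_cong)
    fix a :: real
    show "fL a * indicator {gL (- q)..} a = (SUP n. fL a * indicator {gL (- q)..gL (- e n)} a)"
    proof (cases "gL (- q) \<le> a")
      case True
      obtain n :: nat where n: "a * q / t < real n" using reals_Archimedean2 by blast
      have "gL (- e n) = t * ((real n + 2) / q - 1)" 
      proof -
        have "1 / e n = (real n + 2) / q" by (simp add: e_def)
        then show ?thesis by (simp add: gL_def)
      qed
      moreover have "a \<le> t * ((real n + 2) / q - 1)"
      proof -
        have "a < real n * t / q" using n t q by (simp add: field_simps)
        moreover have "t * ((real n + 2) / q - 1) = real n * t / q + (2 / q - 1) * t"
          by (simp add: algebra_simps add_divide_distrib)
        moreover have "(2 / q - 1) * t \<ge> 0" using t q by (intro mult_nonneg_nonneg) (auto simp: field_simps)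
        ultimately show ?thesis by linarith
      qed
      ultimately have "a \<in> {gL (- q)..gL (- e n)}" using True by simp
      then have "fL a * indicator {gL (- q)..} a \<le> fL a * indicator {gL (- q)..gL (- e n)} a" using True by simp
      also have "\<dots> \<le> (SUP n. fL a * indicator {gL (- q)..gL (- e n)} a)" by (rule SUP_upper) simp
      finally have "fL a * indicator {gL (- q)..} a \<le> (SUP n. fL a * indicator {gL (- q)..gL (- e n)} a)" .
      moreover have "(SUP n. fL a * indicator {gL (- q)..gL (- e n)} a) \<le> fL a * indicator {gL (- q)..} a"
        by (rule SUP_least) (auto simp: indicator_def)
      ultimately show ?thesis by (rule antisym)
    qed auto
  qed
  also have "\<dots> = (SUP n. \<integral>\<^sup>+a. fL a * indicator {gL (- q)..gL (- e n)} a \<partial>lborel)"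
  proof (rule nn_integral_monotone_convergence_SUP)
    have "gL (- e m) \<le> gL (- e n)" if "m \<le> n" for m n
      using that t q by (simp add: gL_def e_def field_simps)
    then show "incseq (\<lambda>n a. fL a * indicator {gL (- q)..gL (- e n)} a)"
      by (fastforce simp: incseq_def le_fun_def indicator_def)
  qed auto
  also have "\<dots> \<le> (\<integral>\<^sup>+x. ennreal (A (- x)) * indicator {- q..0} x \<partial>lborel) + ennreal (t powr (- s))"
    by (rule SUP_least) (rule Ln)
  also have "\<dots> \<le> ?R" by (rule Rge)
  finally show ?thesis .
qed

section \<open>The kernel inequality behind the barrier\<close>

text \<open>The lower cut is the extension by zero across the boundary. The upper cut at
  \<open>L\<close> turns the harmonic half-line profile into a strict supersolution, since it
  removes part of the inflow from far away.\<close>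

definition clip :: "real \<Rightarrow> real \<Rightarrow> real" where
  "clip L d = max 0 (min L d)"

text \<open>One-sided part of the increment \<open>\<bar>d\<^sup>s - d'\<^sup>s\<bar>\<^bsup>p-1\<^esup>\<close>, cut off multiplicatively near the diagonal. With this
  cut-off (instead of \<open>\<bar>x - y\<bar> > \<epsilon>\<close>) the truncated half-line integrals of \<open>t\<^sup>s\<close> have a sign before passing to the limit,
  so that no principal values are needed.\<close>
definition cutp :: "real \<Rightarrow> real \<Rightarrow> real \<Rightarrow> real \<Rightarrow> real \<Rightarrow> real" where
  "cutp s p q d d' = (if d' \<le> q * d then (d powr s - d' powr s) powr (p - 1) else 0)"

text \<open>Splitting at \<open>L\<close>: below it \<open>e > \<delta>\<close> gives integrability
  at 0, above it the integrand is at most \<open>L powr e\<close> and the tail mass is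
  \<open>L powr (- \<delta>)\<close>.\<close>

lemma nn_integral_powm_bound:
  fixes H :: "real \<Rightarrow> real"
  assumes [measurable]: "H \<in> borel_measurable borel" and "0 < \<delta>" "\<delta> < e" "L > 0"
    and H: "\<And>a. a > 0 \<Longrightarrow> H a \<le> min a L powr e"
  shows "(\<integral>\<^sup>+a. ennreal (H a) \<partial>powm \<delta>) \<le> ennreal ((\<delta> / (e - \<delta>) + 1) * L powr (e - \<delta>))"
proof -
  have 1: "(\<integral>\<^sup>+a. ennreal (\<delta> * a powr (e - \<delta> - 1)) * indicator {0..L} a \<partial>lborel) = ennreal (\<delta> * (L powr (e - \<delta>) / (e - \<delta>)))"
  proof -
    have "((\<lambda>a. a powr (e - \<delta> - 1)) has_integral (L powr (e - \<delta> - 1 + 1) / (e - \<delta> - 1 + 1))) {0..L}"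
      using assms by (intro has_integral_powr_from_0) auto
    then have "((\<lambda>a. \<delta> * a powr (e - \<delta> - 1)) has_integral (\<delta> * (L powr (e - \<delta>) / (e - \<delta>)))) {0..L}"
      by (intro has_integral_mult_right) simp
    then have "(\<integral>\<^sup>+a. indicator {0..L} a * (\<delta> * a powr (e - \<delta> - 1)) \<partial>lborel) = ennreal (\<delta> * (L powr (e - \<delta>) / (e - \<delta>)))"
      using assms by (intro nn_integral_has_integral_lebesgue) auto
    moreover have "ennreal (indicator {0..L} a * (\<delta> * a powr (e - \<delta> - 1))) = ennreal (\<delta> * a powr (e - \<delta> - 1)) * indicator {0..L} a" for a
      by (auto simp: indicator_def)
    ultimately show ?thesis by simp
  qed
  have "(\<integral>\<^sup>+a. ennreal (H a) \<partial>powm \<delta>) = (\<integral>\<^sup>+a. ennreal (\<delta> * a powr (- \<delta> - 1)) * indicator {0<..} a * ennreal (H a) \<partial>lborel)"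
    by (rule nn_integral_powm) measurable
  also have "\<dots> \<le> (\<integral>\<^sup>+a. ennreal (\<delta> * a powr (e - \<delta> - 1)) * indicator {0..L} a
      + ennreal (\<delta> * a powr (- \<delta> - 1)) * indicator {0<..} a * (ennreal (L powr e) * indicator {L<..} a) \<partial>lborel)"
  proof (rule nn_integral_mono)
    fix a :: real
    show "ennreal (\<delta> * a powr (- \<delta> - 1)) * indicator {0<..} a * ennreal (H a)
       \<le> ennreal (\<delta> * a powr (e - \<delta> - 1)) * indicator {0..L} a
      + ennreal (\<delta> * a powr (- \<delta> - 1)) * indicator {0<..} a * (ennreal (L powr e) * indicator {L<..} a)"
    proof (cases "a > 0")
      case True
      have "ennreal (H a) \<le> ennreal (min a L powr e)" using H[OF True] by (rule ennreal_leI)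
      then have "ennreal (\<delta> * a powr (- \<delta> - 1)) * indicator {0<..} a * ennreal (H a) \<le> ennreal (\<delta> * a powr (- \<delta> - 1)) * ennreal (min a L powr e)"
        using True by (simp add: mult_left_mono)
      also have "\<dots> \<le> ennreal (\<delta> * a powr (e - \<delta> - 1)) * indicator {0..L} a
      + ennreal (\<delta> * a powr (- \<delta> - 1)) * indicator {0<..} a * (ennreal (L powr e) * indicator {L<..} a)"
      proof (cases "a \<le> L")
        case le: True
        have "a powr (- \<delta> - 1) * a powr e = a powr (e - \<delta> - 1)" by (simp add: powr_add[symmetric] algebra_simps)
        then have "\<delta> * a powr (- \<delta> - 1) * a powr e = \<delta> * a powr (e - \<delta> - 1)" by simp
        then show ?thesis using le True assms by (simp add: ennreal_mult[symmetric])
      qed (use True in auto)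
      finally show ?thesis .
    qed auto
  qed
  also have "\<dots> = ennreal (\<delta> * (L powr (e - \<delta>) / (e - \<delta>))) + (\<integral>\<^sup>+a. ennreal (\<delta> * a powr (- \<delta> - 1)) * indicator {0<..} a * (ennreal (L powr e) * indicator {L<..} a) \<partial>lborel)"
    unfolding 1[symmetric] by (rule nn_integral_add) auto
  also have "(\<integral>\<^sup>+a. ennreal (\<delta> * a powr (- \<delta> - 1)) * indicator {0<..} a * (ennreal (L powr e) * indicator {L<..} a) \<partial>lborel)
    = (\<integral>\<^sup>+a. ennreal (L powr e) * indicator {L<..} a \<partial>powm \<delta>)"
    by (rule nn_integral_powm[symmetric]) measurable
  also have "\<dots> = ennreal (L powr e) * ennreal (L powr (- \<delta>))"
    using assms by (simp add: nn_integral_cmult emeasure_powm_greaterThan)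
  also have "\<dots> = ennreal (L powr (e - \<delta>))"
    by (simp add: ennreal_mult[symmetric] powr_add[symmetric])
  also have "ennreal (\<delta> * (L powr (e - \<delta>) / (e - \<delta>))) + ennreal (L powr (e - \<delta>)) = ennreal ((\<delta> / (e - \<delta>) + 1) * L powr (e - \<delta>))"
    using assms by (subst ennreal_plus[symmetric]) (auto simp: algebra_simps)
  finally show ?thesis .
qed

text \<open>A ball of radius 1/2 around the multiple x of \<open>b\<close> with x . b = 3 lies in
  the half-space and in the ball of radius 7/2, uniformly for 1 \<le> |b| \<le> 2. The uniform
  constant becomes the strictness of the barrier.\<close>

lemma kmeas_half_space_lower:
  assumes "\<gamma> > 0"
  obtains c where "c > 0" "\<And>b :: 'a::euclidean_space. 1 \<le> norm b \<Longrightarrow> norm b \<le> 2 \<Longrightarrow>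
    ennreal c \<le> emeasure (kmeas \<gamma>) {z. 1 < z \<bullet> b}"
proof
  define c where "c = (7/2) powr (- (real DIM('a) + \<gamma>)) * (unit_ball_vol (real DIM('a)) * (1/2) ^ DIM('a))"
  show "c > 0" unfolding c_def by (intro mult_pos_pos) auto
  fix b :: 'a assume b: "1 \<le> norm b" "norm b \<le> 2"
  define x where "x = (3 / (norm b)\<^sup>2) *\<^sub>R b"
  have xb: "x \<bullet> b = 3" using b by (auto simp: x_def dot_square_norm)
  have nx: "norm x \<le> 3" using b by (auto simp: x_def power2_eq_square field_simps)
  have sub: "z \<in> {z. 1 < z \<bullet> b} \<and> norm z \<le> 7/2" if z: "z \<in> ball x (1/2)" for z
  proof -
    have d: "norm (z - x) < 1/2" using z by (simp add: dist_norm norm_minus_commute)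
    have "\<bar>(z - x) \<bullet> b\<bar> \<le> norm (z - x) * norm b" by (rule Cauchy_Schwarz_ineq2)
    also have "\<dots> \<le> 1/2 * 2" using d b by (intro mult_mono) auto
    finally have "z \<bullet> b \<ge> 2" using xb by (simp add: inner_diff_left)
    moreover have "norm z \<le> norm (z - x) + norm x" by (metis diff_add_cancel norm_triangle_ineq)
    ultimately show ?thesis using d nx by auto
  qed
  have [measurable]: "{z. 1 < z \<bullet> b} \<in> sets borel" by measurable
  have "ennreal c = ennreal ((7/2) powr (- (real DIM('a) + \<gamma>))) * emeasure lborel (ball x (1/2))"
    by (subst emeasure_ball) (auto simp: c_def ennreal_mult)
  also have "\<dots> = (\<integral>\<^sup>+z. ennreal ((7/2) powr (- (real DIM('a) + \<gamma>))) * indicator (ball x (1/2)) z \<partial>lborel)"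
    by (subst nn_integral_cmult_indicator) auto
  also have "\<dots> \<le> (\<integral>\<^sup>+z. ennreal (rker \<gamma> z) * indicator {z. 1 < z \<bullet> b} z \<partial>lborel)"
  proof (rule nn_integral_mono)
    fix z :: 'a
    show "ennreal ((7/2) powr (- (real DIM('a) + \<gamma>))) * indicator (ball x (1/2)) z \<le> ennreal (rker \<gamma> z) * indicator {z. 1 < z \<bullet> b} z"
    proof (cases "z \<in> ball x (1/2)")
      case True
      have "z \<noteq> 0" using sub[OF True] by auto
      then have "(7/2) powr (- (real DIM('a) + \<gamma>)) \<le> rker \<gamma> z"
        unfolding rker_def using sub[OF True] assms by (intro powr_mono2') auto
      then show ?thesis using True sub[OF True] by (auto intro: ennreal_leI)
    qed simp
  qed
  also have "\<dots> = emeasure (kmeas \<gamma>) {z. 1 < z \<bullet> b}" by (rule emeasure_kmeas[symmetric]) measurable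
  finally show "ennreal c \<le> emeasure (kmeas \<gamma>) {z. 1 < z \<bullet> b}" .
qed

text \<open>Both integrands depend on z only through \<theta>(z) = z . b + M |z|^2. By homogeneity
  the tails of z . b are c0 a^(-\<gamma>), a multiple of those of \<open>powm \<gamma>\<close>;
  replacing z . b by \<theta> costs a parabolic slab. The tail comparison thus reduces the claim to
  the half-line inequality, with a gain from the cap proportional to L^(-s) and errors proportional
  to (M L)^\<sigma> L^(-s), which are absorbed once M L is small.\<close>

lemma barrier_kernel:
  fixes s p :: real
  assumes s: "0 < s" "s < 1" and p: "p > 1"
  obtains e0 f0 :: real where "e0 > 0" "f0 > 0"
    "\<And>M L t q (b :: 'a::euclidean_space). M > 0 \<Longrightarrow> L > 0 \<Longrightarrow> M * L \<le> e0 \<Longrightarrow> 0 < t \<Longrightarrow> t \<le> L / 2 \<Longrightarrow>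
      1/2 \<le> q \<Longrightarrow> q < 1 \<Longrightarrow> 1 \<le> norm b \<Longrightarrow> norm b \<le> 2 \<Longrightarrow>
      (\<integral>\<^sup>+z. ennreal (cutp s p q (clip L (t + (z \<bullet> b + M * (norm z)\<^sup>2))) t) \<partial>kmeas (s * p)) + ennreal (f0 * L powr (- s))
      \<le> (\<integral>\<^sup>+z. ennreal (cutp s p q t (clip L (t + (z \<bullet> b + M * (norm z)\<^sup>2)))) \<partial>kmeas (s * p))"
proof -
  define \<gamma> where "\<gamma> = s * p"
  have \<gamma>: "\<gamma> > 0" "s < \<gamma>" using s p by (auto simp: \<gamma>_def)
  \<comment> \<open>Each bound has its purpose: \<sigma> < 1 for the slab estimate, \<sigma> <
    \<gamma> so that \<delta> = \<gamma> - \<sigma> is positive, and \<sigma> > s so that \<delta> <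
    s(p-1), which makes the error integrable near 0.\<close>
  obtain \<sigma> where \<sigma>: "s < \<sigma>" "\<sigma> < 1" "\<sigma> < \<gamma>"
    using dense[of s "min 1 \<gamma>"] s \<gamma> by auto
  define \<delta> where "\<delta> = \<gamma> - \<sigma>"
  have \<delta>: "\<delta> > 0" "s * (p - 1) - \<delta> = \<sigma> - s" using \<sigma> by (auto simp: \<delta>_def \<gamma>_def algebra_simps)
  obtain c where c: "c > 0" "\<And>b :: 'a. 1 \<le> norm b \<Longrightarrow> norm b \<le> 2 \<Longrightarrow> ennreal c \<le> emeasure (kmeas \<gamma>) {z. 1 < z \<bullet> b}"
    using kmeas_half_space_lower[OF \<gamma>(1)] by metis
  define K1 where "K1 = 12 * 6 ^ DIM('a) * unit_ball_vol (real DIM('a)) * (1/4) powr (\<sigma> - \<gamma>) / (1 - 2 powr (\<sigma> - \<gamma>))"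
  have "2 powr (\<sigma> - \<gamma>) < 1" using \<sigma> by (simp add: powr_less_one)
  then have K1: "K1 > 0" unfolding K1_def by (intro divide_pos_pos mult_pos_pos) auto
  \<comment> \<open>For increments beyond \<open>Lam * L\<close> the uncapped profile has grown by
    at least h L^s. Its power p - 1 is twice the largest capped value, so the cap removes at least
    L^(s(p-1)) there.\<close>
  define h where "h = 2 powr (1 / (p - 1))"
  have h: "h > 0" "h powr (p - 1) = 2" using p by (auto simp: h_def powr_powr)
  define Lam where "Lam = (1 + h) powr (1 / s)"
  have Lam: "Lam \<ge> 1" "Lam powr s = 1 + h" using h s by (auto simp: Lam_def powr_powr ge_one_powr_ge_zero)
  define E1 where "E1 = \<delta> / (\<sigma> - s) + 1"
  have E1: "E1 > 0" using \<delta> \<sigma> by (auto simp: E1_def intro!: add_nonneg_pos)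
  \<comment> \<open>The cap yields at least 2 f0 L^(-s). Half of it remains as strictness; the other
    half pays for the two slab errors, and \<open>e0\<close> is chosen for precisely this.\<close>
  define f0 where "f0 = c * Lam powr (- \<gamma>) / 2"
  have f0: "f0 > 0" using c Lam by (auto simp: f0_def)
  define e0 where "e0 = min 1 ((f0 / (2 * K1 * E1)) powr (1 / \<sigma>))"
  have e0: "e0 > 0" "e0 \<le> 1" using f0 K1 E1 by (auto simp: e0_def)
  have e0': "2 * K1 * E1 * e0 powr \<sigma> \<le> f0"
  proof -
    have "e0 powr \<sigma> \<le> ((f0 / (2 * K1 * E1)) powr (1 / \<sigma>)) powr \<sigma>"
      using e0 \<sigma> s by (intro powr_mono2) (auto simp: e0_def)
    also have "\<dots> = f0 / (2 * K1 * E1)" using \<sigma> s f0 K1 E1 by (simp add: powr_powr)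
    finally show ?thesis using K1 E1 by (simp add: field_simps)
  qed
  show ?thesis
  proof (rule that[OF e0(1) f0])
    fix M L t q :: real and b :: 'a
    assume M: "M > 0" and L: "L > 0" and hML: "M * L \<le> e0" and t: "0 < t" "t \<le> L / 2"
      and q: "1/2 \<le> q" "q < 1" and b: "1 \<le> norm b" "norm b \<le> 2"
    define \<theta> where "\<theta> z = z \<bullet> b + M * (norm z)\<^sup>2" for z
    have [measurable]: "\<theta> \<in> borel_measurable borel" unfolding \<theta>_def[abs_def] by measurable
    define c0 where "c0 = emeasure (kmeas \<gamma>) {z. 1 < z \<bullet> b}"
    have c0: "ennreal c \<le> c0" unfolding c0_def by (rule c(2)[OF b])
    \<comment> \<open>Inflow and outflow as monotone functions of one real variable: the two
      \<open>cutp\<close> terms are \<open>Hp (\<theta> z)\<close> and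
      \<open>Hm (- \<theta> z)\<close>.\<close>
    define Hp where "Hp a = (if (1 / q - 1) * t \<le> a then (min L (t + a) powr s - t powr s) powr (p - 1) else 0)" for a
    define Hm where "Hm a = (if (1 - q) * t \<le> a then (t powr s - max 0 (t - a) powr s) powr (p - 1) else 0)" for a
    have qt: "t / q \<le> 2 * t" "t / q > t" using q t by (auto simp: field_simps)
    have a0: "(1 / q - 1) * t > 0" "(1 - q) * t > 0" using q t by auto
    have monoHp: "mono Hp"
    proof (rule monoI)
      fix x y :: real assume xy: "x \<le> y"
      show "Hp x \<le> Hp y"
      proof (cases "(1 / q - 1) * t \<le> x")
        case True
        then have "x > 0" using a0 by linarith
        have "t powr s \<le> min L (t + x) powr s" using t s \<open>x > 0\<close> by (intro powr_mono2) auto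
        moreover have "min L (t + x) powr s \<le> min L (t + y) powr s" using t s \<open>x > 0\<close> xy L by (intro powr_mono2) auto
        ultimately have "(min L (t + x) powr s - t powr s) powr (p - 1) \<le> (min L (t + y) powr s - t powr s) powr (p - 1)"
          using p by (intro powr_mono2) auto
        then show ?thesis using True xy by (simp add: Hp_def)
      qed (auto simp: Hp_def)
    qed
    have monoHm: "mono Hm"
    proof (rule monoI)
      fix x y :: real assume xy: "x \<le> y"
      show "Hm x \<le> Hm y"
      proof (cases "(1 - q) * t \<le> x")
        case True
        then have "x > 0" using a0 by linarith
        have "max 0 (t - x) powr s \<le> t powr s" using t s \<open>x > 0\<close> by (intro powr_mono2) auto
        moreover have "max 0 (t - y) powr s \<le> max 0 (t - x) powr s" using t s \<open>x > 0\<close> xy L by (intro powr_mono2) auto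
        ultimately have "(t powr s - max 0 (t - x) powr s) powr (p - 1) \<le> (t powr s - max 0 (t - y) powr s) powr (p - 1)"
          using p by (intro powr_mono2) auto
        then show ?thesis using True xy by (simp add: Hm_def)
      qed (auto simp: Hm_def)
    qed
    have [measurable]: "Hp \<in> borel_measurable borel" "Hm \<in> borel_measurable borel"
      using monoHp monoHm by (auto intro: borel_measurable_mono)
    have L1: "M * a \<le> 1" if "a \<le> L" for a
      using mult_left_mono[OF that, of M] M hML e0 by linarith
    have half: "emeasure (kmeas \<gamma>) {z. a < z \<bullet> b} = ennreal (a powr (- \<gamma>)) * c0" if "a > 0" for a
    proof -
      have "emeasure (kmeas \<gamma>) {z. a < z \<bullet> b} = ennreal (a powr (- \<gamma>)) * emeasure (kmeas \<gamma>) {z. a *\<^sub>R z \<in> {z. a < z \<bullet> b}}"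
        by (rule emeasure_kmeas_scale) (use that in auto)
      also have "{z. a *\<^sub>R z \<in> {z. a < z \<bullet> b}} = {z. 1 < z \<bullet> b}" using that by auto
      finally show ?thesis by (simp add: c0_def)
    qed
    \<comment> \<open>Dilation by \<open>a\<close> moves the slab to level 1 and replaces the
      curvature \<open>M\<close> by \<open>M * a\<close>, which is at most 1 for
      \<open>a \<le> L\<close>. The remaining factor a^(-\<delta>) is a tail of
      \<open>powm \<delta>\<close>.\<close>
    have slab: "emeasure (kmeas \<gamma>) {z. \<bar>z \<bullet> b - a\<bar> \<le> M * (norm z)\<^sup>2} \<le> ennreal (K1 * M powr \<sigma>) * ennreal (a powr (- \<delta>))"
      if a: "0 < a" "a \<le> L" for a
    proof -
      have "emeasure (kmeas \<gamma>) {z. \<bar>z \<bullet> b - a\<bar> \<le> M * (norm z)\<^sup>2} = ennreal (a powr (- \<gamma>)) * emeasure (kmeas \<gamma>) {z. a *\<^sub>R z \<in> {z. \<bar>z \<bullet> b - a\<bar> \<le> M * (norm z)\<^sup>2}}"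
        by (rule emeasure_kmeas_scale) (use that in auto)
      also have "{z. a *\<^sub>R z \<in> {z. \<bar>z \<bullet> b - a\<bar> \<le> M * (norm z)\<^sup>2}} = {z. \<bar>z \<bullet> b - 1\<bar> \<le> (M * a) * (norm z)\<^sup>2}"
      proof -
        have "\<bar>(a *\<^sub>R z) \<bullet> b - a\<bar> \<le> M * (norm (a *\<^sub>R z))\<^sup>2 \<longleftrightarrow> \<bar>z \<bullet> b - 1\<bar> \<le> (M * a) * (norm z)\<^sup>2" for z
        proof -
          have "\<bar>(a *\<^sub>R z) \<bullet> b - a\<bar> = a * \<bar>z \<bullet> b - 1\<bar>"
          proof -
            have "(a *\<^sub>R z) \<bullet> b - a = a * (z \<bullet> b - 1)" by (simp add: algebra_simps)
            then show ?thesis using a by (simp add: abs_mult)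
          qed
          moreover have "M * (norm (a *\<^sub>R z))\<^sup>2 = a * ((M * a) * (norm z)\<^sup>2)" using a by (simp add: power2_eq_square)
          ultimately show ?thesis using a(1) by (simp only: mult_le_cancel_left_pos)
        qed
        then show ?thesis by auto
      qed
      also have "emeasure (kmeas \<gamma>) {z. \<bar>z \<bullet> b - 1\<bar> \<le> (M * a) * (norm z)\<^sup>2} \<le> ennreal (K1 * (M * a) powr \<sigma>)"
        unfolding K1_def by (rule kmeas_parabolic_slab) (use a M b \<sigma> s L1 in auto)
      also have "ennreal (a powr (- \<gamma>)) * ennreal (K1 * (M * a) powr \<sigma>) = ennreal (K1 * M powr \<sigma> * a powr (- \<delta>))"
      proof -
        have "a powr (- \<gamma>) * a powr \<sigma> = a powr (- \<delta>)" by (simp add: powr_add[symmetric] \<delta>_def)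
        then have "a powr (- \<gamma>) * (K1 * (M * a) powr \<sigma>) = K1 * M powr \<sigma> * a powr (- \<delta>)"
          using M a by (simp add: powr_mult mult_ac)
        then show ?thesis using K1 by (simp add: ennreal_mult[symmetric])
      qed
      finally show ?thesis using K1 by (simp add: ennreal_mult mult_left_mono)
    qed
    have tail1: "1 * emeasure (kmeas \<gamma>) {z \<in> space (kmeas \<gamma>). a \<le> \<theta> z}
      \<le> c0 * emeasure (powm \<gamma>) {x \<in> space (powm \<gamma>). a < x} + ennreal (K1 * M powr \<sigma>) * emeasure (powm \<delta>) {x \<in> space (powm \<delta>). a < x}"
      if a: "(1 / q - 1) * t \<le> a" "a \<le> L" for a
    proof -
      have a_pos: "a > 0" using a a0 by linarith
      have "emeasure (kmeas \<gamma>) {z. a \<le> \<theta> z} \<le> emeasure (kmeas \<gamma>) ({z. a < z \<bullet> b} \<union> {z. \<bar>z \<bullet> b - a\<bar> \<le> M * (norm z)\<^sup>2})"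
        by (rule emeasure_mono) (auto simp: \<theta>_def)
      also have "\<dots> \<le> emeasure (kmeas \<gamma>) {z. a < z \<bullet> b} + emeasure (kmeas \<gamma>) {z. \<bar>z \<bullet> b - a\<bar> \<le> M * (norm z)\<^sup>2}"
        by (rule emeasure_subadditive) auto
      also have "\<dots> \<le> ennreal (a powr (- \<gamma>)) * c0 + ennreal (K1 * M powr \<sigma>) * ennreal (a powr (- \<delta>))"
        using half[OF a_pos] slab[OF a_pos a(2)] by (intro add_mono) auto
      also have "ennreal (a powr (- \<gamma>)) = emeasure (powm \<gamma>) {a<..}" using a_pos \<gamma> by (simp add: emeasure_powm_greaterThan)
      also have "ennreal (a powr (- \<delta>)) = emeasure (powm \<delta>) {a<..}" using a_pos \<delta> by (simp add: emeasure_powm_greaterThan)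
      finally show ?thesis by (simp add: mult.commute greaterThan_def)
    qed
    have tail2: "c0 * emeasure (powm \<gamma>) {x \<in> space (powm \<gamma>). a \<le> x}
      \<le> 1 * emeasure (kmeas \<gamma>) {z \<in> space (kmeas \<gamma>). a < - \<theta> z} + ennreal (K1 * M powr \<sigma>) * emeasure (powm \<delta>) {x \<in> space (powm \<delta>). a < x}"
      if a: "(1 - q) * t \<le> a" "a \<le> L" for a
    proof -
      have a_pos: "a > 0" using a a0 by linarith
      have "c0 * emeasure (powm \<gamma>) {a..} = emeasure (kmeas \<gamma>) {z. a < z \<bullet> b}"
        using half[OF a_pos] a_pos \<gamma> by (simp add: emeasure_powm_atLeast mult.commute)
      also have "\<dots> = emeasure (kmeas \<gamma>) {z. - z \<in> {z. a < z \<bullet> b}}"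
        by (rule emeasure_kmeas_uminus[symmetric]) measurable
      also have "\<dots> \<le> emeasure (kmeas \<gamma>) ({z. a < - \<theta> z} \<union> {z. - z \<in> {z. \<bar>z \<bullet> b - a\<bar> \<le> M * (norm z)\<^sup>2}})"
        by (rule emeasure_mono) (auto simp: \<theta>_def)
      also have "\<dots> \<le> emeasure (kmeas \<gamma>) {z. a < - \<theta> z} + emeasure (kmeas \<gamma>) {z. - z \<in> {z. \<bar>z \<bullet> b - a\<bar> \<le> M * (norm z)\<^sup>2}}"
        by (rule emeasure_subadditive) auto
      also have "emeasure (kmeas \<gamma>) {z. - z \<in> {z. \<bar>z \<bullet> b - a\<bar> \<le> M * (norm z)\<^sup>2}} = emeasure (kmeas \<gamma>) {z. \<bar>z \<bullet> b - a\<bar> \<le> M * (norm z)\<^sup>2}"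
        by (rule emeasure_kmeas_uminus) measurable
      also have "\<dots> \<le> ennreal (K1 * M powr \<sigma>) * ennreal (a powr (- \<delta>))" by (rule slab[OF a_pos a(2)])
      also have "ennreal (a powr (- \<delta>)) = emeasure (powm \<delta>) {a<..}" using a_pos \<delta> by (simp add: emeasure_powm_greaterThan)
      finally show ?thesis by (simp add: greaterThan_def atLeast_def add_mono)
    qed
    have HpL: "Hp a = Hp L" if "L \<le> a" for a
    proof -
      have "(1 / q - 1) * t = t / q - t" by (simp add: algebra_simps)
      then have "(1 / q - 1) * t \<le> L" "(1 / q - 1) * t \<le> a" using qt t that by linarith+
      then show ?thesis using that t by (simp add: Hp_def)
    qed
    have HmL: "Hm a = Hm L" if "L \<le> a" for a
    proof -
      have "(1 - q) * t \<le> 1 * t" using q t by (intro mult_right_mono) auto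
      then have "(1 - q) * t \<le> L" "(1 - q) * t \<le> a" "t \<le> L" "t \<le> a" using t that by linarith+
      then show ?thesis by (simp add: Hm_def)
    qed
    have I1: "1 * (\<integral>\<^sup>+z. ennreal (Hp (\<theta> z)) \<partial>kmeas \<gamma>)
      \<le> c0 * (\<integral>\<^sup>+x. ennreal (Hp x) \<partial>powm \<gamma>) + ennreal (K1 * M powr \<sigma>) * (\<integral>\<^sup>+x. ennreal (Hp x) \<partial>powm \<delta>)"
      by (rule nn_integral_mono_tails[OF sigma_finite_kmeas sigma_finite_powm sigma_finite_powm _ _ _ monoHp _ HpL tail1])
         (auto simp: Hp_def)
    have I2: "c0 * (\<integral>\<^sup>+x. ennreal (Hm x) \<partial>powm \<gamma>)
      \<le> 1 * (\<integral>\<^sup>+z. ennreal (Hm (- \<theta> z)) \<partial>kmeas \<gamma>) + ennreal (K1 * M powr \<sigma>) * (\<integral>\<^sup>+x. ennreal (Hm x) \<partial>powm \<delta>)"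
      by (rule nn_integral_mono_tails[OF sigma_finite_powm sigma_finite_kmeas sigma_finite_powm _ _ _ monoHm _ HmL tail2])
         (auto simp: Hm_def)
    define Hi where "Hi a = (if (1 / q - 1) * t \<le> a then ((t + a) powr s - t powr s) powr (p - 1) else 0)" for a
    have [measurable]: "Hi \<in> borel_measurable borel" unfolding Hi_def[abs_def] by measurable
    have I3: "(\<integral>\<^sup>+a. ennreal (Hi a) \<partial>powm \<gamma>) \<le> (\<integral>\<^sup>+a. ennreal (Hm a) \<partial>powm \<gamma>)"
      unfolding Hi_def Hm_def \<gamma>_def by (rule powm_half_line_harmonic) (use s p t q in auto)
    \<comment> \<open>The origin of strictness: beyond \<open>Lam * L\<close> the difference of
      uncapped and capped integrand is at least L^(s(p-1)), and that range has mass (Lam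
      L)^(-\<gamma>).\<close>
    have I4: "(\<integral>\<^sup>+a. ennreal (Hp a) \<partial>powm \<gamma>) + ennreal (Lam powr (- \<gamma>) * L powr (- s)) \<le> (\<integral>\<^sup>+a. ennreal (Hi a) \<partial>powm \<gamma>)"
    proof -
      have "ennreal (Lam powr (- \<gamma>) * L powr (- s)) = ennreal (L powr (s * (p - 1))) * ennreal ((Lam * L) powr (- \<gamma>))"
      proof -
        have "L powr (s * (p - 1)) * L powr (- \<gamma>) = L powr (- s)"
          by (simp add: powr_add[symmetric] \<gamma>_def algebra_simps)
        then have "Lam powr (- \<gamma>) * L powr (- s) = L powr (s * (p - 1)) * (Lam * L) powr (- \<gamma>)"
          using L Lam by (simp add: powr_mult mult_ac)
        then show ?thesis by (simp add: ennreal_mult[symmetric])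
      qed
      also have "ennreal ((Lam * L) powr (- \<gamma>)) = emeasure (powm \<gamma>) {Lam * L..}"
        using Lam L \<gamma> by (intro emeasure_powm_atLeast[symmetric]) auto
      also have "ennreal (L powr (s * (p - 1))) * emeasure (powm \<gamma>) {Lam * L..} = (\<integral>\<^sup>+a. ennreal (L powr (s * (p - 1))) * indicator {Lam * L..} a \<partial>powm \<gamma>)"
        by (simp add: nn_integral_cmult)
      finally have "(\<integral>\<^sup>+a. ennreal (Hp a) \<partial>powm \<gamma>) + ennreal (Lam powr (- \<gamma>) * L powr (- s))
        = (\<integral>\<^sup>+a. ennreal (Hp a) + ennreal (L powr (s * (p - 1))) * indicator {Lam * L..} a \<partial>powm \<gamma>)"
        by (simp add: nn_integral_add)
      also have "\<dots> \<le> (\<integral>\<^sup>+a. ennreal (Hi a) \<partial>powm \<gamma>)"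
      proof (rule nn_integral_mono)
        fix a :: real
        have LL: "Lam * L \<ge> 1 * L" using Lam L by (intro mult_right_mono) auto
        show "ennreal (Hp a) + ennreal (L powr (s * (p - 1))) * indicator {Lam * L..} a \<le> ennreal (Hi a)"
        proof (cases "(1 / q - 1) * t \<le> a")
          case False
          have "(1 / q - 1) * t = t / q - t" by (simp add: algebra_simps)
          then have "a < Lam * L" using False qt t LL by linarith
          then show ?thesis using False by (simp add: Hp_def)
        next
          case True
          then have ap: "a > 0" using a0 by linarith
          have t1: "t powr s \<le> min L (t + a) powr s" using t s ap by (intro powr_mono2) auto
          have t2: "min L (t + a) powr s \<le> (t + a) powr s" using t s ap L by (intro powr_mono2) auto
          show ?thesis
          proof (cases "Lam * L \<le> a")
            case False
            have "(min L (t + a) powr s - t powr s) powr (p - 1) \<le> ((t + a) powr s - t powr s) powr (p - 1)"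
              using t1 t2 p by (intro powr_mono2) auto
            then show ?thesis using True False by (auto simp: Hp_def Hi_def intro: ennreal_leI)
          next
            case aLam: True
            have "(min L (t + a) powr s - t powr s) powr (p - 1) \<le> (L powr s) powr (p - 1)"
            proof (rule powr_mono2)
              have "min L (t + a) powr s \<le> L powr s" using t s ap L by (intro powr_mono2) auto
              then show "min L (t + a) powr s - t powr s \<le> L powr s" using powr_ge_zero[of t s] by linarith
            qed (use t1 p in auto)
            moreover have "2 * (L powr s) powr (p - 1) \<le> ((t + a) powr s - t powr s) powr (p - 1)"
            proof -
              have "(1 + h) * L powr s = (Lam * L) powr s" using Lam L by (simp add: powr_mult)
              also have "\<dots> \<le> (t + a) powr s" using aLam t s Lam L by (intro powr_mono2) auto
              finally have "(1 + h) * L powr s \<le> (t + a) powr s" .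
              moreover have "t powr s \<le> L powr s" using t s L by (intro powr_mono2) auto
              ultimately have "h * L powr s \<le> (t + a) powr s - t powr s" by (simp add: algebra_simps)
              then have "(h * L powr s) powr (p - 1) \<le> ((t + a) powr s - t powr s) powr (p - 1)"
                using h p by (intro powr_mono2) auto
              then show ?thesis using h by (simp add: powr_mult)
            qed
            ultimately have "Hp a + L powr (s * (p - 1)) \<le> Hi a"
              using True by (simp add: Hp_def Hi_def powr_powr)
            moreover have "Hp a \<ge> 0" by (simp add: Hp_def)
            ultimately show ?thesis using aLam by (simp add: ennreal_plus[symmetric] ennreal_leI del: ennreal_plus)
          qed
        qed
      qed
      finally show ?thesis .
    qed
    define E where "E = ennreal (E1 * L powr (\<sigma> - s))"
    have I5: "(\<integral>\<^sup>+a. ennreal (Hp a) \<partial>powm \<delta>) \<le> E"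
    proof -
      have "Hp a \<le> min a L powr (s * (p - 1))" if "a > 0" for a
      proof -
        have "(min L (t + a) powr s - t powr s) powr (p - 1) \<le> (min a L powr s) powr (p - 1)"
        proof (rule powr_mono2)
          have "min L (t + a) powr s \<le> (t + min a L) powr s" using t that L s by (intro powr_mono2) auto
          also have "\<dots> \<le> t powr s + min a L powr s" using t that L s by (intro powr_add_le) auto
          finally show "min L (t + a) powr s - t powr s \<le> min a L powr s" by simp
          show "0 \<le> min L (t + a) powr s - t powr s" using t s that powr_mono2[of s t "min L (t + a)"] by auto
        qed (use p in auto)
        then show ?thesis by (simp add: Hp_def powr_powr)
      qed
      from nn_integral_powm_bound[OF _ _ _ L this, of \<delta>] show ?thesis
        using \<delta> \<sigma> by (simp add: E_def E1_def)
    qed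
    have I6: "(\<integral>\<^sup>+a. ennreal (Hm a) \<partial>powm \<delta>) \<le> E"
    proof -
      have "Hm a \<le> min a L powr (s * (p - 1))" if "a > 0" for a
      proof -
        have "(t powr s - max 0 (t - a) powr s) powr (p - 1) \<le> (min a L powr s) powr (p - 1)"
        proof (rule powr_mono2)
          have "t powr s \<le> (max 0 (t - a) + min a L) powr s" using t that L s by (intro powr_mono2) auto
          also have "\<dots> \<le> max 0 (t - a) powr s + min a L powr s" using t that L s by (intro powr_add_le) auto
          finally show "t powr s - max 0 (t - a) powr s \<le> min a L powr s" by simp
          show "0 \<le> t powr s - max 0 (t - a) powr s" using t s that powr_mono2[of s "max 0 (t - a)" t] by auto
        qed (use p in auto)
        then show ?thesis by (simp add: Hm_def powr_powr)
      qed
      from nn_integral_powm_bound[OF _ _ _ L this, of \<delta>] show ?thesis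
        using \<delta> \<sigma> by (simp add: E_def E1_def)
    qed
    define Ip where "Ip = (\<integral>\<^sup>+z. ennreal (Hm (- \<theta> z)) \<partial>kmeas \<gamma>)"
    define Im where "Im = (\<integral>\<^sup>+z. ennreal (Hp (\<theta> z)) \<partial>kmeas \<gamma>)"
    define K where "K = ennreal (K1 * M powr \<sigma>)"
    define G where "G = ennreal (Lam powr (- \<gamma>) * L powr (- s))"
    have KE: "K * E + K * E \<le> ennreal (f0 * L powr (- s))"
    proof -
      have "(M * L) powr \<sigma> \<le> e0 powr \<sigma>" using M L hML \<sigma> s by (intro powr_mono2) auto
      then have "2 * K1 * E1 * (M * L) powr \<sigma> \<le> 2 * K1 * E1 * e0 powr \<sigma>" using K1 E1 by (intro mult_left_mono) auto
      then have "2 * K1 * E1 * (M * L) powr \<sigma> * L powr (- s) \<le> f0 * L powr (- s)"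
        using e0' by (intro mult_right_mono) auto
      moreover have "2 * K1 * E1 * (M * L) powr \<sigma> * L powr (- s) = 2 * (K1 * M powr \<sigma> * (E1 * L powr (\<sigma> - s)))"
      proof -
        have "L powr \<sigma> * L powr (- s) = L powr (\<sigma> - s)" by (simp add: powr_add[symmetric])
        then show ?thesis using M L by (simp add: powr_mult mult_ac)
      qed
      moreover have "K * E + K * E = ennreal (2 * (K1 * M powr \<sigma> * (E1 * L powr (\<sigma> - s))))"
        using K1 E1 unfolding K_def E_def by (simp add: ennreal_mult[symmetric] ennreal_plus[symmetric] del: ennreal_plus)
      ultimately show ?thesis by (simp add: ennreal_leI)
    qed
    have "Im + ennreal (2 * f0 * L powr (- s)) \<le> Im + c0 * G"
    proof -
      have "ennreal (2 * f0 * L powr (- s)) = ennreal c * G"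
        using c unfolding G_def by (simp add: f0_def ennreal_mult[symmetric] mult_ac)
      also have "\<dots> \<le> c0 * G" by (intro mult_right_mono c0) auto
      finally show ?thesis by (intro add_left_mono)
    qed
    also have "\<dots> \<le> (c0 * (\<integral>\<^sup>+x. ennreal (Hp x) \<partial>powm \<gamma>) + K * E) + c0 * G"
    proof (rule add_right_mono)
      have "Im \<le> c0 * (\<integral>\<^sup>+x. ennreal (Hp x) \<partial>powm \<gamma>) + K * (\<integral>\<^sup>+x. ennreal (Hp x) \<partial>powm \<delta>)"
        using I1 by (simp add: Im_def K_def)
      also have "\<dots> \<le> c0 * (\<integral>\<^sup>+x. ennreal (Hp x) \<partial>powm \<gamma>) + K * E"
        by (intro add_left_mono mult_left_mono I5) auto
      finally show "Im \<le> c0 * (\<integral>\<^sup>+x. ennreal (Hp x) \<partial>powm \<gamma>) + K * E" .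
    qed
    also have "\<dots> = c0 * ((\<integral>\<^sup>+x. ennreal (Hp x) \<partial>powm \<gamma>) + G) + K * E" by (simp add: algebra_simps)
    also have "\<dots> \<le> c0 * (\<integral>\<^sup>+x. ennreal (Hm x) \<partial>powm \<gamma>) + K * E"
      using I4 I3 unfolding G_def by (intro add_right_mono mult_left_mono) auto
    also have "\<dots> \<le> (Ip + K * E) + K * E"
    proof (rule add_right_mono)
      have "c0 * (\<integral>\<^sup>+x. ennreal (Hm x) \<partial>powm \<gamma>) \<le> Ip + K * (\<integral>\<^sup>+x. ennreal (Hm x) \<partial>powm \<delta>)"
        using I2 by (simp add: Ip_def K_def)
      also have "\<dots> \<le> Ip + K * E" by (intro add_left_mono mult_left_mono I6) auto
      finally show "c0 * (\<integral>\<^sup>+x. ennreal (Hm x) \<partial>powm \<gamma>) \<le> Ip + K * E" .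
    qed
    also have "\<dots> = Ip + (K * E + K * E)" by (simp add: add.assoc)
    also have "\<dots> \<le> Ip + ennreal (f0 * L powr (- s))" by (intro add_left_mono KE)
    finally have "Im + ennreal (2 * f0 * L powr (- s)) \<le> Ip + ennreal (f0 * L powr (- s))" .
    moreover have "ennreal (2 * f0 * L powr (- s)) = ennreal (f0 * L powr (- s)) + ennreal (f0 * L powr (- s))"
      using f0 by (simp add: ennreal_plus[symmetric] del: ennreal_plus)
    ultimately have "(Im + ennreal (f0 * L powr (- s))) + ennreal (f0 * L powr (- s)) \<le> Ip + ennreal (f0 * L powr (- s))"
      by (simp add: add.assoc)
    then have fin: "Im + ennreal (f0 * L powr (- s)) \<le> Ip"
      by (simp add: ennreal_add_left_cancel_le add.commute)
    have cp: "cutp s p q (clip L (t + \<theta> z)) t = Hp (\<theta> z)" for z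
    proof -
      \<comment> \<open>From t \<le> L/2 and q \<ge> 1/2 one gets t / q \<le> L, so the cap never
        interferes with the diagonal cut-off.\<close>
      have "t \<le> q * clip L (t + \<theta> z) \<longleftrightarrow> t / q \<le> clip L (t + \<theta> z)" using q by (simp add: field_simps)
      also have "\<dots> \<longleftrightarrow> t / q \<le> t + \<theta> z" using qt t unfolding clip_def by linarith
      also have "\<dots> \<longleftrightarrow> (1 / q - 1) * t \<le> \<theta> z" by (simp add: algebra_simps)
      finally have iff: "t \<le> q * clip L (t + \<theta> z) \<longleftrightarrow> (1 / q - 1) * t \<le> \<theta> z" .
      show ?thesis
      proof (cases "(1 / q - 1) * t \<le> \<theta> z")
        case True
        then have "clip L (t + \<theta> z) = min L (t + \<theta> z)" using a0 t L unfolding clip_def by linarith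
        then show ?thesis using True iff by (simp add: cutp_def Hp_def)
      qed (use iff in \<open>simp add: cutp_def Hp_def\<close>)
    qed
    have cm: "cutp s p q t (clip L (t + \<theta> z)) = Hm (- \<theta> z)" for z
    proof -
      have qt': "q * t < t" "q * t > 0" using q t by auto
      have "clip L (t + \<theta> z) \<le> q * t \<longleftrightarrow> t + \<theta> z \<le> q * t" using qt' t unfolding clip_def by linarith
      also have "\<dots> \<longleftrightarrow> (1 - q) * t \<le> - \<theta> z" by (auto simp: algebra_simps)
      finally have iff: "clip L (t + \<theta> z) \<le> q * t \<longleftrightarrow> (1 - q) * t \<le> - \<theta> z" .
      show ?thesis
      proof (cases "(1 - q) * t \<le> - \<theta> z")
        case True
        then have "clip L (t + \<theta> z) = max 0 (t - - \<theta> z)" using a0 t L unfolding clip_def by linarith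
        then show ?thesis using True iff by (simp add: cutp_def Hm_def)
      qed (use iff in \<open>simp add: cutp_def Hm_def\<close>)
    qed
    show "(\<integral>\<^sup>+z. ennreal (cutp s p q (clip L (t + (z \<bullet> b + M * (norm z)\<^sup>2))) t) \<partial>kmeas (s * p)) + ennreal (f0 * L powr (- s))
      \<le> (\<integral>\<^sup>+z. ennreal (cutp s p q t (clip L (t + (z \<bullet> b + M * (norm z)\<^sup>2)))) \<partial>kmeas (s * p))"
      unfolding \<theta>_def[symmetric] \<gamma>_def[symmetric] cp cm Im_def[symmetric] Ip_def[symmetric] by (rule fin)
  qed
qed

section \<open>The Gagliardo energy and truncation below a barrier\<close>

text \<open>With the kernel inside the measure, energy inequalities reduce to pointwise inequalities
  between increments of two functions.\<close>

definition pmeas :: "real \<Rightarrow> ('a::euclidean_space \<times> 'a) measure" where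
  "pmeas \<gamma> = density (lborel \<Otimes>\<^sub>M lborel) (\<lambda>w. ennreal (rker \<gamma> (fst w - snd w)))"

lemma sets_pmeas [measurable_cong, simp]: "sets (pmeas \<gamma>) = sets (borel \<Otimes>\<^sub>M borel)"
  by (simp add: pmeas_def cong: sets_pair_measure_cong)

lemma space_pmeas [simp]: "space (pmeas \<gamma>) = UNIV"
  by (simp add: pmeas_def space_pair_measure)

lemma gagliardo_pmeas:
  fixes u :: "'a::euclidean_space \<Rightarrow> real"
  assumes [measurable]: "u \<in> borel_measurable borel"
  shows "gagliardo s p u = (\<integral>\<^sup>+w. ennreal (\<bar>u (fst w) - u (snd w)\<bar> powr p) \<partial>pmeas (s * p))"
proof -
  have "(\<integral>\<^sup>+w. ennreal (\<bar>u (fst w) - u (snd w)\<bar> powr p) \<partial>pmeas (s * p))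
    = (\<integral>\<^sup>+w. ennreal (rker (s * p) (fst w - snd w)) * ennreal (\<bar>u (fst w) - u (snd w)\<bar> powr p) \<partial>(lborel \<Otimes>\<^sub>M lborel))"
    unfolding pmeas_def by (rule nn_integral_density) measurable
  also have "\<dots> = gagliardo s p u"
    unfolding gagliardo_def rker_def
    by (intro nn_integral_cong) (auto simp: ennreal_mult[symmetric] powr_minus_divide simp del: minus_add_distrib)
  finally show ?thesis ..
qed

lemma nn_integral_kmeas_translate:
  fixes f :: "'a::euclidean_space \<Rightarrow> ennreal"
  assumes [measurable]: "f \<in> borel_measurable borel"
  shows "(\<integral>\<^sup>+y. ennreal (rker \<gamma> (x - y)) * f y \<partial>lborel) = (\<integral>\<^sup>+z. f (x + z) \<partial>kmeas \<gamma>)"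
proof -
  have "(\<integral>\<^sup>+y. ennreal (rker \<gamma> (x - y)) * f y \<partial>lborel) = (\<integral>\<^sup>+y. ennreal (rker \<gamma> (x - y)) * f y \<partial>distr lborel borel ((+) x))"
    by (simp add: lborel_distr_plus)
  also have "\<dots> = (\<integral>\<^sup>+z. ennreal (rker \<gamma> (- z)) * f (x + z) \<partial>lborel)"
    by (subst nn_integral_distr) auto
  also have "\<dots> = (\<integral>\<^sup>+z. f (x + z) \<partial>kmeas \<gamma>)"
    by (subst nn_integral_kmeas) auto
  finally show ?thesis .
qed

lemma nn_integral_pmeas:
  fixes F :: "'a::euclidean_space \<times> 'a \<Rightarrow> ennreal"
  assumes [measurable]: "F \<in> borel_measurable (borel \<Otimes>\<^sub>M borel)"
  shows "(\<integral>\<^sup>+w. F w \<partial>pmeas \<gamma>) = (\<integral>\<^sup>+x. \<integral>\<^sup>+z. F (x, x + z) \<partial>kmeas \<gamma> \<partial>lborel)"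
proof -
  have "(\<integral>\<^sup>+w. F w \<partial>pmeas \<gamma>) = (\<integral>\<^sup>+w. ennreal (rker \<gamma> (fst w - snd w)) * F w \<partial>(lborel \<Otimes>\<^sub>M lborel))"
    unfolding pmeas_def by (rule nn_integral_density) measurable
  also have "\<dots> = (\<integral>\<^sup>+x. \<integral>\<^sup>+y. ennreal (rker \<gamma> (x - y)) * F (x, y) \<partial>lborel \<partial>lborel)"
    by (subst lborel.nn_integral_fst[symmetric]) auto
  also have "\<dots> = (\<integral>\<^sup>+x. \<integral>\<^sup>+z. F (x, x + z) \<partial>kmeas \<gamma> \<partial>lborel)"
    by (intro nn_integral_cong nn_integral_kmeas_translate) measurable
  finally show ?thesis .
qed

lemma nn_integral_pmeas_swap:
  fixes F :: "'a::euclidean_space \<times> 'a \<Rightarrow> ennreal"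
  assumes [measurable]: "F \<in> borel_measurable (borel \<Otimes>\<^sub>M borel)"
  shows "(\<integral>\<^sup>+w. F (snd w, fst w) \<partial>pmeas \<gamma>) = (\<integral>\<^sup>+w. F w \<partial>pmeas \<gamma>)"
proof -
  have [measurable]: "(\<lambda>w. F (snd w, fst w)) \<in> borel_measurable (borel \<Otimes>\<^sub>M borel)" by measurable
  have "(\<integral>\<^sup>+w. F w \<partial>pmeas \<gamma>) = (\<integral>\<^sup>+w. ennreal (rker \<gamma> (fst w - snd w)) * F w \<partial>(lborel \<Otimes>\<^sub>M lborel))"
    unfolding pmeas_def by (rule nn_integral_density) measurable
  also have "\<dots> = (\<integral>\<^sup>+w. ennreal (rker \<gamma> (fst w - snd w)) * F w \<partial>distr (lborel \<Otimes>\<^sub>M lborel) (lborel \<Otimes>\<^sub>M lborel) (\<lambda>(x, y). (y, x)))"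
    by (subst lborel_pair.distr_pair_swap) simp
  also have "\<dots> = (\<integral>\<^sup>+w. ennreal (rker \<gamma> (snd w - fst w)) * F (snd w, fst w) \<partial>(lborel \<Otimes>\<^sub>M lborel))"
    by (subst nn_integral_distr) (auto simp: case_prod_beta)
  also have "\<dots> = (\<integral>\<^sup>+w. ennreal (rker \<gamma> (fst w - snd w)) * F (snd w, fst w) \<partial>(lborel \<Otimes>\<^sub>M lborel))"
    by (intro nn_integral_cong) (metis minus_diff_eq rker_minus)
  also have "\<dots> = (\<integral>\<^sup>+w. F (snd w, fst w) \<partial>pmeas \<gamma>)"
    unfolding pmeas_def by (rule nn_integral_density[symmetric]) measurable
  finally show ?thesis by simp
qed

lemma gagliardo_kmeas:
  fixes u :: "'a::euclidean_space \<Rightarrow> real"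
  assumes [measurable]: "u \<in> borel_measurable borel"
  shows "gagliardo s p u = (\<integral>\<^sup>+x. \<integral>\<^sup>+z. ennreal (\<bar>u x - u (x + z)\<bar> powr p) \<partial>kmeas (s * p) \<partial>lborel)"
  unfolding gagliardo_pmeas[OF assms] by (subst nn_integral_pmeas) auto

lemma gagliardo_mono:
  fixes u v :: "'a::euclidean_space \<Rightarrow> real"
  assumes [measurable]: "u \<in> borel_measurable borel" "v \<in> borel_measurable borel"
    and "p \<ge> 0" "\<And>x y. \<bar>v x - v y\<bar> \<le> \<bar>u x - u y\<bar>"
  shows "gagliardo s p v \<le> gagliardo s p u"
  unfolding gagliardo_pmeas[OF assms(1)] gagliardo_pmeas[OF assms(2)]
  using assms(3,4) by (intro nn_integral_mono ennreal_leI powr_mono2) auto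

lemma gagliardo_cong_AE:
  fixes u v :: "'a::euclidean_space \<Rightarrow> real"
  assumes [measurable]: "u \<in> borel_measurable borel" "v \<in> borel_measurable borel"
    and ae: "AE x in lborel. u x = v x"
  shows "gagliardo s p u = gagliardo s p v"
proof -
  have "AE w in lborel \<Otimes>\<^sub>M lborel. u (fst w) = v (fst w)"
    by (rule lborel_pair.AE_pair_measure) (measurable, use ae in auto)
  moreover have "AE w in lborel \<Otimes>\<^sub>M lborel. u (snd w) = v (snd w)"
    by (rule lborel_pair.AE_pair_measure) (measurable, use ae in auto)
  ultimately have "AE w in lborel \<Otimes>\<^sub>M lborel. u (fst w) = v (fst w) \<and> u (snd w) = v (snd w)" by (rule AE_conjI)
  then show ?thesis unfolding gagliardo_def
    by (intro nn_integral_cong_AE) (auto elim!: AE_mp)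
qed

text \<open>Young's inequality with exponents p and p/(p-1) bounds the cross term, which gives the
  convexity of |.|^p in its supporting-line form. \<open>sgn c * \<bar>c\<bar> powr (p - 1)\<close>
  is the nonlinearity of the p-Laplacian.\<close>

lemma powr_above_tangent:
  fixes a c p :: real
  assumes p: "p > 1"
  shows "\<bar>c\<bar> powr p + p * (sgn c * \<bar>c\<bar> powr (p - 1)) * (a - c) \<le> \<bar>a\<bar> powr p"
proof -
  define r where "r = p / (p - 1)"
  have r: "r > 1" "1 / p + 1 / r = 1" "(p - 1) * r = p" using p by (auto simp: r_def field_simps)
  have "\<bar>a\<bar> * \<bar>c\<bar> powr (p - 1) \<le> \<bar>a\<bar> powr p / p + (\<bar>c\<bar> powr (p - 1)) powr r / r"
    by (rule Youngs_inequality) (use p r in auto)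
  also have "(\<bar>c\<bar> powr (p - 1)) powr r = \<bar>c\<bar> powr p" using r by (simp add: powr_powr)
  finally have "p * (\<bar>a\<bar> * \<bar>c\<bar> powr (p - 1)) \<le> p * (\<bar>a\<bar> powr p / p + \<bar>c\<bar> powr p / r)"
    using p by (intro mult_left_mono) auto
  also have "\<dots> = \<bar>a\<bar> powr p + (p - 1) * \<bar>c\<bar> powr p" using p by (simp add: r_def field_simps)
  finally have 1: "p * (\<bar>a\<bar> * \<bar>c\<bar> powr (p - 1)) \<le> \<bar>a\<bar> powr p + (p - 1) * \<bar>c\<bar> powr p" .
  have "sgn c * a \<le> \<bar>a\<bar>" by (auto simp: sgn_if)
  then have "p * \<bar>c\<bar> powr (p - 1) * (sgn c * a) \<le> p * \<bar>c\<bar> powr (p - 1) * \<bar>a\<bar>"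
    using p by (intro mult_left_mono) auto
  then have 2: "p * (sgn c * \<bar>c\<bar> powr (p - 1)) * a \<le> p * (\<bar>a\<bar> * \<bar>c\<bar> powr (p - 1))" by (simp add: mult_ac)
  have 3: "sgn c * \<bar>c\<bar> powr (p - 1) * c = \<bar>c\<bar> powr p"
  proof (cases "c = 0")
    case False
    have "sgn c * \<bar>c\<bar> powr (p - 1) * c = \<bar>c\<bar> powr (p - 1) * \<bar>c\<bar>" by (auto simp: sgn_if)
    also have "\<dots> = \<bar>c\<bar> powr p" using False by (simp add: powr_diff)
    finally show ?thesis .
  qed simp
  have "p * (sgn c * \<bar>c\<bar> powr (p - 1)) * (a - c) = p * (sgn c * \<bar>c\<bar> powr (p - 1)) * a - p * \<bar>c\<bar> powr p"
    unfolding 3[symmetric] by (simp add: algebra_simps)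
  moreover have "p * (\<bar>a\<bar> * \<bar>c\<bar> powr (p - 1)) \<le> \<bar>a\<bar> powr p + p * \<bar>c\<bar> powr p - \<bar>c\<bar> powr p"
    using 1 by (simp add: left_diff_distrib)
  ultimately show ?thesis using 2 by linarith
qed

lemma sgn_powr_mono:
  fixes c d p :: real
  assumes "p > 1" "c \<le> d"
  shows "sgn c * \<bar>c\<bar> powr (p - 1) \<le> sgn d * \<bar>d\<bar> powr (p - 1)"
proof -
  consider "0 \<le> c" | "c < 0" "0 \<le> d" | "d < 0" using assms by linarith
  then show ?thesis
  proof cases
    case 1
    then have "\<bar>c\<bar> powr (p - 1) \<le> \<bar>d\<bar> powr (p - 1)" using assms by (intro powr_mono2) auto
    then show ?thesis using 1 assms by (auto simp: sgn_if)
  next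
    case 2
    then have "sgn c * \<bar>c\<bar> powr (p - 1) \<le> 0" "0 \<le> sgn d * \<bar>d\<bar> powr (p - 1)" by (auto simp: sgn_if)
    then show ?thesis by linarith
  next
    case 3
    then have "\<bar>d\<bar> powr (p - 1) \<le> \<bar>c\<bar> powr (p - 1)" using assms by (intro powr_mono2) auto
    then show ?thesis using 3 assms by (auto simp: sgn_if)
  qed
qed

lemma cutp_nonneg [simp]: "cutp s p q d d' \<ge> 0"
  by (simp add: cutp_def)

lemma cutp_measurable [measurable (raw)]:
  assumes [measurable]: "f \<in> borel_measurable M" "g \<in> borel_measurable M"
  shows "(\<lambda>x. cutp s p q (f x) (g x)) \<in> borel_measurable M"
  unfolding cutp_def by measurable

text \<open>Convexity at the truncated increment m - m' gives a term \<psi>(m - m')(v - v'), where v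
  and v' are the parts cut off; monotonicity of \<psi> replaces m - m' by the increment of the
  barrier. For multiplicatively separated arguments \<psi> of that increment is the difference of
  two \<open>cutp\<close> terms, of which at most one is nonzero. Its positive and negative parts
  stand on opposite sides, so that all terms survive integration in the extended nonnegative
  reals.\<close>

lemma truncation_pointwise:
  fixes a b d d' A s p q :: real
  assumes p: "p > 1" and A: "A > 0" and s: "s > 0" and d: "d \<ge> 0" "d' \<ge> 0" and q: "0 < q" "q < 1"
    and E: "d' \<le> q * d \<or> d \<le> q * d' \<or> d = d'"
  defines "m \<equiv> min a (A * d powr s)" and "m' \<equiv> min b (A * d' powr s)"
  shows "\<bar>m - m'\<bar> powr p + p * A powr (p - 1) * (cutp s p q d d' * (a - m) + cutp s p q d' d * (b - m'))
    \<le> \<bar>a - b\<bar> powr p + p * A powr (p - 1) * (cutp s p q d' d * (a - m) + cutp s p q d d' * (b - m'))"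
proof -
  define \<psi> where "\<psi> c = sgn c * \<bar>c\<bar> powr (p - 1)" for c :: real
  define e where "e = A * d powr s"
  define f where "f = A * d' powr s"
  define v where "v = a - m"
  define v' where "v' = b - m'"
  have v: "v \<ge> 0" "v' \<ge> 0" "v > 0 \<Longrightarrow> m = e" "v' > 0 \<Longrightarrow> m' = f" "m \<le> e" "m' \<le> f"
    by (auto simp: v_def v'_def m_def m'_def e_def f_def)
  have psi: "A powr (p - 1) * (cutp s p q d d' - cutp s p q d' d) = \<psi> (e - f)"
  proof -
    have *: "A powr (p - 1) * (cutp s p q x y - cutp s p q y x) = \<psi> (A * x powr s - A * y powr s)"
      if xy: "y \<le> q * x" "x \<ge> 0" "y \<ge> 0" for x y
    proof -
      have "q * x \<le> 1 * x" using q xy by (intro mult_right_mono) auto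
      then have "y \<le> x" using xy by linarith
      then have ge: "y powr s \<le> x powr s" using xy s by (intro powr_mono2) auto
      have z: "cutp s p q y x = 0"
      proof (cases "x \<le> q * y")
        case True
        have "q * y \<le> q * (q * x)" using q xy by (intro mult_left_mono) auto
        then have "x \<le> (q * q) * x" using True by (simp add: mult.assoc)
        moreover have "q * q < 1"
        proof -
          have "q * q < q * 1" using q by (intro mult_strict_left_mono) auto
          then show ?thesis using q by linarith
        qed
        ultimately have "x = 0" using xy mult_strict_right_mono[of "q * q" 1 x] by (cases "x = 0") auto
        then show ?thesis using xy q by (simp add: cutp_def)
      qed (simp add: cutp_def)
      have "\<psi> (A * x powr s - A * y powr s) = (A * (x powr s - y powr s)) powr (p - 1)"
      proof (cases "x powr s = y powr s")
        case False
        then have "A * (x powr s - y powr s) > 0" using ge A by simp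
        then show ?thesis by (simp add: \<psi>_def algebra_simps)
      qed (simp add: \<psi>_def)
      also have "\<dots> = A powr (p - 1) * cutp s p q x y"
        using A ge xy by (simp add: powr_mult cutp_def)
      finally show ?thesis using z by simp
    qed
    have \<psi>m: "\<psi> (- c) = - \<psi> c" for c by (simp add: \<psi>_def sgn_minus)
    from E consider "d' \<le> q * d" | "d \<le> q * d'" | "d = d'" by blast
    then show ?thesis
    proof cases
      case 1
      from *[OF this d] show ?thesis by (simp add: e_def f_def)
    next
      case 2
      from *[OF this d(2,1)] show ?thesis using \<psi>m[of "e - f"] by (simp add: e_def f_def algebra_simps)
    qed (simp add: \<psi>_def e_def f_def)
  qed
  \<comment> \<open>If v > v' then v > 0, so truncation is active at the first point and m = e,
    while m' \<le> f always; hence e - f \<le> m - m'. The case v < v' is symmetric and reverses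
    both signs.\<close>
  have "\<psi> (e - f) * (v - v') \<le> \<psi> (m - m') * (v - v')"
  proof -
    consider "v = v'" | "v > v'" | "v < v'" by linarith
    then show ?thesis
    proof cases
      case 2
      then have "e - f \<le> m - m'" using v by auto
      then show ?thesis using 2 p unfolding \<psi>_def by (intro mult_right_mono sgn_powr_mono) auto
    next
      case 3
      then have "m - m' \<le> e - f" using v by auto
      then show ?thesis using 3 p unfolding \<psi>_def by (intro mult_right_mono_neg sgn_powr_mono) auto
    qed simp
  qed
  then have "p * \<psi> (e - f) * (v - v') \<le> p * \<psi> (m - m') * (v - v')" using p by (simp add: mult.assoc)
  moreover have "\<bar>m - m'\<bar> powr p + p * \<psi> (m - m') * ((a - b) - (m - m')) \<le> \<bar>a - b\<bar> powr p"
    unfolding \<psi>_def by (rule powr_above_tangent[OF p])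
  moreover have "(a - b) - (m - m') = v - v'" by (simp add: v_def v'_def)
  ultimately have "\<bar>m - m'\<bar> powr p + p * (A powr (p - 1) * (cutp s p q d d' - cutp s p q d' d)) * (v - v') \<le> \<bar>a - b\<bar> powr p"
    unfolding psi by simp
  then show ?thesis unfolding v_def[symmetric] v'_def[symmetric] by (simp add: algebra_simps)
qed

text \<open>The supersolution inequality is tested with the removed part v = u - m. For fixed q the
  pointwise inequality is integrated over \<open>Eq q\<close>, where the \<open>cutp\<close> terms
  represent the increments; off this set both of them vanish. Exchanging the two points doubles each
  flux, whence the factor 2 in the gain. Letting q tend to 1 recovers the full energy of
  \<open>m\<close> by monotone convergence.\<close>

lemma gagliardo_truncate_barrier:
  fixes D u :: "'a::euclidean_space \<Rightarrow> real" and B :: "real \<Rightarrow> real"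
  assumes p: "p > 1" and A: "A > 0" and s: "s > 0" and F: "F \<ge> 0"
    and [measurable]: "D \<in> borel_measurable borel" "u \<in> borel_measurable borel"
    and D: "\<And>x. D x \<ge> 0"
  defines "m \<equiv> \<lambda>x. min (u x) (A * D x powr s)"
  assumes fin: "(\<integral>\<^sup>+x. ennreal (u x - m x) \<partial>lborel) < \<infinity>"
    and key: "\<And>q x. 1/2 \<le> q \<Longrightarrow> q < 1 \<Longrightarrow> A * D x powr s < u x \<Longrightarrow>
       (\<integral>\<^sup>+z. ennreal (cutp s p q (D (x + z)) (D x)) \<partial>kmeas (s * p)) + ennreal F
       \<le> (\<integral>\<^sup>+z. ennreal (cutp s p q (D x) (D (x + z))) \<partial>kmeas (s * p))"
    and bd: "\<And>q x. 1/2 \<le> q \<Longrightarrow> q < 1 \<Longrightarrow> A * D x powr s < u x \<Longrightarrow>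
       (\<integral>\<^sup>+z. ennreal (cutp s p q (D (x + z)) (D x)) \<partial>kmeas (s * p)) \<le> ennreal (B q)"
  shows "gagliardo s p m + ennreal (2 * p * A powr (p - 1) * F) * (\<integral>\<^sup>+x. ennreal (u x - m x) \<partial>lborel) \<le> gagliardo s p u"
proof -
  define \<gamma> where "\<gamma> = s * p"
  define v where "v x = u x - m x" for x
  have [measurable]: "m \<in> borel_measurable borel" unfolding m_def by measurable
  have [measurable]: "v \<in> borel_measurable borel" unfolding v_def[abs_def] by measurable
  have v0: "v x \<ge> 0" for x by (simp add: v_def m_def)
  define V where "V = (\<integral>\<^sup>+x. ennreal (v x) \<partial>lborel)"
  have V: "V < \<infinity>" using fin by (simp add: V_def v_def)
  define k where "k = p * A powr (p - 1)"
  have k: "k > 0" using p A by (simp add: k_def)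
  define P where "P q w = ennreal (cutp s p q (D (fst w)) (D (snd w)) * v (fst w))" for q and w :: "'a \<times> 'a"
  define R where "R q w = ennreal (cutp s p q (D (snd w)) (D (fst w)) * v (fst w))" for q and w :: "'a \<times> 'a"
  have PRm[measurable]: "P q \<in> borel_measurable (borel \<Otimes>\<^sub>M borel)" "R q \<in> borel_measurable (borel \<Otimes>\<^sub>M borel)" for q
    unfolding P_def[abs_def] R_def[abs_def] by measurable
  have PRsm[measurable]: "(\<lambda>w. P q (snd w, fst w)) \<in> borel_measurable (borel \<Otimes>\<^sub>M borel)"
    "(\<lambda>w. R q (snd w, fst w)) \<in> borel_measurable (borel \<Otimes>\<^sub>M borel)" for q
    unfolding P_def[abs_def] R_def[abs_def] by measurable
  define Eq where "Eq q = {w. D (snd w) \<le> q * D (fst w) \<or> D (fst w) \<le> q * D (snd w) \<or> D (fst w) = D (snd w)}" for q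
  have Eqm[measurable]: "Eq q \<in> sets (borel \<Otimes>\<^sub>M borel)" for q
  proof -
    have "{w \<in> space (borel \<Otimes>\<^sub>M borel). D (snd w) \<le> q * D (fst w) \<or> D (fst w) \<le> q * D (snd w) \<or> D (fst w) = D (snd w)}
      \<in> sets (borel \<Otimes>\<^sub>M borel)" by measurable
    then show ?thesis by (simp add: Eq_def space_pair_measure)
  qed
  define J where "J w = ennreal (\<bar>m (fst w) - m (snd w)\<bar> powr p)" for w
  have [measurable]: "J \<in> borel_measurable (borel \<Otimes>\<^sub>M borel)" unfolding J_def[abs_def] by measurable
  have main: "(\<integral>\<^sup>+w. J w * indicator (Eq q) w \<partial>pmeas \<gamma>) + ennreal (2 * k * F) * V \<le> gagliardo s p u"
    if q: "1/2 \<le> q" "q < 1" for q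
  proof -
    define Sp where "Sp = (\<integral>\<^sup>+w. P q w \<partial>pmeas \<gamma>)"
    define Sm where "Sm = (\<integral>\<^sup>+w. R q w \<partial>pmeas \<gamma>)"
    have swp: "(\<integral>\<^sup>+w. P q (snd w, fst w) \<partial>pmeas \<gamma>) = Sp" "(\<integral>\<^sup>+w. R q (snd w, fst w) \<partial>pmeas \<gamma>) = Sm"
      unfolding Sp_def Sm_def by (rule nn_integral_pmeas_swap, measurable)+
    have SpI: "Sp = (\<integral>\<^sup>+x. ennreal (v x) * (\<integral>\<^sup>+z. ennreal (cutp s p q (D x) (D (x + z))) \<partial>kmeas \<gamma>) \<partial>lborel)"
    proof -
      have "Sp = (\<integral>\<^sup>+x. \<integral>\<^sup>+z. ennreal (cutp s p q (D x) (D (x + z)) * v x) \<partial>kmeas \<gamma> \<partial>lborel)"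
        unfolding Sp_def by (subst nn_integral_pmeas) (auto simp: P_def)
      also have "\<dots> = (\<integral>\<^sup>+x. ennreal (v x) * (\<integral>\<^sup>+z. ennreal (cutp s p q (D x) (D (x + z))) \<partial>kmeas \<gamma>) \<partial>lborel)"
        using v0 by (intro nn_integral_cong) (simp add: ennreal_mult' mult.commute nn_integral_cmult[symmetric])
      finally show ?thesis .
    qed
    have SmI: "Sm = (\<integral>\<^sup>+x. ennreal (v x) * (\<integral>\<^sup>+z. ennreal (cutp s p q (D (x + z)) (D x)) \<partial>kmeas \<gamma>) \<partial>lborel)"
    proof -
      have "Sm = (\<integral>\<^sup>+x. \<integral>\<^sup>+z. ennreal (cutp s p q (D (x + z)) (D x) * v x) \<partial>kmeas \<gamma> \<partial>lborel)"
        unfolding Sm_def by (subst nn_integral_pmeas) (auto simp: R_def)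
      also have "\<dots> = (\<integral>\<^sup>+x. ennreal (v x) * (\<integral>\<^sup>+z. ennreal (cutp s p q (D (x + z)) (D x)) \<partial>kmeas \<gamma>) \<partial>lborel)"
        using v0 by (intro nn_integral_cong) (simp add: ennreal_mult' mult.commute nn_integral_cmult[symmetric])
      finally show ?thesis .
    qed
    have pos: "A * D x powr s < u x" if "v x \<noteq> 0" for x
      using that by (auto simp: v_def m_def min_def split: if_splits)
    \<comment> \<open>Finiteness of the inflow term permits its cancellation from both sides; this
      is the purpose of the bound \<open>B q\<close>, which may blow up as q tends to 1.\<close>
    have Sfin: "Sm < \<infinity>"
    proof -
      have "Sm \<le> (\<integral>\<^sup>+x. ennreal (v x) * ennreal (B q) \<partial>lborel)"
        unfolding SmI
      proof (rule nn_integral_mono)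
        fix x
        show "ennreal (v x) * (\<integral>\<^sup>+z. ennreal (cutp s p q (D (x + z)) (D x)) \<partial>kmeas \<gamma>) \<le> ennreal (v x) * ennreal (B q)"
        proof (cases "v x = 0")
          case False
          then show ?thesis using bd[OF q pos] by (intro mult_left_mono) (auto simp: \<gamma>_def)
        qed simp
      qed
      also have "\<dots> = V * ennreal (B q)" by (simp add: V_def nn_integral_multc)
      also have "\<dots> < \<infinity>" using V by (simp add: ennreal_mult_less_top)
      finally show ?thesis .
    qed
    have SS: "Sm + ennreal F * V \<le> Sp"
    proof -
      have [measurable]: "(\<lambda>x. \<integral>\<^sup>+z. ennreal (cutp s p q (D (x + z)) (D x)) \<partial>kmeas \<gamma>) \<in> borel_measurable lborel"
        by (rule sigma_finite_measure.borel_measurable_nn_integral[OF sigma_finite_kmeas]) measurable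
      have "Sm + ennreal F * V = (\<integral>\<^sup>+x. ennreal (v x) * (\<integral>\<^sup>+z. ennreal (cutp s p q (D (x + z)) (D x)) \<partial>kmeas \<gamma>) + ennreal F * ennreal (v x) \<partial>lborel)"
        unfolding SmI V_def by (subst nn_integral_add) (auto simp: nn_integral_cmult)
      also have "\<dots> \<le> Sp" unfolding SpI
      proof (rule nn_integral_mono)
        fix x
        show "ennreal (v x) * (\<integral>\<^sup>+z. ennreal (cutp s p q (D (x + z)) (D x)) \<partial>kmeas \<gamma>) + ennreal F * ennreal (v x)
          \<le> ennreal (v x) * (\<integral>\<^sup>+z. ennreal (cutp s p q (D x) (D (x + z))) \<partial>kmeas \<gamma>)"
        proof (cases "v x = 0")
          case False
          have "ennreal (v x) * (\<integral>\<^sup>+z. ennreal (cutp s p q (D (x + z)) (D x)) \<partial>kmeas \<gamma>) + ennreal F * ennreal (v x)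
            = ennreal (v x) * ((\<integral>\<^sup>+z. ennreal (cutp s p q (D (x + z)) (D x)) \<partial>kmeas \<gamma>) + ennreal F)"
            by (simp add: distrib_left mult.commute)
          also have "\<dots> \<le> ennreal (v x) * (\<integral>\<^sup>+z. ennreal (cutp s p q (D x) (D (x + z))) \<partial>kmeas \<gamma>)"
            using key[OF q pos[OF False]] by (intro mult_left_mono) (auto simp: \<gamma>_def)
          finally show ?thesis .
        qed simp
      qed
      finally show ?thesis .
    qed
    have "(\<integral>\<^sup>+w. J w * indicator (Eq q) w \<partial>pmeas \<gamma>) + ennreal k * (Sp + Sp)
      = (\<integral>\<^sup>+w. J w * indicator (Eq q) w + ennreal k * (P q w + P q (snd w, fst w)) \<partial>pmeas \<gamma>)"
    proof -
      have "(\<integral>\<^sup>+w. J w * indicator (Eq q) w + ennreal k * (P q w + P q (snd w, fst w)) \<partial>pmeas \<gamma>)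
        = (\<integral>\<^sup>+w. J w * indicator (Eq q) w \<partial>pmeas \<gamma>) + (\<integral>\<^sup>+w. ennreal k * (P q w + P q (snd w, fst w)) \<partial>pmeas \<gamma>)"
        by (rule nn_integral_add) measurable
      also have "(\<integral>\<^sup>+w. ennreal k * (P q w + P q (snd w, fst w)) \<partial>pmeas \<gamma>) = ennreal k * (\<integral>\<^sup>+w. P q w + P q (snd w, fst w) \<partial>pmeas \<gamma>)"
        by (rule nn_integral_cmult) measurable
      also have "(\<integral>\<^sup>+w. P q w + P q (snd w, fst w) \<partial>pmeas \<gamma>) = Sp + (\<integral>\<^sup>+w. P q (snd w, fst w) \<partial>pmeas \<gamma>)"
        unfolding Sp_def by (rule nn_integral_add) measurable
      finally show ?thesis unfolding swp by simp
    qed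
    also have "\<dots> \<le> (\<integral>\<^sup>+w. ennreal (\<bar>u (fst w) - u (snd w)\<bar> powr p) + ennreal k * (R q w + R q (snd w, fst w)) \<partial>pmeas \<gamma>)"
    proof (rule nn_integral_mono)
      fix w :: "'a \<times> 'a"
      obtain x y where w: "w = (x, y)" by (cases w)
      show "J w * indicator (Eq q) w + ennreal k * (P q w + P q (snd w, fst w))
        \<le> ennreal (\<bar>u (fst w) - u (snd w)\<bar> powr p) + ennreal k * (R q w + R q (snd w, fst w))"
      proof (cases "w \<in> Eq q")
        case True
        have "\<bar>m x - m y\<bar> powr p + k * (cutp s p q (D x) (D y) * v x + cutp s p q (D y) (D x) * v y)
          \<le> \<bar>u x - u y\<bar> powr p + k * (cutp s p q (D y) (D x) * v x + cutp s p q (D x) (D y) * v y)"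
          unfolding m_def v_def k_def
          by (rule truncation_pointwise[OF p A s D D]) (use q True in \<open>auto simp: Eq_def w\<close>)
        then have "ennreal (\<bar>m x - m y\<bar> powr p + k * (cutp s p q (D x) (D y) * v x + cutp s p q (D y) (D x) * v y))
          \<le> ennreal (\<bar>u x - u y\<bar> powr p + k * (cutp s p q (D y) (D x) * v x + cutp s p q (D x) (D y) * v y))"
          by (rule ennreal_leI)
        then show ?thesis using True k v0 by (simp add: w J_def P_def R_def ennreal_mult')
      next
        case False
        then have "cutp s p q (D x) (D y) = 0" "cutp s p q (D y) (D x) = 0" by (auto simp: Eq_def w cutp_def)
        then show ?thesis using False by (simp add: w P_def R_def)
      qed
    qed
    also have "\<dots> = gagliardo s p u + ennreal k * (Sm + Sm)"
    proof -
      have "(\<integral>\<^sup>+w. ennreal (\<bar>u (fst w) - u (snd w)\<bar> powr p) + ennreal k * (R q w + R q (snd w, fst w)) \<partial>pmeas \<gamma>)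
        = (\<integral>\<^sup>+w. ennreal (\<bar>u (fst w) - u (snd w)\<bar> powr p) \<partial>pmeas \<gamma>) + (\<integral>\<^sup>+w. ennreal k * (R q w + R q (snd w, fst w)) \<partial>pmeas \<gamma>)"
        by (rule nn_integral_add) measurable
      also have "(\<integral>\<^sup>+w. ennreal k * (R q w + R q (snd w, fst w)) \<partial>pmeas \<gamma>) = ennreal k * (\<integral>\<^sup>+w. R q w + R q (snd w, fst w) \<partial>pmeas \<gamma>)"
        by (rule nn_integral_cmult) measurable
      also have "(\<integral>\<^sup>+w. R q w + R q (snd w, fst w) \<partial>pmeas \<gamma>) = Sm + (\<integral>\<^sup>+w. R q (snd w, fst w) \<partial>pmeas \<gamma>)"
        unfolding Sm_def by (rule nn_integral_add) measurable
      finally show ?thesis unfolding swp by (simp add: gagliardo_pmeas \<gamma>_def)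
    qed
    finally have 1: "(\<integral>\<^sup>+w. J w * indicator (Eq q) w \<partial>pmeas \<gamma>) + ennreal k * (Sp + Sp) \<le> gagliardo s p u + ennreal k * (Sm + Sm)" .
    have kF: "ennreal (2 * k * F) * V = ennreal k * (ennreal F * V + ennreal F * V)"
    proof -
      have "ennreal (2 * k * F) = ennreal k * ennreal F + ennreal k * ennreal F"
        using k F by (simp add: ennreal_mult[symmetric] ennreal_plus[symmetric] del: ennreal_plus)
      then show ?thesis by (simp add: distrib_right distrib_left mult.assoc)
    qed
    have "((\<integral>\<^sup>+w. J w * indicator (Eq q) w \<partial>pmeas \<gamma>) + ennreal (2 * k * F) * V) + ennreal k * (Sm + Sm)
      = (\<integral>\<^sup>+w. J w * indicator (Eq q) w \<partial>pmeas \<gamma>) + ennreal k * ((Sm + ennreal F * V) + (Sm + ennreal F * V))"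
      unfolding kF by (simp add: distrib_left add_ac)
    also have "\<dots> \<le> (\<integral>\<^sup>+w. J w * indicator (Eq q) w \<partial>pmeas \<gamma>) + ennreal k * (Sp + Sp)"
      by (intro add_left_mono mult_left_mono add_mono SS) auto
    also note 1
    finally have "((\<integral>\<^sup>+w. J w * indicator (Eq q) w \<partial>pmeas \<gamma>) + ennreal (2 * k * F) * V) + ennreal k * (Sm + Sm) \<le> gagliardo s p u + ennreal k * (Sm + Sm)" .
    moreover have "ennreal k * (Sm + Sm) < \<infinity>" using Sfin by (simp add: ennreal_mult_less_top)
    ultimately show ?thesis by (auto simp: ennreal_add_left_cancel_le add.commute[of _ "ennreal k * (Sm + Sm)"])
  qed
  \<comment> \<open>Any sequence in [1/2, 1) increasing to 1 works: two different nonnegative values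
    are separated by the factor \<open>q n\<close> for large n, and equal values belong to every
    \<open>Eq q\<close>.\<close>
  define q where "q n = 1 - 1 / (real n + 2)" for n :: nat
  have q: "1/2 \<le> q n" "q n < 1" for n by (auto simp: q_def field_simps)
  have qmono: "q i \<le> q j" if "i \<le> j" for i j
    using that by (auto simp: q_def intro!: divide_left_mono)
  have "gagliardo s p m = (\<integral>\<^sup>+w. J w \<partial>pmeas \<gamma>)" by (simp add: gagliardo_pmeas J_def \<gamma>_def)
  also have "\<dots> = (\<integral>\<^sup>+w. (SUP n. J w * indicator (Eq (q n)) w) \<partial>pmeas \<gamma>)"
  proof (rule nn_integral_cong)
    fix w :: "'a \<times> 'a"
    have "\<exists>n. w \<in> Eq (q n)"
    proof -
      have *: "\<exists>n. y \<le> q n * x" if "y < x" "y \<ge> 0" for x y :: real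
      proof -
        have "x - y > 0" "x > 0" using that by auto
        obtain n :: nat where n: "x / (x - y) < real n" using reals_Archimedean2 by blast
        have "x < real n * (x - y)" using n \<open>x - y > 0\<close> by (simp add: field_simps)
        also have "\<dots> \<le> (real n + 2) * (x - y)" using \<open>x - y > 0\<close> by (intro mult_right_mono) auto
        finally have "x / (real n + 2) \<le> x - y" by (simp add: field_simps)
        then have "y \<le> q n * x" by (simp add: q_def algebra_simps)
        then show ?thesis ..
      qed
      consider "D (fst w) = D (snd w)" | "D (snd w) < D (fst w)" | "D (fst w) < D (snd w)" by linarith
      then show ?thesis
      proof cases
        case 2
        from *[OF this D] show ?thesis by (auto simp: Eq_def)
      next
        case 3
        from *[OF this D] show ?thesis by (auto simp: Eq_def)
      qed (auto simp: Eq_def)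
    qed
    then obtain n where n: "w \<in> Eq (q n)" by blast
    then have "J w = J w * indicator (Eq (q n)) w" by simp
    also have "\<dots> \<le> (SUP n. J w * indicator (Eq (q n)) w)" by (rule SUP_upper) simp
    finally have "J w \<le> (SUP n. J w * indicator (Eq (q n)) w)" .
    moreover have "(SUP n. J w * indicator (Eq (q n)) w) \<le> J w"
      by (rule SUP_least) (auto simp: indicator_def)
    ultimately show "J w = (SUP n. J w * indicator (Eq (q n)) w)" by (rule antisym)
  qed
  also have "\<dots> = (SUP n. \<integral>\<^sup>+w. J w * indicator (Eq (q n)) w \<partial>pmeas \<gamma>)"
  proof (rule nn_integral_monotone_convergence_SUP)
    have "Eq (q i) \<subseteq> Eq (q j)" if "i \<le> j" for i j
    proof -
      have "q i * D x \<le> q j * D x" for x using qmono[OF that] D by (intro mult_right_mono) auto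
      then show ?thesis unfolding Eq_def by (auto intro: order_trans)
    qed
    then show "incseq (\<lambda>n w. J w * indicator (Eq (q n)) w)"
      by (fastforce simp: incseq_def le_fun_def indicator_def)
  qed measurable
  finally have "gagliardo s p m + ennreal (2 * k * F) * V = (SUP n. (\<integral>\<^sup>+w. J w * indicator (Eq (q n)) w \<partial>pmeas \<gamma>) + ennreal (2 * k * F) * V)"
    by (simp add: ennreal_SUP_add_left)
  also have "\<dots> \<le> gagliardo s p u"
    by (rule SUP_least) (rule main[OF q])
  finally show ?thesis by (simp add: k_def V_def v_def mult.assoc)
qed

section \<open>Fractional Sobolev inequality and truncation at a constant\<close>

text \<open>The ball around \<open>x\<close> of volume 2m contains at least volume m outside
  \<open>B\<close>, all within its radius R. Thus the integral is at least m R^(-(N+\<gamma>)), and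
  R is proportional to m^(1/N).\<close>

lemma kmeas_complement_lower:
  assumes \<gamma>: "\<gamma> > 0"
  obtains c where "c > 0"
    "\<And>m B (x::'a::euclidean_space). m > 0 \<Longrightarrow> B \<in> sets borel \<Longrightarrow> emeasure lborel B \<le> ennreal m \<Longrightarrow>
      ennreal (c * m powr (- \<gamma> / real DIM('a))) \<le> (\<integral>\<^sup>+z. indicator (- B) (x + z) \<partial>kmeas \<gamma>)"
proof
  define N where "N = real DIM('a)"
  have N: "N > 0" by (simp add: N_def)
  define \<omega> where "\<omega> = unit_ball_vol N"
  have \<omega>: "\<omega> > 0" using N by (simp add: \<omega>_def)
  define c where "c = (2 / \<omega>) powr (- (1 + \<gamma> / N))"
  show "c > 0" using \<omega> by (simp add: c_def)
  fix m :: real and B :: "'a set" and x :: 'a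
  assume m: "m > 0" and [measurable]: "B \<in> sets borel" and B: "emeasure lborel B \<le> ennreal m"
  define R where "R = (2 * m / \<omega>) powr (1 / N)"
  have R: "R > 0" using m \<omega> by (simp add: R_def)
  have RN: "\<omega> * R ^ DIM('a) = 2 * m"
  proof -
    have "R ^ DIM('a) = R powr N" using R by (simp add: powr_realpow N_def)
    also have "\<dots> = 2 * m / \<omega>" using N m \<omega> by (simp add: R_def powr_powr)
    finally show ?thesis using \<omega> by simp
  qed
  \<comment> \<open>The centre is removed because \<open>rker\<close> is 0 at the origin, so the
    lower bound by the value at distance \<open>R\<close> fails there.\<close>
  define B' where "B' = B \<union> {x}"
  have [measurable]: "B' \<in> sets borel" by (simp add: B'_def)
  have B': "emeasure lborel B' \<le> ennreal m"
  proof -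
    have "emeasure lborel B' \<le> emeasure lborel B + emeasure lborel {x}"
      unfolding B'_def by (rule emeasure_subadditive) auto
    then show ?thesis using B by simp
  qed
  define A where "A = ball x R - B'"
  have [measurable]: "A \<in> sets borel" by (simp add: A_def)
  have A: "ennreal m \<le> emeasure lborel A"
  proof -
    have "ennreal m + ennreal m = emeasure lborel (ball x R)"
      using R m RN by (subst emeasure_ball) (auto simp: \<omega>_def N_def ennreal_plus[symmetric] simp del: ennreal_plus)
    also have "\<dots> \<le> emeasure lborel (A \<union> B')" by (rule emeasure_mono) (auto simp: A_def)
    also have "\<dots> \<le> emeasure lborel A + emeasure lborel B'" by (rule emeasure_subadditive) auto
    also have "\<dots> \<le> emeasure lborel A + ennreal m" by (intro add_left_mono B')
    finally show ?thesis by (simp add: add.commute ennreal_add_left_cancel_le)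
  qed
  have "ennreal (c * m powr (- \<gamma> / N)) = ennreal (R powr (- (N + \<gamma>))) * ennreal m"
  proof -
    have "R powr (- (N + \<gamma>)) = (2 * m / \<omega>) powr (- (1 + \<gamma> / N))"
    proof -
      have "1 / N * - (N + \<gamma>) = - (1 + \<gamma> / N)" using N by (simp add: field_simps)
      then show ?thesis by (simp only: R_def powr_powr)
    qed
    also have "\<dots> = ((2 / \<omega>) * m) powr (- (1 + \<gamma> / N))" by simp
    also have "\<dots> = c * m powr (- (1 + \<gamma> / N))" using m \<omega> unfolding c_def by (subst powr_mult) auto
    finally have "R powr (- (N + \<gamma>)) * m = c * (m powr (- (1 + \<gamma> / N)) * m powr 1)" using m by simp
    also have "m powr (- (1 + \<gamma> / N)) * m powr 1 = m powr (- \<gamma> / N)" by (simp only: powr_add[symmetric]) simp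
    finally show ?thesis using m by (simp add: ennreal_mult[symmetric])
  qed
  also have "\<dots> \<le> ennreal (R powr (- (N + \<gamma>))) * emeasure lborel A" by (intro mult_left_mono A) auto
  also have "\<dots> = (\<integral>\<^sup>+y. ennreal (R powr (- (N + \<gamma>))) * indicator A y \<partial>lborel)"
    by (subst nn_integral_cmult_indicator) auto
  also have "\<dots> \<le> (\<integral>\<^sup>+y. ennreal (rker \<gamma> (x - y)) * indicator (- B) y \<partial>lborel)"
  proof (rule nn_integral_mono)
    fix y
    show "ennreal (R powr (- (N + \<gamma>))) * indicator A y \<le> ennreal (rker \<gamma> (x - y)) * indicator (- B) y"
    proof (cases "y \<in> A")
      case True
      have "R powr (- (N + \<gamma>)) \<le> rker \<gamma> (x - y)"
        unfolding rker_def N_def using True \<gamma> by (intro powr_mono2') (auto simp: A_def B'_def dist_norm)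
      then show ?thesis using True by (auto simp: A_def B'_def intro: ennreal_leI)
    qed simp
  qed
  also have "\<dots> = (\<integral>\<^sup>+z. indicator (- B) (x + z) \<partial>kmeas \<gamma>)"
    by (rule nn_integral_kmeas_translate) measurable
  finally show "ennreal (c * m powr (- \<gamma> / real DIM('a))) \<le> (\<integral>\<^sup>+z. indicator (- B) (x + z) \<partial>kmeas \<gamma>)"
    by (simp add: N_def)
qed

lemma emeasure_superlevel_le:
  fixes u :: "'a::euclidean_space \<Rightarrow> real"
  assumes [measurable]: "u \<in> borel_measurable borel" and "a > 0" "r > 0"
  shows "emeasure lborel {x. a < \<bar>u x\<bar>} \<le> ennreal ((1 / a) powr r) * (\<integral>\<^sup>+x. ennreal (\<bar>u x\<bar> powr r) \<partial>lborel)"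
proof -
  have "emeasure lborel {x. a < \<bar>u x\<bar>} = (\<integral>\<^sup>+x. indicator {x. a < \<bar>u x\<bar>} x \<partial>lborel)" by simp
  also have "\<dots> \<le> (\<integral>\<^sup>+x. ennreal ((1 / a) powr r) * ennreal (\<bar>u x\<bar> powr r) \<partial>lborel)"
  proof (rule nn_integral_mono)
    fix x
    show "indicator {x. a < \<bar>u x\<bar>} x \<le> ennreal ((1 / a) powr r) * ennreal (\<bar>u x\<bar> powr r)"
    proof (cases "a < \<bar>u x\<bar>")
      case True
      have "1 \<le> (1 / a * \<bar>u x\<bar>) powr r" using True assms by (intro ge_one_powr_ge_zero) (auto simp: field_simps)
      also have "\<dots> = (1 / a) powr r * \<bar>u x\<bar> powr r" by (rule powr_mult)
      finally show ?thesis using True by (simp add: ennreal_mult[symmetric] ennreal_1[symmetric] ennreal_leI del: ennreal_1)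
    qed simp
  qed
  also have "\<dots> = ennreal ((1 / a) powr r) * (\<integral>\<^sup>+x. ennreal (\<bar>u x\<bar> powr r) \<partial>lborel)"
    by (rule nn_integral_cmult) measurable
  finally show ?thesis .
qed

text \<open>At a point where the function has value l, the set above l/2 has measure at most
  (2/l)^pst n, with n the integral to be bounded. Its complement carries kernel mass of order l^(pst
  \<gamma>/N) n^(-\<gamma>/N), and there the increment is at least l/2. Integration over all points
  gives n^(1 - \<gamma>/N) \<le> const J, without embeddings or rearrangement.\<close>

lemma fractional_sobolev:
  fixes s p :: real
  assumes s: "0 < s" and p: "p > 1" and sp: "s * p < real DIM('a::euclidean_space)"
  defines "pst \<equiv> real DIM('a) * p / (real DIM('a) - s * p)"
  obtains S where "S > 0"
    "\<And>u :: 'a \<Rightarrow> real. u \<in> borel_measurable borel \<Longrightarrow> (\<integral>\<^sup>+x. ennreal (\<bar>u x\<bar> powr p) \<partial>lborel) < \<infinity> \<Longrightarrow>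
      gagliardo s p u < \<infinity> \<Longrightarrow>
      (\<integral>\<^sup>+x. ennreal (\<bar>u x\<bar> powr pst) \<partial>lborel) \<le> ennreal (S * enn2real (gagliardo s p u) powr (pst / p))"
proof -
  define N where "N = real DIM('a)"
  define \<gamma> where "\<gamma> = s * p"
  have \<gamma>: "\<gamma> > 0" "\<gamma> < N" using s p sp by (auto simp: \<gamma>_def N_def)
  have pst_eq: "pst = N * p / (N - \<gamma>)" by (simp add: pst_def N_def \<gamma>_def)
  have N: "N > 0" using \<gamma> by linarith
  have pst_p: "pst / p = N / (N - \<gamma>)" using p by (simp add: pst_eq)
  \<comment> \<open>This identity singles out the critical exponent: the powers of l obtained from
    the increment and from the kernel mass recombine to l^pst.\<close>
  have id: "p + pst * (\<gamma> / N) = pst"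
    using \<gamma> N by (simp add: pst_eq field_simps)
  have "p * (\<gamma> / (N - \<gamma>)) > 0" using p \<gamma> by auto
  moreover have "pst = p + p * (\<gamma> / (N - \<gamma>))" using \<gamma> by (simp add: pst_eq field_simps)
  ultimately have pst: "pst > p" by linarith
  obtain c where c: "c > 0" and cl:
    "\<And>m B (x::'a). m > 0 \<Longrightarrow> B \<in> sets borel \<Longrightarrow> emeasure lborel B \<le> ennreal m \<Longrightarrow>
      ennreal (c * m powr (- \<gamma> / real DIM('a))) \<le> (\<integral>\<^sup>+z. indicator (- B) (x + z) \<partial>kmeas \<gamma>)"
    using kmeas_complement_lower[OF \<gamma>(1)] by metis
  define S where "S = (2 powr pst / c) powr (pst / p)"
  have S: "S > 0" using c by (simp add: S_def)
  show ?thesis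
  proof (rule that[OF S])
    fix u :: "'a \<Rightarrow> real"
    assume [measurable]: "u \<in> borel_measurable borel" and up: "(\<integral>\<^sup>+x. ennreal (\<bar>u x\<bar> powr p) \<partial>lborel) < \<infinity>"
      and uJ: "gagliardo s p u < \<infinity>"
    define J where "J = enn2real (gagliardo s p u)"
    have J: "gagliardo s p u = ennreal J" "J \<ge> 0" using uJ by (auto simp: J_def)
    \<comment> \<open>The truncations have finite critical integral, being bounded and in L^p with p
      < pst. The argument divides by a power of that integral, so finiteness must be known in
      advance.\<close>
    define v where "v k x = min \<bar>u x\<bar> (real k)" for k :: nat and x
    have [measurable]: "v k \<in> borel_measurable borel" for k unfolding v_def[abs_def] by measurable
    have v0: "v k x \<ge> 0" for k x by (simp add: v_def)
    have bound: "(\<integral>\<^sup>+x. ennreal (v k x powr pst) \<partial>lborel) \<le> ennreal (S * J powr (pst / p))" for k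
    proof -
      define I where "I = (\<integral>\<^sup>+x. ennreal (v k x powr pst) \<partial>lborel)"
      have "I \<le> (\<integral>\<^sup>+x. ennreal (real k powr (pst - p)) * ennreal (\<bar>u x\<bar> powr p) \<partial>lborel)"
        unfolding I_def
      proof (rule nn_integral_mono)
        fix x
        have "v k x powr pst = v k x powr (pst - p) * v k x powr p" by (simp add: powr_add[symmetric])
        also have "\<dots> \<le> real k powr (pst - p) * \<bar>u x\<bar> powr p"
          using pst p v0[of k x] by (intro mult_mono powr_mono2) (auto simp: v_def)
        finally show "ennreal (v k x powr pst) \<le> ennreal (real k powr (pst - p)) * ennreal (\<bar>u x\<bar> powr p)"
          by (simp add: ennreal_mult[symmetric] ennreal_leI)
      qed
      also have "\<dots> < \<infinity>" using up by (simp add: nn_integral_cmult ennreal_mult_less_top)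
      finally have Ifin: "I < \<infinity>" .
      define n where "n = enn2real I"
      have n: "I = ennreal n" "n \<ge> 0" using Ifin by (auto simp: n_def)
      show ?thesis
      proof (cases "n = 0")
        case True
        then show ?thesis using n by (simp add: I_def)
      next
        case False
        then have n0: "n > 0" using n by simp
        have "ennreal (c * 2 powr (- pst) * n powr (- \<gamma> / N)) * I = (\<integral>\<^sup>+x. ennreal (c * 2 powr (- pst) * n powr (- \<gamma> / N)) * ennreal (v k x powr pst) \<partial>lborel)"
          unfolding I_def by (rule nn_integral_cmult[symmetric]) measurable
        also have "\<dots> \<le> (\<integral>\<^sup>+x. \<integral>\<^sup>+z. ennreal (\<bar>v k x - v k (x + z)\<bar> powr p) \<partial>kmeas \<gamma> \<partial>lborel)"
        proof (rule nn_integral_mono)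
          fix x
          show "ennreal (c * 2 powr (- pst) * n powr (- \<gamma> / N)) * ennreal (v k x powr pst) \<le> (\<integral>\<^sup>+z. ennreal (\<bar>v k x - v k (x + z)\<bar> powr p) \<partial>kmeas \<gamma>)"
          proof (cases "v k x = 0")
            case True
            then show ?thesis using pst p by simp
          next
            case False
            define l where "l = v k x"
            have l: "l > 0" using False v0[of k x] by (simp add: l_def)
            define B where "B = {y. l / 2 < \<bar>v k y\<bar>}"
            have [measurable]: "B \<in> sets borel" unfolding B_def by measurable
            \<comment> \<open>Chebyshev's bound for the superlevel set, in terms of the very integral to be estimated.\<close>
            define m where "m = (2 / l) powr pst * n"
            have m: "m > 0" using l n0 by (simp add: m_def)
            have "emeasure lborel B \<le> ennreal ((1 / (l / 2)) powr pst) * (\<integral>\<^sup>+y. ennreal (\<bar>v k y\<bar> powr pst) \<partial>lborel)"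
              unfolding B_def using l pst p by (intro emeasure_superlevel_le) auto
            also have "(\<integral>\<^sup>+y. ennreal (\<bar>v k y\<bar> powr pst) \<partial>lborel) = ennreal n"
              using v0 n by (simp add: I_def abs_of_nonneg)
            also have "ennreal ((1 / (l / 2)) powr pst) * ennreal n = ennreal m"
              using n by (simp add: m_def ennreal_mult)
            finally have Bm: "emeasure lborel B \<le> ennreal m" .
            have "c * 2 powr (- pst) * n powr (- \<gamma> / N) * l powr pst = (l / 2) powr p * (c * m powr (- \<gamma> / N))"
            proof -
              have 1: "m powr (- \<gamma> / N) = (2 / l) powr (pst * (- \<gamma> / N)) * n powr (- \<gamma> / N)"
                unfolding m_def by (simp only: powr_mult powr_powr)
              have 2: "(2 / l) powr (pst * (- \<gamma> / N)) = (l / 2) powr (pst * (\<gamma> / N))"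
              proof -
                have "2 / l = inverse (l / 2)" by simp
                then have "(2 / l) powr (pst * (- \<gamma> / N)) = inverse ((l / 2) powr (pst * (- \<gamma> / N)))"
                  using l by (simp only: inverse_powr)
                also have "\<dots> = (l / 2) powr (pst * (\<gamma> / N))" by (simp add: powr_minus[symmetric])
                finally show ?thesis .
              qed
              have "(l / 2) powr p * (c * m powr (- \<gamma> / N)) = ((l / 2) powr p * (l / 2) powr (pst * (\<gamma> / N))) * c * n powr (- \<gamma> / N)"
                unfolding 1 2 by (simp only: mult_ac)
              also have "(l / 2) powr p * (l / 2) powr (pst * (\<gamma> / N)) = (l / 2) powr pst"
                by (simp only: powr_add[symmetric] id)
              also have "(l / 2) powr pst = l powr pst * 2 powr (- pst)"
                by (simp add: powr_divide powr_minus_divide)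
              finally show ?thesis by (simp only: mult_ac)
            qed
            then have "ennreal (c * 2 powr (- pst) * n powr (- \<gamma> / N)) * ennreal (v k x powr pst) = ennreal ((l / 2) powr p) * ennreal (c * m powr (- \<gamma> / N))"
              using c by (simp add: l_def[symmetric] ennreal_mult[symmetric])
            also have "\<dots> \<le> ennreal ((l / 2) powr p) * (\<integral>\<^sup>+z. indicator (- B) (x + z) \<partial>kmeas \<gamma>)"
              unfolding N_def by (intro mult_left_mono cl m Bm) auto
            also have "\<dots> = (\<integral>\<^sup>+z. ennreal ((l / 2) powr p) * indicator (- B) (x + z) \<partial>kmeas \<gamma>)"
              by (rule nn_integral_cmult[symmetric]) measurable
            also have "\<dots> \<le> (\<integral>\<^sup>+z. ennreal (\<bar>v k x - v k (x + z)\<bar> powr p) \<partial>kmeas \<gamma>)"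
            proof (rule nn_integral_mono)
              fix z
              show "ennreal ((l / 2) powr p) * indicator (- B) (x + z) \<le> ennreal (\<bar>v k x - v k (x + z)\<bar> powr p)"
              proof (cases "x + z \<in> B")
                case False
                then have "l / 2 \<le> \<bar>v k x - v k (x + z)\<bar>" unfolding B_def l_def[symmetric] by auto
                then have "(l / 2) powr p \<le> \<bar>v k x - v k (x + z)\<bar> powr p" using l p by (intro powr_mono2) auto
                then show ?thesis using False by (simp add: ennreal_leI)
              qed simp
            qed
            finally show ?thesis .
          qed
        qed
        also have "\<dots> = gagliardo s p (v k)" by (simp add: gagliardo_kmeas \<gamma>_def)
        also have "\<dots> \<le> gagliardo s p u"
          by (rule gagliardo_mono) (use p in \<open>auto simp: v_def\<close>)
        finally have "ennreal (c * 2 powr (- pst) * n powr (- \<gamma> / N) * n) \<le> ennreal J"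
          using c n by (simp add: J ennreal_mult)
        then have "c * 2 powr (- pst) * n powr (- \<gamma> / N) * n \<le> J" using J by simp
        moreover have "n powr (- \<gamma> / N) * n = n powr ((N - \<gamma>) / N)"
        proof -
          have "n powr (- \<gamma> / N) * n powr 1 = n powr ((N - \<gamma>) / N)"
            using N by (simp only: powr_add[symmetric]) (simp add: field_simps)
          then show ?thesis using n0 by simp
        qed
        ultimately have "c * 2 powr (- pst) * n powr ((N - \<gamma>) / N) \<le> J" by (simp add: mult.assoc)
        then have "n powr ((N - \<gamma>) / N) \<le> (2 powr pst / c) * J"
          using c by (simp add: powr_minus field_simps)
        then have "(n powr ((N - \<gamma>) / N)) powr (pst / p) \<le> ((2 powr pst / c) * J) powr (pst / p)"
          using pst p by (intro powr_mono2) auto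
        moreover have "(n powr ((N - \<gamma>) / N)) powr (pst / p) = n"
          using n0 N \<gamma> by (simp add: powr_powr pst_p)
        moreover have "((2 powr pst / c) * J) powr (pst / p) = S * J powr (pst / p)"
          unfolding S_def by (rule powr_mult)
        ultimately show ?thesis using n by (simp add: I_def[symmetric] ennreal_leI)
      qed
    qed
    have "(\<integral>\<^sup>+x. ennreal (\<bar>u x\<bar> powr pst) \<partial>lborel) = (\<integral>\<^sup>+x. (SUP k. ennreal (v k x powr pst)) \<partial>lborel)"
    proof (rule nn_integral_cong)
      fix x
      obtain k :: nat where "\<bar>u x\<bar> \<le> real k" using real_arch_simple by blast
      then have "ennreal (\<bar>u x\<bar> powr pst) = ennreal (v k x powr pst)" by (simp add: v_def)
      also have "\<dots> \<le> (SUP k. ennreal (v k x powr pst))" by (rule SUP_upper) simp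
      finally have "ennreal (\<bar>u x\<bar> powr pst) \<le> (SUP k. ennreal (v k x powr pst))" .
      moreover have "(SUP k. ennreal (v k x powr pst)) \<le> ennreal (\<bar>u x\<bar> powr pst)"
        using pst p by (intro SUP_least ennreal_leI powr_mono2) (auto simp: v_def)
      ultimately show "ennreal (\<bar>u x\<bar> powr pst) = (SUP k. ennreal (v k x powr pst))" by (rule antisym)
    qed
    also have "\<dots> = (SUP k. \<integral>\<^sup>+x. ennreal (v k x powr pst) \<partial>lborel)"
    proof (rule nn_integral_monotone_convergence_SUP)
      show "incseq (\<lambda>k x. ennreal (v k x powr pst))"
        using pst p by (auto simp: incseq_def le_fun_def v_def intro!: ennreal_leI powr_mono2)
    qed measurable
    also have "\<dots> \<le> ennreal (S * J powr (pst / p))" by (rule SUP_least) (rule bound)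
    finally show "(\<integral>\<^sup>+x. ennreal (\<bar>u x\<bar> powr pst) \<partial>lborel) \<le> ennreal (S * enn2real (gagliardo s p u) powr (pst / p))"
      by (simp add: J_def)
  qed
qed

section \<open>Splitting a function into its truncation at a constant level and the excess\<close>

definition clampr :: "real \<Rightarrow> real \<Rightarrow> real" where
  "clampr \<tau> t = max (- \<tau>) (min \<tau> t)"

lemma clampr_measurable [measurable (raw)]:
  assumes [measurable]: "f \<in> borel_measurable M"
  shows "(\<lambda>x. clampr \<tau> (f x)) \<in> borel_measurable M"
  unfolding clampr_def by measurable

lemma clampr_mono: "a \<le> b \<Longrightarrow> clampr \<tau> a \<le> clampr \<tau> b"
  by (auto simp: clampr_def)

lemma clampr_diff_mono:
  assumes "a \<le> b" "\<tau> > 0"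
  shows "a - clampr \<tau> a \<le> b - clampr \<tau> b"
  using assms by (auto simp: clampr_def min_def max_def)

text \<open>The clamp and its remainder are both nondecreasing, so their increments have the same
  sign and absolute values add up.\<close>

lemma clampr_abs_split:
  assumes "\<tau> > 0"
  shows "\<bar>a - b\<bar> = \<bar>clampr \<tau> a - clampr \<tau> b\<bar> + \<bar>(a - clampr \<tau> a) - (b - clampr \<tau> b)\<bar>"
proof (cases "a \<le> b")
  case True
  then show ?thesis using clampr_mono[OF True, of \<tau>] clampr_diff_mono[OF True assms] by linarith
next
  case False
  then have "b \<le> a" by simp
  then show ?thesis using clampr_mono[of b a \<tau>] clampr_diff_mono[of b a \<tau>] assms by linarith
qed

text \<open>The average of superadditivity of t^p and of the tangent inequality at X. The first
  keeps energy of the excess, to be used with the Sobolev inequality; the second provides a term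
  linear in Y.\<close>

lemma powr_add_ge_mixed:
  fixes X Y p :: real
  assumes "X \<ge> 0" "Y \<ge> 0" "p > 1"
  shows "X powr p + (1/2) * Y powr p + (p/2) * (X powr (p - 1) * Y) \<le> (X + Y) powr p"
proof -
  have 1: "X powr p + Y powr p \<le> (X + Y) powr p" using assms by (intro powr_add_ge) auto
  have 2: "X powr p + p * (X powr (p - 1) * Y) \<le> (X + Y) powr p"
    using powr_above_tangent[of p X "X + Y"] assms by (cases "X = 0") (auto simp: mult_ac)
  show ?thesis using 1 2 by simp
qed

text \<open>The linear gain comes from pairs x, y with |u(x)| > \<tau> and |u(y)| \<le> \<tau>/2:
  the truncations differ by at least \<tau>/2, and the increment of the excess is all of |u(x) -
  T(x)|. The factor \<open>k\<close> is the kernel mass of the points y available; it becomes as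
  large as desired when {|u| > \<tau>/2} is small.\<close>

lemma gagliardo_clamp:
  fixes u :: "'a::euclidean_space \<Rightarrow> real"
  assumes p: "p > 1" and \<tau>: "\<tau> > 0" and k: "k \<ge> 0" and [measurable]: "u \<in> borel_measurable borel"
    and low: "\<And>x. ennreal k \<le> (\<integral>\<^sup>+z. indicator (- {y. \<tau> / 2 < \<bar>u y\<bar>}) (x + z) \<partial>kmeas (s * p))"
  defines "T \<equiv> \<lambda>x. clampr \<tau> (u x)"
  shows "gagliardo s p T + ennreal (1/2) * gagliardo s p (\<lambda>x. u x - T x)
    + ennreal (p / 2 * (\<tau> / 2) powr (p - 1) * k) * (\<integral>\<^sup>+x. ennreal \<bar>u x - T x\<bar> \<partial>lborel) \<le> gagliardo s p u"
proof -
  define \<gamma> where "\<gamma> = s * p"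
  have [measurable]: "T \<in> borel_measurable borel" unfolding T_def by measurable
  define S where "S x = u x - T x" for x
  have [measurable]: "S \<in> borel_measurable borel" unfolding S_def[abs_def] by measurable
  define B where "B = {y. \<tau> / 2 < \<bar>u y\<bar>}"
  have [measurable]: "B \<in> sets borel" unfolding B_def by measurable
  define h where "h = p / 2 * (\<tau> / 2) powr (p - 1)"
  have h: "h \<ge> 0" using p by (simp add: h_def)
  define A where "A w = ennreal h * (ennreal \<bar>S (fst w)\<bar> * indicator (- B) (snd w))" for w
  have [measurable]: "A \<in> borel_measurable (borel \<Otimes>\<^sub>M borel)" unfolding A_def[abs_def] by measurable
  have "ennreal (h * k) * (\<integral>\<^sup>+x. ennreal \<bar>S x\<bar> \<partial>lborel) = (\<integral>\<^sup>+x. ennreal h * ennreal \<bar>S x\<bar> * ennreal k \<partial>lborel)"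
    using h k by (subst nn_integral_cmult[symmetric]) (auto simp: ennreal_mult mult_ac)
  also have "\<dots> \<le> (\<integral>\<^sup>+x. ennreal h * ennreal \<bar>S x\<bar> * (\<integral>\<^sup>+z. indicator (- B) (x + z) \<partial>kmeas \<gamma>) \<partial>lborel)"
    using low unfolding B_def \<gamma>_def by (intro nn_integral_mono mult_left_mono) auto
  also have "\<dots> = (\<integral>\<^sup>+x. \<integral>\<^sup>+z. A (x, x + z) \<partial>kmeas \<gamma> \<partial>lborel)"
    by (intro nn_integral_cong) (simp add: A_def nn_integral_cmult[symmetric] mult.assoc)
  also have "\<dots> = (\<integral>\<^sup>+w. A w \<partial>pmeas \<gamma>)" by (rule nn_integral_pmeas[symmetric]) measurable
  finally have 1: "ennreal (h * k) * (\<integral>\<^sup>+x. ennreal \<bar>S x\<bar> \<partial>lborel) \<le> (\<integral>\<^sup>+w. A w \<partial>pmeas \<gamma>)" .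
  have "gagliardo s p T + ennreal (1/2) * gagliardo s p S + (\<integral>\<^sup>+w. A w \<partial>pmeas \<gamma>)
    = (\<integral>\<^sup>+w. ennreal (\<bar>T (fst w) - T (snd w)\<bar> powr p) + ennreal (1/2) * ennreal (\<bar>S (fst w) - S (snd w)\<bar> powr p) + A w \<partial>pmeas \<gamma>)"
    by (simp add: gagliardo_pmeas \<gamma>_def[symmetric] nn_integral_add nn_integral_cmult)
  also have "\<dots> \<le> (\<integral>\<^sup>+w. ennreal (\<bar>u (fst w) - u (snd w)\<bar> powr p) \<partial>pmeas \<gamma>)"
  proof (rule nn_integral_mono)
    fix w :: "'a \<times> 'a"
    obtain x y where w: "w = (x, y)" by (cases w)
    define X where "X = \<bar>T x - T y\<bar>"
    define Y where "Y = \<bar>S x - S y\<bar>"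
    have XY: "\<bar>u x - u y\<bar> = X + Y" unfolding X_def Y_def S_def T_def by (rule clampr_abs_split[OF \<tau>])
    have Aw: "A w \<le> ennreal ((p/2) * (X powr (p - 1) * Y))"
    proof (cases "y \<in> B \<or> S x = 0")
      case True
      then show ?thesis by (auto simp: A_def w)
    next
      case False
      then have y: "\<bar>u y\<bar> \<le> \<tau> / 2" and x: "\<bar>u x\<bar> > \<tau>" using \<tau>
        unfolding B_def S_def T_def clampr_def by (auto simp: min_def max_def split: if_splits)
      have Ty: "T y = u y" using y \<tau> by (auto simp: T_def clampr_def)
      have "\<bar>T x\<bar> = \<tau>" using x \<tau> by (auto simp: T_def clampr_def)
      then have "X \<ge> \<tau> / 2" using y Ty unfolding X_def by linarith
      then have 2: "(\<tau> / 2) powr (p - 1) \<le> X powr (p - 1)" using \<tau> p by (intro powr_mono2) auto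
      have 3: "Y = \<bar>S x\<bar>" using Ty by (simp add: Y_def S_def[of y])
      have "h * \<bar>S x\<bar> \<le> (p/2) * (X powr (p - 1) * Y)"
        using 2 p unfolding h_def 3 by (simp add: mult.assoc mult_left_mono mult_right_mono)
      then show ?thesis using False h by (simp add: A_def w ennreal_mult[symmetric] ennreal_leI)
    qed
    have "ennreal (X powr p) + ennreal (1/2) * ennreal (Y powr p) + A w
      \<le> ennreal (X powr p) + ennreal (1/2) * ennreal (Y powr p) + ennreal ((p/2) * (X powr (p - 1) * Y))"
      by (intro add_left_mono Aw)
    also have "\<dots> = ennreal (X powr p + (1/2) * Y powr p + (p/2) * (X powr (p - 1) * Y))"
    proof -
      have "ennreal (1/2) * ennreal (Y powr p) = ennreal ((1/2) * Y powr p)"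
        by (rule ennreal_mult[symmetric]) auto
      moreover have "0 \<le> (p/2) * (X powr (p - 1) * Y)" using p by (simp add: Y_def)
      ultimately show ?thesis by (simp add: ennreal_plus[symmetric] del: ennreal_plus)
    qed
    also have "\<dots> \<le> ennreal ((X + Y) powr p)"
      using p by (intro ennreal_leI powr_add_ge_mixed) (auto simp: X_def Y_def)
    finally show "ennreal (\<bar>T (fst w) - T (snd w)\<bar> powr p) + ennreal (1/2) * ennreal (\<bar>S (fst w) - S (snd w)\<bar> powr p) + A w
      \<le> ennreal (\<bar>u (fst w) - u (snd w)\<bar> powr p)"
      unfolding w fst_conv snd_conv X_def[symmetric] Y_def[symmetric] XY by (simp add: w)
  qed
  also have "\<dots> = gagliardo s p u" by (simp add: gagliardo_pmeas \<gamma>_def)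
  finally have 2: "gagliardo s p T + ennreal (1/2) * gagliardo s p S + (\<integral>\<^sup>+w. A w \<partial>pmeas \<gamma>) \<le> gagliardo s p u" .
  have "gagliardo s p T + ennreal (1/2) * gagliardo s p S + ennreal (h * k) * (\<integral>\<^sup>+x. ennreal \<bar>S x\<bar> \<partial>lborel)
    \<le> gagliardo s p T + ennreal (1/2) * gagliardo s p S + (\<integral>\<^sup>+w. A w \<partial>pmeas \<gamma>)"
    by (intro add_left_mono 1)
  also note 2
  finally show ?thesis by (simp add: S_def[abs_def] h_def)
qed

section \<open>Exterior balls and the barrier\<close>

lemma linear_functional_bound:
  fixes l :: "'a::euclidean_space \<Rightarrow> real"
  assumes "linear l" "\<And>i. i \<in> Basis \<Longrightarrow> \<bar>l i\<bar> \<le> B"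
  shows "\<bar>l v\<bar> \<le> real DIM('a) * B * norm v"
proof -
  have "l v = l (\<Sum>i\<in>Basis. (v \<bullet> i) *\<^sub>R i)" by (simp add: euclidean_representation)
  also have "\<dots> = (\<Sum>i\<in>Basis. (v \<bullet> i) * l i)"
    using assms(1) by (simp add: linear_sum linear_scale)
  finally have "\<bar>l v\<bar> \<le> (\<Sum>i\<in>Basis. \<bar>v \<bullet> i\<bar> * \<bar>l i\<bar>)"
    by (metis (no_types, lifting) abs_mult sum.cong sum_abs)
  also have "\<dots> \<le> (\<Sum>i\<in>(Basis::'a set). norm v * B)"
    using assms(2) by (intro sum_mono mult_mono) (auto simp: Basis_le_norm)
  also have "\<dots> = real DIM('a) * B * norm v" by simp
  finally show ?thesis .
qed

lemma Ck_on_has_derivative: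
  assumes "Ck_on (Suc k) U f" "open U" "x \<in> U"
  shows "(f has_derivative frechet_derivative f (at x)) (at x)"
proof -
  have "f differentiable_on U" using assms(1) by simp
  then have "f differentiable at x" using assms(2,3) by (metis at_within_open differentiable_on_def)
  then show ?thesis by (simp only: frechet_derivative_works)
qed

lemma Ck_on_Suc_Lipschitz:
  fixes f :: "'a::euclidean_space \<Rightarrow> real"
  assumes "Ck_on (Suc 0) U f" "open U" "cball x0 r \<subseteq> U" "r \<ge> 0"
  obtains K where "K \<ge> 0" "\<And>x y. x \<in> cball x0 r \<Longrightarrow> y \<in> cball x0 r \<Longrightarrow> \<bar>f x - f y\<bar> \<le> K * norm (x - y)"
proof -
  define f' where "f' x = frechet_derivative f (at x)" for x
  have d: "(f has_derivative f' x) (at x)" if "x \<in> U" for x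
    unfolding f'_def using assms(1,2) that by (rule Ck_on_has_derivative)
  have "\<exists>B. \<forall>x\<in>cball x0 r. \<bar>f' x i\<bar> \<le> B" if i: "i \<in> Basis" for i
  proof -
    have "continuous_on U (\<lambda>x. f' x i)" using assms(1) i by (auto simp: f'_def)
    then have "continuous_on (cball x0 r) (\<lambda>x. f' x i)" using assms(3) by (rule continuous_on_subset)
    then have "compact ((\<lambda>x. f' x i) ` cball x0 r)" by (intro compact_continuous_image) auto
    then have "bounded ((\<lambda>x. f' x i) ` cball x0 r)" by (rule compact_imp_bounded)
    then show ?thesis by (auto simp: bounded_iff)
  qed
  then obtain B where B: "\<And>i x. i \<in> Basis \<Longrightarrow> x \<in> cball x0 r \<Longrightarrow> \<bar>f' x i\<bar> \<le> B i"
    by metis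
  define M where "M = (\<Sum>i\<in>Basis. \<bar>B i\<bar>)"
  have M0: "M \<ge> 0" unfolding M_def by (rule sum_nonneg) auto
  have M: "\<bar>f' x i\<bar> \<le> M" if "i \<in> Basis" "x \<in> cball x0 r" for i x
  proof -
    have "\<bar>f' x i\<bar> \<le> \<bar>B i\<bar>" using B[OF that] by linarith
    also have "\<dots> \<le> M" unfolding M_def using that by (intro member_le_sum) auto
    finally show ?thesis .
  qed
  show ?thesis
  proof (rule that[of "real DIM('a) * M"])
    show "real DIM('a) * M \<ge> 0" using M0 by simp
    fix x y assume xy: "x \<in> cball x0 r" "y \<in> cball x0 r"
    have "norm (f x - f y) \<le> (real DIM('a) * M) * norm (x - y)"
    proof (rule differentiable_bound[of "cball x0 r"])
      fix z assume z: "z \<in> cball x0 r"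
      then have dz: "(f has_derivative f' z) (at z)" using d assms(3) by auto
      then show "(f has_derivative f' z) (at z within cball x0 r)" by (rule has_derivative_at_withinI)
      show "onorm (f' z) \<le> real DIM('a) * M"
      proof (rule onorm_bound)
        fix v
        show "norm (f' z v) \<le> real DIM('a) * M * norm v"
          using linear_functional_bound[of "f' z" M v] M[OF _ z] has_derivative_linear[OF dz] by simp
      qed (use M0 in auto)
    qed (use xy in auto)
    then show "\<bar>f x - f y\<bar> \<le> real DIM('a) * M * norm (x - y)" by simp
  qed
qed

lemma Ck_on_2_Taylor:
  fixes f :: "'a::euclidean_space \<Rightarrow> real"
  assumes C2: "Ck_on (Suc (Suc 0)) U f" and U: "open U" "cball x0 r \<subseteq> U" "r \<ge> 0"
  defines "f' \<equiv> \<lambda>x. frechet_derivative f (at x)"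
  obtains K where "K \<ge> 0"
    "\<And>x y i. x \<in> cball x0 r \<Longrightarrow> y \<in> cball x0 r \<Longrightarrow> i \<in> Basis \<Longrightarrow> \<bar>f' x i - f' y i\<bar> \<le> K * norm (x - y)"
    "\<And>x y. x \<in> cball x0 r \<Longrightarrow> y \<in> cball x0 r \<Longrightarrow> \<bar>f y - f x - f' x (y - x)\<bar> \<le> K * (norm (y - x))\<^sup>2"
proof -
  have d: "(f has_derivative f' x) (at x)" if "x \<in> U" for x
    unfolding f'_def by (rule Ck_on_has_derivative[OF C2 U(1) that])
  have "\<exists>K\<ge>0. \<forall>x\<in>cball x0 r. \<forall>y\<in>cball x0 r. \<bar>f' x i - f' y i\<bar> \<le> K * norm (x - y)" if "i \<in> Basis" for i
  proof -
    have "\<forall>i\<in>Basis. Ck_on (Suc 0) U (\<lambda>x. f' x i)"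
      using C2 unfolding Ck_on.simps(2)[of "Suc 0" U f] f'_def by (elim conjE)
    then have "Ck_on (Suc 0) U (\<lambda>x. f' x i)" using that by (rule bspec)
    from Ck_on_Suc_Lipschitz[OF this U] obtain K where "K \<ge> 0"
      "\<And>x y. x \<in> cball x0 r \<Longrightarrow> y \<in> cball x0 r \<Longrightarrow> \<bar>f' x i - f' y i\<bar> \<le> K * norm (x - y)"
      by blast
    then show ?thesis by blast
  qed
  then have "\<forall>i\<in>Basis. \<exists>K. K \<ge> 0 \<and> (\<forall>x\<in>cball x0 r. \<forall>y\<in>cball x0 r. \<bar>f' x i - f' y i\<bar> \<le> K * norm (x - y))"
    by blast
  from bchoice[OF this] obtain B where B0: "\<forall>i\<in>Basis. B i \<ge> 0 \<and> (\<forall>x\<in>cball x0 r. \<forall>y\<in>cball x0 r. \<bar>f' x i - f' y i\<bar> \<le> B i * norm (x - y))"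
    by blast
  have B: "B i \<ge> 0" if "i \<in> Basis" for i using bspec[OF B0 that] by (rule conjunct1)
  have B2: "\<bar>f' x i - f' y i\<bar> \<le> B i * norm (x - y)" if "i \<in> Basis" "x \<in> cball x0 r" "y \<in> cball x0 r" for i x y
    using bspec[OF B0 that(1)] that(2,3) by blast
  define M where "M = (\<Sum>i\<in>Basis. B i)"
  have M0: "M \<ge> 0" unfolding M_def using B by (intro sum_nonneg) auto
  have M: "\<bar>f' x i - f' y i\<bar> \<le> M * norm (x - y)" if "i \<in> Basis" "x \<in> cball x0 r" "y \<in> cball x0 r" for i x y
  proof -
    have "\<bar>f' x i - f' y i\<bar> \<le> B i * norm (x - y)" by (rule B2[OF that])
    also have "\<dots> \<le> M * norm (x - y)" unfolding M_def using that B by (intro mult_right_mono member_le_sum) auto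
    finally show ?thesis .
  qed
  define K where "K = real DIM('a) * M"
  have "M * 1 \<le> M * real DIM('a)" using M0 by (intro mult_left_mono) (auto simp: Suc_leI)
  then have MK: "M \<le> K" by (simp add: K_def mult.commute)
  show ?thesis
  proof (rule that[of K])
    show "K \<ge> 0" using M0 MK by linarith
    show "\<bar>f' x i - f' y i\<bar> \<le> K * norm (x - y)" if "x \<in> cball x0 r" "y \<in> cball x0 r" "i \<in> Basis" for x y i
      using M[OF that(3,1,2)] mult_right_mono[OF MK, of "norm (x - y)"] by simp
    fix x y assume xy: "x \<in> cball x0 r" "y \<in> cball x0 r"
    have lin: "linear (f' z)" if "z \<in> cball x0 r" for z
      using has_derivative_linear[OF d] that U by auto
    \<comment> \<open>Intersecting with the ball of radius |y - x| around \<open>x\<close> keeps the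
      set convex and bounds the variation of the derivative by a multiple of |y - x|, so the mean
      value inequality yields a quadratic remainder.\<close>
    define S where "S = cball x0 r \<inter> cball x (norm (y - x))"
    have xS: "x \<in> S" using xy by (simp add: S_def)
    have yS: "y \<in> S" using xy by (simp add: S_def dist_norm norm_minus_commute)
    define h where "h z = f z - f' x z" for z
    have "norm (h y - h x) \<le> (K * norm (y - x)) * norm (y - x)"
    proof (rule differentiable_bound[of S h "\<lambda>z v. f' z v - f' x v"])
      show "convex S" unfolding S_def by (intro convex_Int) auto
      fix z assume z: "z \<in> S"
      then have zr: "z \<in> cball x0 r" and zx: "norm (z - x) \<le> norm (y - x)"
        by (auto simp: S_def dist_norm norm_minus_commute)
      have bl: "bounded_linear (f' x)" using has_derivative_bounded_linear[OF d] xy U by auto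
      have "z \<in> U" using zr U by auto
      then have "((\<lambda>y. f y - f' x y) has_derivative (\<lambda>v. f' z v - f' x v)) (at z)"
        by (intro has_derivative_diff d bounded_linear_imp_has_derivative bl)
      then show "(h has_derivative (\<lambda>v. f' z v - f' x v)) (at z within S)"
        unfolding h_def[abs_def] by (rule has_derivative_at_withinI)
      show "onorm (\<lambda>v. f' z v - f' x v) \<le> K * norm (y - x)"
      proof (rule onorm_bound)
        show "0 \<le> K * norm (y - x)" using M0 MK by simp
        fix v
        have "linear (\<lambda>v. f' z v - f' x v)" by (intro linear_compose_sub lin zr xy)
        moreover have "\<bar>f' z i - f' x i\<bar> \<le> M * norm (y - x)" if "i \<in> Basis" for i
          using M[OF that zr xy(1)] mult_left_mono[OF zx M0] by linarith
        ultimately have "\<bar>f' z v - f' x v\<bar> \<le> real DIM('a) * (M * norm (y - x)) * norm v"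
          by (rule linear_functional_bound)
        then show "norm (f' z v - f' x v) \<le> K * norm (y - x) * norm v" by (simp add: K_def mult_ac)
      qed
    qed (rule yS, rule xS)
    moreover have "f' x (y - x) = f' x y - f' x x" using lin[OF xy(1)] by (simp add: linear_diff)
    ultimately show "\<bar>f y - f x - f' x (y - x)\<bar> \<le> K * (norm (y - x))\<^sup>2"
      by (simp add: h_def power2_eq_square algebra_simps)
  qed
qed

text \<open>\<open>\<Omega>\<close> avoids the ball of radius \<open>1/(2M)\<close> that touches \<open>x\<close> from the side of \<open>-n\<close>.\<close>
definition support_parab :: "'a::euclidean_space set \<Rightarrow> real \<Rightarrow> 'a \<Rightarrow> 'a \<Rightarrow> bool" where
  "support_parab \<Omega> M x n \<longleftrightarrow> norm n = 1 \<and> (\<forall>y\<in>\<Omega>. 0 \<le> (y - x) \<bullet> n + M * (norm (y - x))\<^sup>2)"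

text \<open>With n the negative unit gradient of the defining function, Taylor's formula and
  \<psi>(y) < 0 = \<psi>(x) give the estimate for y near x. For |y - x| \<ge> R the quadratic term
  dominates as soon as M \<ge> 1/R.\<close>

lemma local_exterior_ball:
  assumes dom: "bounded_smooth_domain (\<Omega> :: 'a::euclidean_space set)" and x0: "x0 \<in> frontier \<Omega>"
  obtains r M where "r > 0" "M > 0" "\<And>x. x \<in> frontier \<Omega> \<Longrightarrow> x \<in> ball x0 r \<Longrightarrow> \<exists>n. support_parab \<Omega> M x n"
proof -
  from dom x0 obtain U \<psi> where U: "open U" "x0 \<in> U" "smooth_on U \<psi>"
    and nz: "\<And>y. y \<in> U \<Longrightarrow> frechet_derivative \<psi> (at y) \<noteq> (\<lambda>_. 0)"
    and \<Omega>U: "\<Omega> \<inter> U = {y \<in> U. \<psi> y < 0}"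
    unfolding bounded_smooth_domain_def by metis
  have op: "open \<Omega>" using dom by (simp add: bounded_smooth_domain_def)
  have C2: "Ck_on (Suc (Suc 0)) U \<psi>" using U(3) by (simp only: smooth_on_def)
  define f' where "f' x = frechet_derivative \<psi> (at x)" for x
  obtain R where R: "R > 0" "cball x0 (2 * R) \<subseteq> U"
  proof -
    obtain e where "e > 0" "cball x0 e \<subseteq> U" using U open_contains_cball by metis
    then show ?thesis using that[of "e / 2"] by auto
  qed
  obtain K where K: "K \<ge> 0"
    "\<And>x y i. x \<in> cball x0 (2 * R) \<Longrightarrow> y \<in> cball x0 (2 * R) \<Longrightarrow> i \<in> Basis \<Longrightarrow> \<bar>f' x i - f' y i\<bar> \<le> K * norm (x - y)"
    "\<And>x y. x \<in> cball x0 (2 * R) \<Longrightarrow> y \<in> cball x0 (2 * R) \<Longrightarrow> \<bar>\<psi> y - \<psi> x - f' x (y - x)\<bar> \<le> K * (norm (y - x))\<^sup>2"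
    using Ck_on_2_Taylor[OF C2 U(1) R(2)] R(1) unfolding f'_def by (metis less_eq_real_def mult_pos_pos zero_less_numeral)
  have d: "(\<psi> has_derivative f' x) (at x)" if "x \<in> U" for x
    unfolding f'_def using C2 U(1) that by (rule Ck_on_has_derivative)
  have lin: "linear (f' x)" if "x \<in> U" for x using has_derivative_linear[OF d[OF that]] .
  obtain i where i: "i \<in> Basis" "f' x0 i \<noteq> 0"
  proof -
    have "\<exists>i\<in>Basis. f' x0 i \<noteq> 0"
    proof (rule ccontr)
      assume "\<not> ?thesis"
      then have "\<bar>f' x0 v\<bar> \<le> real DIM('a) * 0 * norm v" for v
        using lin[OF U(2)] by (intro linear_functional_bound) auto
      then have "f' x0 = (\<lambda>_. 0)" by auto
      then show False using nz[OF U(2)] by (simp add: f'_def)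
    qed
    then show ?thesis using that by blast
  qed
  define g where "g = \<bar>f' x0 i\<bar> / 2"
  have g: "g > 0" using i by (simp add: g_def)
  \<comment> \<open>On this ball the i-th partial derivative moves by at most \<open>g\<close>, half
    of its size at \<open>x0\<close>, so the gradient has norm at least \<open>g\<close> at all
    boundary points in the ball.\<close>
  define r where "r = min R (g / (K + 1))"
  have r: "r > 0" "r \<le> R" "r \<le> g / (K + 1)" using R g K by (auto simp: r_def)
  \<comment> \<open>\<open>1 / R\<close> serves the points at distance at least R,
    \<open>K / g\<close> the Taylor remainder divided by the norm of the gradient.\<close>
  define M where "M = max (1 / R) (K / g) "
  have M: "M > 0" "M \<ge> 1 / R" "M \<ge> K / g" using R by (auto simp: M_def less_max_iff_disj)
  show ?thesis
  proof (rule that[OF r(1) M(1)])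
    fix x assume xf: "x \<in> frontier \<Omega>" and xb: "x \<in> ball x0 r"
    have xc: "x \<in> cball x0 (2 * R)" using xb r R by auto
    then have xU: "x \<in> U" using R by auto
    have \<psi>x: "\<psi> x = 0"
    proof (rule antisym)
      have "x \<notin> \<Omega>" using xf op by (simp add: frontier_def interior_open)
      then show "0 \<le> \<psi> x" using xU \<Omega>U by (metis (mono_tags, lifting) IntD1 linorder_not_le mem_Collect_eq)
      show "\<psi> x \<le> 0"
      proof (rule ccontr)
        assume "\<not> \<psi> x \<le> 0"
        then have pos: "\<psi> x > 0" by simp
        have cont: "continuous_on U \<psi>" using C2 by simp
        have "open (U \<inter> \<psi> -` {0<..})" by (rule continuous_open_preimage[OF cont U(1)]) auto
        moreover have "x \<in> U \<inter> \<psi> -` {0<..}" using xU pos by auto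
        moreover have "x \<in> closure \<Omega>" using xf by (simp add: frontier_def)
        ultimately obtain y where "y \<in> \<Omega>" "y \<in> U \<inter> \<psi> -` {0<..}"
          by (metis closure_iff_nhds_not_empty disjoint_iff subset_refl)
        then have "y \<in> \<Omega> \<inter> U" "0 < \<psi> y" by auto
        then show False unfolding \<Omega>U by simp
      qed
    qed
    define G where "G = (\<Sum>j\<in>Basis. f' x j *\<^sub>R j)"
    have fG: "f' x v = v \<bullet> G" for v
    proof -
      have "f' x v = f' x (\<Sum>j\<in>Basis. (v \<bullet> j) *\<^sub>R j)" by (simp add: euclidean_representation)
      also have "\<dots> = (\<Sum>j\<in>Basis. (v \<bullet> j) * f' x j)" using lin[OF xU] by (simp add: linear_sum linear_scale)
      also have "\<dots> = v \<bullet> G" by (simp add: G_def inner_sum_right mult.commute)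
      finally show ?thesis .
    qed
    have nG: "norm G \<ge> g"
    proof -
      have "\<bar>f' x i - f' x0 i\<bar> \<le> K * norm (x - x0)" using K(2)[OF xc _ i(1), of x0] R by auto
      also have "\<dots> \<le> (K + 1) * r" using xb K r by (intro mult_mono) (auto simp: dist_norm norm_minus_commute)
      also have "\<dots> \<le> (K + 1) * (g / (K + 1))" using r K by (intro mult_left_mono) auto
      also have "\<dots> = g" using K by simp
      finally have "\<bar>f' x i\<bar> \<ge> g" unfolding g_def by linarith
      also have "\<bar>f' x i\<bar> = \<bar>i \<bullet> G\<bar>" by (simp add: fG)
      also have "\<dots> \<le> norm G" using i(1) by (metis Basis_le_norm inner_commute)
      finally show ?thesis .
    qed
    define n where "n = - (1 / norm G) *\<^sub>R G"
    have n1: "norm n = 1" using nG g by (auto simp: n_def)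
    have "0 \<le> (y - x) \<bullet> n + M * (norm (y - x))\<^sup>2" if y: "y \<in> \<Omega>" for y
    proof (cases "norm (y - x) < R")
      case True
      have "y \<in> cball x0 (2 * R)"
      proof -
        have "norm (y - x0) \<le> norm (y - x) + norm (x - x0)" by (metis diff_add_cancel add_diff_eq norm_triangle_ineq)
        then show ?thesis using True xb r by (auto simp: dist_norm norm_minus_commute)
      qed
      from K(3)[OF xc this] have "f' x (y - x) \<le> \<psi> y - \<psi> x + K * (norm (y - x))\<^sup>2" by linarith
      moreover have "\<psi> y < 0" using \<open>y \<in> cball x0 (2 * R)\<close> R y \<Omega>U by auto
      ultimately have "(y - x) \<bullet> G \<le> K * (norm (y - x))\<^sup>2" by (simp add: fG \<psi>x)
      then have "(1 / norm G) * ((y - x) \<bullet> G) \<le> (1 / norm G) * (K * (norm (y - x))\<^sup>2)"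
        by (intro mult_left_mono) auto
      also have "\<dots> = (K / norm G) * (norm (y - x))\<^sup>2" by simp
      also have "\<dots> \<le> M * (norm (y - x))\<^sup>2"
      proof (rule mult_right_mono)
        have "norm G > 0" using nG g by linarith
        then have "K / norm G \<le> K / g" using nG g K(1) by (intro divide_left_mono mult_pos_pos) auto
        then show "K / norm G \<le> M" using M by linarith
      qed simp
      finally show ?thesis by (simp add: n_def)
    next
      case False
      have "\<bar>(y - x) \<bullet> n\<bar> \<le> norm (y - x) * norm n" by (rule Cauchy_Schwarz_ineq2)
      then have "(y - x) \<bullet> n \<ge> - norm (y - x)" using n1 by simp
      moreover have "norm (y - x) * 1 \<le> norm (y - x) * (M * norm (y - x))"
      proof (rule mult_left_mono)
        have "1 = (1 / R) * R" using R by simp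
        also have "\<dots> \<le> M * norm (y - x)" using M R False by (intro mult_mono) auto
        finally show "1 \<le> M * norm (y - x)" .
      qed simp
      ultimately show ?thesis by (simp add: power2_eq_square mult_ac)
    qed
    then show "\<exists>n. support_parab \<Omega> M x n" using n1 unfolding support_parab_def by blast
  qed
qed

lemma support_parab_mono: "support_parab \<Omega> M x n \<Longrightarrow> M \<le> M' \<Longrightarrow> support_parab \<Omega> M' x n"
  unfolding support_parab_def by (meson add_left_mono mult_right_mono order_trans zero_le_power2)

lemma uniform_exterior_ball:
  assumes dom: "bounded_smooth_domain (\<Omega> :: 'a::euclidean_space set)"
  obtains M where "M > 0" "\<And>x. x \<in> frontier \<Omega> \<Longrightarrow> \<exists>n. support_parab \<Omega> M x n"
proof -
  have "bounded \<Omega>" using dom by (simp add: bounded_smooth_domain_def)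
  then have comp: "compact (frontier \<Omega>)" by (rule compact_frontier_bounded)
  have "\<forall>x0\<in>frontier \<Omega>. \<exists>r M. r > 0 \<and> M > 0 \<and> (\<forall>x\<in>frontier \<Omega>. x \<in> ball x0 r \<longrightarrow> (\<exists>n. support_parab \<Omega> M x n))"
    using local_exterior_ball[OF dom] by metis
  then obtain r M where rM: "\<And>x0. x0 \<in> frontier \<Omega> \<Longrightarrow> r x0 > 0 \<and> M x0 > 0 \<and> (\<forall>x\<in>frontier \<Omega>. x \<in> ball x0 (r x0) \<longrightarrow> (\<exists>n. support_parab \<Omega> (M x0) x n))"
    by metis
  obtain F where F: "F \<subseteq> frontier \<Omega>" "finite F" "frontier \<Omega> \<subseteq> (\<Union>x\<in>F. ball x (r x))"
    using compactE_image[OF comp, of "frontier \<Omega>" "\<lambda>x. ball x (r x)"] rM by (metis (no_types, lifting) UN_I centre_in_ball open_ball subsetI)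
  \<comment> \<open>The sum dominates every local constant of the finite cover, and the summand 1
    keeps the bound positive in all cases.\<close>
  define M0 where "M0 = 1 + (\<Sum>x\<in>F. M x)"
  have Mpos: "M x \<ge> 0" if "x \<in> F" for x using rM F that by (meson less_eq_real_def subsetD)
  show ?thesis
  proof (rule that[of M0])
    show "M0 > 0" unfolding M0_def using Mpos by (intro add_pos_nonneg sum_nonneg) auto
    fix x assume x: "x \<in> frontier \<Omega>"
    then obtain y where y: "y \<in> F" "x \<in> ball y (r y)" using F by blast
    then obtain n where n: "support_parab \<Omega> (M y) x n" using rM[of y] F x by blast
    have "M y \<le> (\<Sum>x\<in>F. M x)" using y F Mpos by (intro member_le_sum) auto
    then have "M y \<le> M0" by (simp add: M0_def)
    then show "\<exists>n. support_parab \<Omega> M0 x n" using support_parab_mono[OF n] by blast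
  qed
qed

text \<open>Raising a neighbouring value raises the inflow and, by the companion lemma, lowers the
  outflow. Hence a function touched from above at a point inherits the supersolution inequality
  there, which lets an infimum of model barriers be a barrier.\<close>

lemma cutp_mono_left:
  assumes "d1 \<le> d2" "0 \<le> d1" "0 \<le> d" "0 \<le> q" "q \<le> 1" "0 < s" "p > 1"
  shows "cutp s p q d1 d \<le> cutp s p q d2 d"
proof (cases "d \<le> q * d1")
  case True
  have "q * d1 \<le> q * d2" using assms by (intro mult_left_mono) auto
  then have 2: "d \<le> q * d2" using True by linarith
  have "q * d1 \<le> 1 * d1" using assms by (intro mult_right_mono) auto
  then have "d powr s \<le> d1 powr s" using True assms by (intro powr_mono2) auto
  moreover have "d1 powr s \<le> d2 powr s" using assms by (intro powr_mono2) auto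
  ultimately show ?thesis using True 2 assms by (auto simp: cutp_def intro!: powr_mono2)
qed (auto simp: cutp_def)

lemma cutp_mono_right:
  assumes "d1 \<le> d2" "0 \<le> d1" "0 \<le> d" "0 \<le> q" "q \<le> 1" "0 < s" "p > 1"
  shows "cutp s p q d d2 \<le> cutp s p q d d1"
proof (cases "d2 \<le> q * d")
  case True
  then have 2: "d1 \<le> q * d" using assms by linarith
  have "q * d \<le> 1 * d" using assms by (intro mult_right_mono) auto
  then have "d2 powr s \<le> d powr s" using True assms by (intro powr_mono2) auto
  moreover have "d1 powr s \<le> d2 powr s" using assms by (intro powr_mono2) auto
  ultimately show ?thesis using True 2 assms by (auto simp: cutp_def intro!: powr_mono2)
qed (auto simp: cutp_def)

lemma clip_mono: "a \<le> b \<Longrightarrow> clip L a \<le> clip L b"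
  by (auto simp: clip_def)

lemma clip_nonneg [simp]: "clip L a \<ge> 0"
  by (simp add: clip_def)

text \<open>If t \<ge> a, the cut-off forces an increment of at least (1/q - 1) a, hence |z| bounded
  below, and away from the origin the kernel has finite mass. The bound needs a positive lower limit
  for the barrier, which is why the barrier is raised by \<kappa>.\<close>

lemma barrier_inflow_bound:
  fixes s p M L a q :: real
  assumes "0 < s" "p > 1" "M > 0" "L > 0" "a > 0" "1/2 \<le> q" "q < 1"
  obtains B where "\<And>t (b :: 'a::euclidean_space). a \<le> t \<Longrightarrow> norm b \<le> 2 \<Longrightarrow>
    (\<integral>\<^sup>+z. ennreal (cutp s p q (clip L (t + (z \<bullet> b + M * (norm z)\<^sup>2))) t) \<partial>kmeas (s * p)) \<le> ennreal B"
proof -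
  define \<epsilon> where "\<epsilon> = (1 / q - 1) * a"
  have \<epsilon>: "\<epsilon> > 0" using assms by (simp add: \<epsilon>_def)
  \<comment> \<open>For |z| \<le> 1 and |b| \<le> 2 the increment is at most (2 + M)|z|.\<close>
  define r where "r = min 1 (\<epsilon> / (2 + M))"
  have r: "r > 0" "r \<le> 1" "r \<le> \<epsilon> / (2 + M)" using \<epsilon> assms by (auto simp: r_def)
  define V where "V = 2 ^ DIM('a) * unit_ball_vol (real DIM('a)) * r powr (- (s * p)) / (1 - 2 powr (- (s * p)))"
  define B where "B = (L powr s) powr (p - 1) * V"
  show ?thesis
  proof (rule that[of B])
    fix t :: real and b :: 'a assume t: "a \<le> t" and b: "norm b \<le> 2"
    have "(\<integral>\<^sup>+z. ennreal (cutp s p q (clip L (t + (z \<bullet> b + M * (norm z)\<^sup>2))) t) \<partial>kmeas (s * p))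
      \<le> (\<integral>\<^sup>+z. ennreal ((L powr s) powr (p - 1)) * indicator {z::'a. r \<le> norm z} z \<partial>kmeas (s * p))"
    proof (rule nn_integral_mono)
      fix z :: 'a
      define d where "d = clip L (t + (z \<bullet> b + M * (norm z)\<^sup>2))"
      show "ennreal (cutp s p q d t) \<le> ennreal ((L powr s) powr (p - 1)) * indicator {z. r \<le> norm z} z"
      proof (cases "t \<le> q * d")
        case False
        then show ?thesis by (simp add: cutp_def)
      next
        case True
        have d: "0 \<le> d" "d \<le> L" using assms by (auto simp: d_def clip_def)
        have "q * d \<le> 1 * d" using assms d by (intro mult_right_mono) auto
        then have "t \<le> d" using True by linarith
        then have "t powr s \<le> d powr s" using assms t by (intro powr_mono2) auto
        moreover have "d powr s \<le> L powr s" using assms d by (intro powr_mono2) auto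
        moreover have "0 \<le> t powr s" by simp
        ultimately have "0 \<le> d powr s - t powr s" "d powr s - t powr s \<le> L powr s" by linarith+
        then have 1: "(d powr s - t powr s) powr (p - 1) \<le> (L powr s) powr (p - 1)"
          using assms by (intro powr_mono2) auto
        have "r \<le> norm z"
        proof (rule ccontr)
          assume "\<not> r \<le> norm z"
          then have nz: "norm z < r" "norm z \<le> 1" using r by auto
          have "t / q \<le> d" using True assms by (simp add: field_simps)
          moreover have "t / q > 0" using t assms by simp
          ultimately have "t / q \<le> t + (z \<bullet> b + M * (norm z)\<^sup>2)" unfolding d_def clip_def by linarith
          then have "(1 / q - 1) * t \<le> z \<bullet> b + M * (norm z)\<^sup>2" by (simp add: algebra_simps)
          moreover have "(1 / q - 1) * a \<le> (1 / q - 1) * t" using assms t by (intro mult_left_mono) auto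
          ultimately have "\<epsilon> \<le> z \<bullet> b + M * (norm z)\<^sup>2" by (simp add: \<epsilon>_def)
          moreover have "\<bar>z \<bullet> b\<bar> \<le> norm z * norm b" by (rule Cauchy_Schwarz_ineq2)
          moreover have "norm z * norm b \<le> norm z * 2" using b by (intro mult_left_mono) auto
          moreover have "M * (norm z)\<^sup>2 \<le> M * norm z"
            using nz assms mult_left_mono[of "norm z" 1 "norm z"] by (simp add: power2_eq_square)
          ultimately have "\<epsilon> \<le> (2 + M) * norm z" by (simp add: algebra_simps)
          also have "\<dots> < (2 + M) * r" using nz assms by (intro mult_strict_left_mono) auto
          also have "\<dots> \<le> (2 + M) * (\<epsilon> / (2 + M))" using r assms by (intro mult_left_mono) auto
          also have "\<dots> = \<epsilon>" using assms by simp
          finally show False by simp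
        qed
        then show ?thesis using 1 True by (simp add: cutp_def ennreal_leI)
      qed
    qed
    also have "\<dots> = ennreal ((L powr s) powr (p - 1)) * emeasure (kmeas (s * p)) {z::'a. r \<le> norm z}"
      by (rule nn_integral_cmult_indicator) simp
    also have "\<dots> \<le> ennreal ((L powr s) powr (p - 1)) * ennreal V"
      unfolding V_def using assms r by (intro mult_left_mono kmeas_tail_finite) auto
    also have "\<dots> = ennreal B" unfolding B_def by (rule ennreal_mult''[symmetric]) (use assms in \<open>auto simp: V_def powr_less_one less_imp_le intro!: divide_nonneg_nonneg\<close>)
    finally show "(\<integral>\<^sup>+z. ennreal (cutp s p q (clip L (t + (z \<bullet> b + M * (norm z)\<^sup>2))) t) \<partial>kmeas (s * p)) \<le> ennreal B" .
  qed
qed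

lemma bounded_smooth_domain_frontier_nonempty:
  fixes \<Omega> :: "'a::euclidean_space set"
  assumes "bounded_smooth_domain \<Omega>"
  shows "frontier \<Omega> \<noteq> {}"
  using assms frontier_not_empty[of \<Omega>] not_bounded_UNIV unfolding bounded_smooth_domain_def by metis

text \<open>The power \<open>D\<^sup>s\<close> is a strict supersolution at the points of \<open>\<Omega>\<close> where \<open>D\<close> is at most half of the cap \<open>L\<close>.
  The uniform bound only serves to subtract the integrals of \<open>cutp\<close>.\<close>
definition barrier_function :: "'a::euclidean_space set \<Rightarrow> real \<Rightarrow> real \<Rightarrow> real \<Rightarrow> real \<Rightarrow> ('a \<Rightarrow> real) \<Rightarrow> bool" where
  "barrier_function \<Omega> s p L F D \<longleftrightarrow> D \<in> borel_measurable borel \<and> (\<forall>x. 0 \<le> D x) \<and>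
    (\<forall>q x. 1/2 \<le> q \<longrightarrow> q < 1 \<longrightarrow> x \<in> \<Omega> \<longrightarrow> D x \<le> L / 2 \<longrightarrow>
      (\<integral>\<^sup>+z. ennreal (cutp s p q (D (x + z)) (D x)) \<partial>kmeas (s * p)) + ennreal F
      \<le> (\<integral>\<^sup>+z. ennreal (cutp s p q (D x) (D (x + z))) \<partial>kmeas (s * p))) \<and>
    (\<exists>B. \<forall>q x. 1/2 \<le> q \<longrightarrow> q < 1 \<longrightarrow> x \<in> \<Omega> \<longrightarrow> D x \<le> L / 2 \<longrightarrow>
      (\<integral>\<^sup>+z. ennreal (cutp s p q (D (x + z)) (D x)) \<partial>kmeas (s * p)) \<le> ennreal (B q))"

text \<open>At each x the infimum defining \<open>d\<close> is attained by a quadratic function,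
  which after raising and capping touches \<open>D\<close> from above at x; the kernel inequality
  passes from it to \<open>D\<close>. An infimum of quadratics replaces the distance function, so
  neither its differentiability nor unique nearest points enter. \<open>L\<close>, \<open>F\<close>,
  \<open>K\<close> are obtained before \<kappa> and do not depend on it.\<close>

lemma barrier_exists:
  fixes \<Omega> :: "'a::euclidean_space set" and s p :: real
  assumes dom: "bounded_smooth_domain \<Omega>" and s: "0 < s" "s < 1" and p: "p > 1"
  obtains L F K :: real where "L > 0" "F > 0" "K > 0"
    "\<And>\<kappa>. \<kappa> > 0 \<Longrightarrow> \<exists>D :: 'a \<Rightarrow> real. barrier_function \<Omega> s p L F D \<and> (\<forall>x\<in>\<Omega>. D x \<le> \<kappa> + K * dist_bd \<Omega> x)"
proof -
  obtain M where M: "M > 0" and ext: "\<And>x. x \<in> frontier \<Omega> \<Longrightarrow> \<exists>n. support_parab \<Omega> M x n"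
    using uniform_exterior_ball[OF dom] by metis
  obtain e0 f0 where e0: "e0 > 0" and f0: "f0 > 0" and ker:
    "\<And>M L t q (b :: 'a). M > 0 \<Longrightarrow> L > 0 \<Longrightarrow> M * L \<le> e0 \<Longrightarrow> 0 < t \<Longrightarrow> t \<le> L / 2 \<Longrightarrow>
      1/2 \<le> q \<Longrightarrow> q < 1 \<Longrightarrow> 1 \<le> norm b \<Longrightarrow> norm b \<le> 2 \<Longrightarrow>
      (\<integral>\<^sup>+z. ennreal (cutp s p q (clip L (t + (z \<bullet> b + M * (norm z)\<^sup>2))) t) \<partial>kmeas (s * p)) + ennreal (f0 * L powr (- s))
      \<le> (\<integral>\<^sup>+z. ennreal (cutp s p q t (clip L (t + (z \<bullet> b + M * (norm z)\<^sup>2)))) \<partial>kmeas (s * p))"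
    by (rule barrier_kernel[OF s p, where 'a='a]) (rule that)
  \<comment> \<open>\<open>M * L \<le> e0\<close> is required by the kernel inequality;
    \<open>M * L \<le> 1\<close> keeps the gradients \<open>b\<close> below norm 2 where D \<le>
    L/2.\<close>
  define L where "L = min e0 1 / M"
  have L: "L > 0" "M * L \<le> e0" "M * L \<le> 1" using M e0 by (auto simp: L_def)
  define F where "F = f0 * L powr (- s)"
  have F: "F > 0" using f0 L by (simp add: F_def)
  have bd: "bounded \<Omega>" and op: "open \<Omega>" and ne: "\<Omega> \<noteq> {}" using dom by (auto simp: bounded_smooth_domain_def)
  have fr: "frontier \<Omega> \<noteq> {}" by (rule bounded_smooth_domain_frontier_nonempty[OF dom])
  have cfr: "compact (frontier \<Omega>)" using bd by (rule compact_frontier_bounded)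
  obtain R where R: "R > 0" "\<And>x. x \<in> \<Omega> \<union> frontier \<Omega> \<Longrightarrow> norm x \<le> R"
  proof -
    have "bounded (\<Omega> \<union> frontier \<Omega>)" using bd cfr by (simp add: compact_imp_bounded)
    then show ?thesis using that unfolding bounded_pos by metis
  qed
  define K where "K = 1 + M * (2 * R)"
  have K: "K > 0" using M R by (simp add: K_def add_pos_pos)
  define rho where "rho w x = (x - fst w) \<bullet> snd w + M * (norm (x - fst w))\<^sup>2" for w :: "'a \<times> 'a" and x
  \<comment> \<open>Pairs of a boundary point and a unit normal of an exterior ball there. All
    conditions are closed, so \<open>P\<close> is compact and infima over it are attained; no choice
    of one normal per point is made.\<close>
  define P where "P = {w. fst w \<in> frontier \<Omega> \<and> support_parab \<Omega> M (fst w) (snd w)}"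
  have rho_cont: "continuous_on UNIV (\<lambda>w. rho w x)" for x
    unfolding rho_def by (intro continuous_intros)
  have P_eq: "P = (frontier \<Omega> \<times> sphere 0 1) \<inter> (\<Inter>y\<in>\<Omega>. {w. 0 \<le> rho w y})"
    unfolding P_def support_parab_def rho_def by auto
  have Pcomp: "compact P"
  proof -
    have "closed {w. 0 \<le> rho w y}" for y
      using rho_cont[of y] by (intro closed_Collect_le) (auto intro: continuous_on_const)
    then have "closed (\<Inter>y\<in>\<Omega>. {w. 0 \<le> rho w y})" by auto
    moreover have "compact (frontier \<Omega> \<times> sphere (0::'a) 1)" using cfr by (intro compact_Times) auto
    ultimately show ?thesis unfolding P_eq by (rule compact_Int_closed[rotated])
  qed
  have Pne: "P \<noteq> {}" using fr ext unfolding P_def by fastforce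
  define d where "d x = Inf ((\<lambda>w. rho w x) ` P)" for x
  have att: "\<exists>w\<in>P. d x = rho w x \<and> (\<forall>w'\<in>P. rho w x \<le> rho w' x)" for x
  proof -
    have "continuous_on P (\<lambda>w. rho w x)" using rho_cont by (rule continuous_on_subset) auto
    then obtain w where w: "w \<in> P" "\<forall>w'\<in>P. rho w x \<le> rho w' x"
      using continuous_attains_inf[OF Pcomp Pne] by metis
    moreover have "d x = rho w x" unfolding d_def using w by (intro cInf_eq_minimum) auto
    ultimately show ?thesis by blast
  qed
  have d_le: "d x \<le> rho w x" if "w \<in> P" for w x using att[of x] that by auto
  \<comment> \<open>The infimum runs over a possibly uncountable family, but since it is attained,
    each strict sublevel set is a union of open sets.\<close>
  have d_meas[measurable]: "d \<in> borel_measurable borel"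
  proof (rule borel_measurableI_less)
    fix y
    have "{x. d x < y} = (\<Union>w\<in>P. {x. rho w x < y})"
    proof (intro set_eqI iffI)
      fix x assume "x \<in> {x. d x < y}"
      then show "x \<in> (\<Union>w\<in>P. {x. rho w x < y})" using att[of x] by auto
    next
      fix x assume "x \<in> (\<Union>w\<in>P. {x. rho w x < y})"
      then show "x \<in> {x. d x < y}" using d_le by (auto intro: le_less_trans)
    qed
    moreover have "open {x. rho w x < y}" for w
      unfolding rho_def by (intro open_Collect_less continuous_intros)
    ultimately show "{x \<in> space borel. d x < y} \<in> sets borel" by (auto intro!: borel_open)
  qed
  show ?thesis
  proof (rule that[OF L(1) F K])
    fix \<kappa> :: real assume \<kappa>: "\<kappa> > 0"
    define D where "D x = clip L (\<kappa> + d x)" for x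
    have [measurable]: "D \<in> borel_measurable borel" unfolding D_def[abs_def] clip_def by measurable
    have D0: "0 \<le> D x" for x by (simp add: D_def)
    have D_le: "D x \<le> \<kappa> + K * dist_bd \<Omega> x" if x: "x \<in> \<Omega>" for x
    proof -
      obtain x0 where x0: "x0 \<in> frontier \<Omega>" "dist_bd \<Omega> x = dist x x0"
        unfolding dist_bd_def using infdist_attains_inf[OF frontier_closed fr, of x] by metis
      obtain n where n: "support_parab \<Omega> M x0 n" using ext[OF x0(1)] by blast
      then have w: "(x0, n) \<in> P" using x0 by (simp add: P_def)
      have n1: "norm n = 1" using n by (simp add: support_parab_def)
      have "d x \<le> rho (x0, n) x" by (rule d_le[OF w])
      also have "\<dots> \<le> norm (x - x0) + M * (norm (x - x0))\<^sup>2"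
      proof -
        have "\<bar>(x - x0) \<bullet> n\<bar> \<le> norm (x - x0) * norm n" by (rule Cauchy_Schwarz_ineq2)
        then show ?thesis using n1 by (simp add: rho_def)
      qed
      also have "\<dots> \<le> K * norm (x - x0)"
      proof -
        have "norm (x - x0) \<le> norm x + norm x0" by (rule norm_triangle_ineq4)
        also have "\<dots> \<le> 2 * R" using R(2)[of x] R(2)[of x0] x x0 by auto
        finally have "norm (x - x0) * norm (x - x0) \<le> 2 * R * norm (x - x0)" by (intro mult_right_mono) auto
        then have "M * (norm (x - x0) * norm (x - x0)) \<le> M * (2 * R * norm (x - x0))" using M by (intro mult_left_mono) auto
        then show ?thesis by (simp add: K_def power2_eq_square algebra_simps)
      qed
      finally have 1: "d x \<le> K * dist_bd \<Omega> x" using x0 by (simp add: dist_norm)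
      have "0 \<le> K * dist_bd \<Omega> x" using K x0 by simp
      then show ?thesis using 1 \<kappa> unfolding D_def clip_def by linarith
    qed
    have main: "\<exists>t b. \<kappa> \<le> t \<and> t \<le> L / 2 \<and> D x = t \<and> 1 \<le> norm b \<and> norm b \<le> 2 \<and>
      (\<forall>z. D (x + z) \<le> clip L (t + (z \<bullet> b + M * (norm z)\<^sup>2)))" if x: "x \<in> \<Omega>" "D x \<le> L / 2" for x
    proof -
      obtain w where w: "w \<in> P" "d x = rho w x" using att[of x] by blast
      define t where "t = \<kappa> + d x"
      have d0: "d x \<ge> 0" using w x unfolding P_def support_parab_def rho_def by auto
      have t: "\<kappa> \<le> t" using d0 by (simp add: t_def)
      have Dt: "D x = t" using x(2) t \<kappa> L unfolding D_def t_def clip_def by linarith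
      \<comment> \<open>The gradient at x of the minimising quadratic function. The expansion at x +
        z is exact, and completing the square gives |b|^2 = 1 + 4 M d(x), which is at least 1 and at
        most 3 here.\<close>
      define b where "b = snd w + (2 * M) *\<^sub>R (x - fst w)"
      have n1: "snd w \<bullet> snd w = 1" using w unfolding P_def support_parab_def by (auto simp: dot_square_norm)
      have exp: "rho w (x + z) = d x + (z \<bullet> b + M * (norm z)\<^sup>2)" for z
        unfolding w(2) rho_def b_def power2_norm_eq_inner
        by (simp add: algebra_simps inner_commute)
      have "b \<bullet> b = 1 + 4 * M * d x"
        unfolding w(2) rho_def b_def power2_norm_eq_inner
        using n1 by (simp add: algebra_simps inner_commute)
      then have nb: "(norm b)\<^sup>2 = 1 + 4 * M * d x" by (simp add: power2_norm_eq_inner)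
      have "1 \<le> (norm b)\<^sup>2" using nb M d0 by simp
      then have b1: "1 \<le> norm b" by (metis norm_ge_zero one_power2 power2_le_imp_le)
      have "d x \<le> L / 2" using x(2) Dt \<kappa> by (simp add: t_def)
      then have "M * d x \<le> M * (L / 2)" using M by (intro mult_left_mono) auto
      then have "(norm b)\<^sup>2 \<le> 2\<^sup>2" using nb L by simp
      then have b2: "norm b \<le> 2" by (rule power2_le_imp_le) simp
      have "D (x + z) \<le> clip L (t + (z \<bullet> b + M * (norm z)\<^sup>2))" for z
        unfolding D_def using d_le[OF w(1), of "x + z"] exp[of z] by (intro clip_mono) (simp add: t_def)
      then show ?thesis using t Dt x(2) b1 b2 by blast
    qed
    have key: "(\<integral>\<^sup>+z. ennreal (cutp s p q (D (x + z)) (D x)) \<partial>kmeas (s * p)) + ennreal F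
       \<le> (\<integral>\<^sup>+z. ennreal (cutp s p q (D x) (D (x + z))) \<partial>kmeas (s * p))"
      if q: "1/2 \<le> q" "q < 1" and x: "x \<in> \<Omega>" "D x \<le> L / 2" for q x
    proof -
      obtain t b where tb: "\<kappa> \<le> t" "t \<le> L / 2" "D x = t" "1 \<le> norm b" "norm b \<le> 2"
        and up: "\<And>z. D (x + z) \<le> clip L (t + (z \<bullet> b + M * (norm z)\<^sup>2))"
        using main[OF x] by blast
      have t: "t > 0" using tb \<kappa> by linarith
      have "(\<integral>\<^sup>+z. ennreal (cutp s p q (D (x + z)) (D x)) \<partial>kmeas (s * p)) + ennreal F
        \<le> (\<integral>\<^sup>+z. ennreal (cutp s p q (clip L (t + (z \<bullet> b + M * (norm z)\<^sup>2))) t) \<partial>kmeas (s * p)) + ennreal F"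
        using up D0 q t s p unfolding tb(3) by (intro add_right_mono nn_integral_mono ennreal_leI cutp_mono_left) auto
      also have "\<dots> \<le> (\<integral>\<^sup>+z. ennreal (cutp s p q t (clip L (t + (z \<bullet> b + M * (norm z)\<^sup>2)))) \<partial>kmeas (s * p))"
        unfolding F_def by (rule ker) (use M L t tb q in auto)
      also have "\<dots> \<le> (\<integral>\<^sup>+z. ennreal (cutp s p q (D x) (D (x + z))) \<partial>kmeas (s * p))"
        using up D0 q t s p unfolding tb(3) by (intro nn_integral_mono ennreal_leI cutp_mono_right) auto
      finally show ?thesis .
    qed
    have "\<exists>B. \<forall>x. x \<in> \<Omega> \<longrightarrow> D x \<le> L / 2 \<longrightarrow>
        (\<integral>\<^sup>+z. ennreal (cutp s p q (D (x + z)) (D x)) \<partial>kmeas (s * p)) \<le> ennreal B" if q: "1/2 \<le> q" "q < 1" for q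
    proof -
      obtain B where B: "\<And>t (b :: 'a). \<kappa> \<le> t \<Longrightarrow> norm b \<le> 2 \<Longrightarrow>
        (\<integral>\<^sup>+z. ennreal (cutp s p q (clip L (t + (z \<bullet> b + M * (norm z)\<^sup>2))) t) \<partial>kmeas (s * p)) \<le> ennreal B"
        by (rule barrier_inflow_bound[OF s(1) p M L(1) \<kappa> q, where 'a='a]) (rule that)
      have "(\<integral>\<^sup>+z. ennreal (cutp s p q (D (x + z)) (D x)) \<partial>kmeas (s * p)) \<le> ennreal B"
        if x: "x \<in> \<Omega>" "D x \<le> L / 2" for x
      proof -
        obtain t b where tb: "\<kappa> \<le> t" "t \<le> L / 2" "D x = t" "1 \<le> norm b" "norm b \<le> 2"
          and up: "\<And>z. D (x + z) \<le> clip L (t + (z \<bullet> b + M * (norm z)\<^sup>2))"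
          using main[OF x] by blast
        have "(\<integral>\<^sup>+z. ennreal (cutp s p q (D (x + z)) (D x)) \<partial>kmeas (s * p))
          \<le> (\<integral>\<^sup>+z. ennreal (cutp s p q (clip L (t + (z \<bullet> b + M * (norm z)\<^sup>2))) t) \<partial>kmeas (s * p))"
          using up D0 q tb \<kappa> s p unfolding tb(3) by (intro nn_integral_mono ennreal_leI cutp_mono_left) auto
        also have "\<dots> \<le> ennreal B" by (rule B[OF tb(1,5)])
        finally show ?thesis .
      qed
      then show ?thesis by blast
    qed
    then have "\<forall>q. \<exists>B. 1/2 \<le> q \<longrightarrow> q < 1 \<longrightarrow> (\<forall>x. x \<in> \<Omega> \<longrightarrow> D x \<le> L / 2 \<longrightarrow>
        (\<integral>\<^sup>+z. ennreal (cutp s p q (D (x + z)) (D x)) \<partial>kmeas (s * p)) \<le> ennreal B)"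
      by blast
    from choice[OF this] have bdd: "\<exists>B. \<forall>q x. 1/2 \<le> q \<longrightarrow> q < 1 \<longrightarrow> x \<in> \<Omega> \<longrightarrow> D x \<le> L / 2 \<longrightarrow>
        (\<integral>\<^sup>+z. ennreal (cutp s p q (D (x + z)) (D x)) \<partial>kmeas (s * p)) \<le> ennreal (B q)"
      by blast
    show "\<exists>D :: 'a \<Rightarrow> real. barrier_function \<Omega> s p L F D \<and> (\<forall>x\<in>\<Omega>. D x \<le> \<kappa> + K * dist_bd \<Omega> x)"
      unfolding barrier_function_def using key D_le D0 bdd by (intro exI[of _ D] conjI) auto
  qed
qed

section \<open>Energy estimates\<close>

lemma prim_has_derivative:
  assumes "continuous_on UNIV g"
  shows "(prim g has_real_derivative g t) (at t)"
proof -
  \<comment> \<open>An interval with both 0 and t in its interior, so that the derivative within it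
    is the full derivative.\<close>
  define a where "a = - \<bar>t\<bar> - 1"
  define b where "b = \<bar>t\<bar> + 1"
  have "((\<lambda>u. LBINT y=0..u. g y) has_vector_derivative g t) (at t within {a..b})"
    by (rule interval_integral_FTC2[of a 0 b g t, unfolded zero_ereal_def[symmetric]])
       (use assms in \<open>auto simp: a_def b_def zero_ereal_def intro: continuous_on_subset\<close>)
  moreover have "at t within {a..b} = at t"
    by (rule at_within_interior) (auto simp: a_def b_def)
  ultimately have "((\<lambda>u. LBINT y=0..u. g y) has_vector_derivative g t) (at t)" by simp
  then have "((\<lambda>u. LBINT y=0..u. g y) has_real_derivative g t) (at t)"
    by (simp add: has_real_derivative_iff_has_vector_derivative)
  then show ?thesis unfolding prim_def[abs_def] by (simp add: zero_ereal_def)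
qed

lemma prim_0 [simp]: "prim g 0 = 0"
  by (simp add: prim_def zero_ereal_def[symmetric])

lemma prim_continuous:
  assumes "continuous_on UNIV g"
  shows "continuous_on UNIV (prim g)"
  using prim_has_derivative[OF assms] by (meson DERIV_continuous continuous_at_imp_continuous_on)

lemma prim_measurable:
  assumes "continuous_on UNIV g"
  shows "prim g \<in> borel_measurable borel"
  by (rule borel_measurable_continuous_onI) (rule prim_continuous[OF assms])

lemma prim_diff_le:
  assumes g: "continuous_on UNIV g" and B: "\<And>x. min a b \<le> x \<Longrightarrow> x \<le> max a b \<Longrightarrow> \<bar>g x\<bar> \<le> B"
  shows "\<bar>prim g a - prim g b\<bar> \<le> B * \<bar>a - b\<bar>"
proof -
  have *: "\<bar>prim g y - prim g x\<bar> \<le> B * \<bar>y - x\<bar>"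
    if xy: "x < y" and gB: "\<And>z. x \<le> z \<Longrightarrow> z \<le> y \<Longrightarrow> \<bar>g z\<bar> \<le> B" for x y
  proof -
    obtain z where z: "x < z" "z < y" "prim g y - prim g x = (y - x) * g z"
      using MVT2[OF xy, of "prim g" g] prim_has_derivative[OF g] by blast
    then have "\<bar>prim g y - prim g x\<bar> = \<bar>y - x\<bar> * \<bar>g z\<bar>" by (simp add: abs_mult)
    also have "\<dots> \<le> \<bar>y - x\<bar> * B" using gB[of z] z by (intro mult_left_mono) auto
    finally show ?thesis by (simp add: mult.commute)
  qed
  consider "a = b" | "a < b" | "b < a" by linarith
  then show ?thesis
  proof cases
    case 2
    from *[OF this] B 2 show ?thesis by (simp add: abs_minus_commute)
  next
    case 3
    from *[OF this] B 3 show ?thesis by simp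
  qed simp
qed

lemma energy_eq:
  assumes "p > 0"
  shows "energy \<Omega> s p g u = 1 / p * enn2real (gagliardo s p u) - (LINT x:\<Omega>|lborel. prim g (u x))"
  using assms by (simp add: energy_def X_norm_def powr_powr)

lemma set_integrable_bounded_lborel:
  fixes f :: "'a::euclidean_space \<Rightarrow> real"
  assumes "\<Omega> \<in> sets borel" "emeasure lborel \<Omega> < \<infinity>" "f \<in> borel_measurable borel" "\<And>x. x \<in> \<Omega> \<Longrightarrow> \<bar>f x\<bar> \<le> B"
  shows "set_integrable lborel \<Omega> f"
  unfolding set_integrable_def
proof (rule integrableI_bounded_set[where A = \<Omega> and B = B])
  show "AE x in lborel. x \<in> \<Omega> \<longrightarrow> norm (indicat_real \<Omega> x *\<^sub>R f x) \<le> B" using assms(4) by auto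
qed (use assms in auto)

lemma prim_comp_integrable:
  fixes u :: "'a::euclidean_space \<Rightarrow> real"
  assumes g: "continuous_on UNIV g" and \<Omega>: "\<Omega> \<in> sets borel" "emeasure lborel \<Omega> < \<infinity>"
    and [measurable]: "u \<in> borel_measurable borel" and u: "\<And>x. \<bar>u x\<bar> \<le> \<tau>"
  shows "set_integrable lborel \<Omega> (\<lambda>x. prim g (u x))"
proof -
  have "compact (prim g ` {- \<tau>..\<tau>})"
    using prim_continuous[OF g] by (intro compact_continuous_image) (auto intro: continuous_on_subset)
  then obtain B where B: "\<And>y. y \<in> prim g ` {- \<tau>..\<tau>} \<Longrightarrow> norm y \<le> B"
    using compact_imp_bounded bounded_iff by metis
  have [measurable]: "prim g \<in> borel_measurable borel" by (rule prim_measurable[OF g])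
  show ?thesis
  proof (rule set_integrable_bounded_lborel[OF \<Omega>])
    show "\<bar>prim g (u x)\<bar> \<le> B" if "x \<in> \<Omega>" for x
      using B[of "prim g (u x)"] u[of x] by (auto simp: abs_le_iff)
  qed measurable
qed

lemma LINT_diff_le:
  fixes f h :: "'a::euclidean_space \<Rightarrow> real"
  assumes f: "set_integrable lborel \<Omega> f" and h: "set_integrable lborel \<Omega> h"
    and w: "w \<in> borel_measurable borel" "\<And>x. 0 \<le> w x" "(\<integral>\<^sup>+x. ennreal (w x) \<partial>lborel) \<le> ennreal W" "W \<ge> 0"
    and fh: "\<And>x. x \<in> \<Omega> \<Longrightarrow> f x - h x \<le> w x"
  shows "(LINT x:\<Omega>|lborel. f x) - (LINT x:\<Omega>|lborel. h x) \<le> W"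
proof -
  have wi: "integrable lborel w"
    using w by (intro integrableI_nonneg) (auto intro: le_less_trans)
  have "(LINT x:\<Omega>|lborel. f x) - (LINT x:\<Omega>|lborel. h x) = (LINT x|lborel. indicator \<Omega> x *\<^sub>R f x - indicator \<Omega> x *\<^sub>R h x)"
    using f h unfolding set_lebesgue_integral_def set_integrable_def by simp
  also have "\<dots> \<le> (LINT x|lborel. w x)"
  proof (rule integral_mono)
    show "integrable lborel (\<lambda>x. indicator \<Omega> x *\<^sub>R f x - indicator \<Omega> x *\<^sub>R h x)"
      using f h unfolding set_integrable_def by simp
    show "indicator \<Omega> x *\<^sub>R f x - indicator \<Omega> x *\<^sub>R h x \<le> w x" for x
      using fh[of x] w(2)[of x] by (cases "x \<in> \<Omega>") auto
  qed (rule wi)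
  also have "(LINT x|lborel. w x) \<le> W"
  proof -
    have "ennreal (LINT x|lborel. w x) = (\<integral>\<^sup>+x. ennreal (w x) \<partial>lborel)"
      using wi w by (intro nn_integral_eq_integral[symmetric]) auto
    then have "ennreal (LINT x|lborel. w x) \<le> ennreal W" using w by simp
    then show ?thesis using w by simp
  qed
  finally show ?thesis .
qed

lemma small_powr:
  fixes K e b :: real
  assumes "K > 0" "e > 0" "b > 0"
  obtains r where "r > 0" "\<And>\<rho>. 0 \<le> \<rho> \<Longrightarrow> \<rho> \<le> r \<Longrightarrow> K * \<rho> powr e \<le> b"
proof
  show "(b / K) powr (1 / e) > 0" using assms by simp
  fix \<rho> assume \<rho>: "0 \<le> \<rho>" "\<rho> \<le> (b / K) powr (1 / e)"
  have "\<rho> powr e \<le> ((b / K) powr (1 / e)) powr e" using \<rho> assms by (intro powr_mono2) auto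
  also have "\<dots> = b / K" using assms by (simp add: powr_powr)
  finally show "K * \<rho> powr e \<le> b" using assms by (simp add: field_simps)
qed

section \<open>Decrease of the functional under both truncations\<close>

text \<open>Where the clamp acts, |t| = \<tau> + v with v the excess, and (\<tau> + v)^\<beta> \<le>
  (2\<tau>)^\<beta> + (2v)^\<beta>. The bound separates a linear term, to be paid by the truncation
  gain, from a critical power, to be paid by the Sobolev inequality.\<close>

lemma prim_clamp_growth:
  fixes C \<beta> \<tau> :: real
  assumes g: "continuous_on UNIV g" and C: "C > 0" and \<beta>: "\<beta> > 0" and \<tau>: "\<tau> > 0"
    and gr: "\<And>t. \<bar>g t\<bar> \<le> C * (1 + \<bar>t\<bar> powr \<beta>)"
  obtains C1 where "C1 > 0"
    "\<And>t. \<bar>prim g t - prim g (clampr \<tau> t)\<bar> \<le> C1 * (\<bar>t - clampr \<tau> t\<bar> + \<bar>t - clampr \<tau> t\<bar> powr (\<beta> + 1))"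
proof
  define C1 where "C1 = C * (1 + (2 * \<tau>) powr \<beta> + 2 powr \<beta>)"
  show "C1 > 0" unfolding C1_def using C by (intro mult_pos_pos add_pos_nonneg) auto
  fix t
  define v where "v = \<bar>t - clampr \<tau> t\<bar>"
  show "\<bar>prim g t - prim g (clampr \<tau> t)\<bar> \<le> C1 * (\<bar>t - clampr \<tau> t\<bar> + \<bar>t - clampr \<tau> t\<bar> powr (\<beta> + 1))"
  proof (cases "v = 0")
    case True
    then show ?thesis using \<open>C1 > 0\<close> by (simp add: v_def)
  next
    case False
    then have v: "v > 0" by (simp add: v_def)
    have tv: "\<bar>t\<bar> = \<tau> + v" using v \<tau> unfolding v_def clampr_def by (auto simp: min_def max_def split: if_splits)
    have "\<bar>g x\<bar> \<le> C * (1 + (2 * \<tau>) powr \<beta> + 2 powr \<beta> * v powr \<beta>)"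
      if "min t (clampr \<tau> t) \<le> x" "x \<le> max t (clampr \<tau> t)" for x
    proof -
      have "\<bar>x\<bar> \<le> \<bar>t\<bar>" using that \<tau> unfolding clampr_def by (auto simp: min_def max_def split: if_splits)
      then have "\<bar>x\<bar> powr \<beta> \<le> (\<tau> + v) powr \<beta>" using \<beta> tv by (intro powr_mono2) auto
      also have "\<dots> \<le> (2 * max \<tau> v) powr \<beta>" using \<beta> \<tau> v by (intro powr_mono2) auto
      also have "\<dots> \<le> (2 * \<tau>) powr \<beta> + (2 * v) powr \<beta>" by (auto simp: max_def)
      also have "(2 * v) powr \<beta> = 2 powr \<beta> * v powr \<beta>" by (rule powr_mult)
      finally have "C * (1 + \<bar>x\<bar> powr \<beta>) \<le> C * (1 + ((2 * \<tau>) powr \<beta> + 2 powr \<beta> * v powr \<beta>))"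
        using C by (intro mult_left_mono) auto
      then show ?thesis using gr[of x] by (simp add: add.assoc)
    qed
    then have "\<bar>prim g t - prim g (clampr \<tau> t)\<bar> \<le> C * (1 + (2 * \<tau>) powr \<beta> + 2 powr \<beta> * v powr \<beta>) * v"
      unfolding v_def by (intro prim_diff_le[OF g]) auto
    also have "\<dots> = C * ((1 + (2 * \<tau>) powr \<beta>) * v + 2 powr \<beta> * (v powr \<beta> * v powr 1))"
      using v by (simp add: algebra_simps)
    also have "v powr \<beta> * v powr 1 = v powr (\<beta> + 1)" by (rule powr_add[symmetric])
    also have "C * ((1 + (2 * \<tau>) powr \<beta>) * v + 2 powr \<beta> * v powr (\<beta> + 1))
      \<le> C * ((1 + (2 * \<tau>) powr \<beta> + 2 powr \<beta>) * v + (1 + (2 * \<tau>) powr \<beta> + 2 powr \<beta>) * v powr (\<beta> + 1))"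
    proof (rule mult_left_mono)
      have "0 \<le> 2 powr \<beta> * v + (1 + (2 * \<tau>) powr \<beta>) * v powr (\<beta> + 1)"
        using v by (intro add_nonneg_nonneg mult_nonneg_nonneg) auto
      then show "(1 + (2 * \<tau>) powr \<beta>) * v + 2 powr \<beta> * v powr (\<beta> + 1)
        \<le> (1 + (2 * \<tau>) powr \<beta> + 2 powr \<beta>) * v + (1 + (2 * \<tau>) powr \<beta> + 2 powr \<beta>) * v powr (\<beta> + 1)"
        by (simp add: algebra_simps)
    qed (use C in simp)
    also have "\<dots> = C1 * (v + v powr (\<beta> + 1))" by (simp add: C1_def algebra_simps)
    finally show ?thesis by (simp add: v_def)
  qed
qed

text \<open>Two separate budgets: the linear part of the change of the primitive is covered by the
  gain \<open>h * k\<close>, the critical part by the half of the energy of the excess kept in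
  \<open>gagliardo_clamp\<close>. Small energy serves both: it shrinks the superlevel set, and it
  makes the supercritical power \<open>JS powr (pst / p)\<close> small relative to
  \<open>JS\<close>.\<close>

lemma energy_clamp_le:
  fixes \<Omega> :: "'a::euclidean_space set" and s p C \<tau> :: real
  assumes \<Omega>: "\<Omega> \<in> sets borel" "emeasure lborel \<Omega> < \<infinity>"
    and s: "0 < s" and p: "p > 1" and sp: "s * p < real DIM('a)"
    and g: "continuous_on UNIV g" and C: "C > 0" and \<tau>: "\<tau> > 0"
    and gr: "\<And>t. \<bar>g t\<bar> \<le> C * (1 + \<bar>t\<bar> powr (real DIM('a) * p / (real DIM('a) - s * p) - 1))"
  obtains \<rho> where "\<rho> > 0"
    "\<And>u :: 'a \<Rightarrow> real. u \<in> borel_measurable borel \<Longrightarrow> (\<integral>\<^sup>+x. ennreal (\<bar>u x\<bar> powr p) \<partial>lborel) < \<infinity> \<Longrightarrow>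
      gagliardo s p u \<le> ennreal \<rho> \<Longrightarrow> set_integrable lborel \<Omega> (\<lambda>x. prim g (u x)) \<Longrightarrow>
      energy \<Omega> s p g (\<lambda>x. clampr \<tau> (u x)) \<le> energy \<Omega> s p g u"
proof -
  define N where "N = real DIM('a)"
  define \<gamma> where "\<gamma> = s * p"
  define pst where "pst = N * p / (N - \<gamma>)"
  have \<gamma>: "\<gamma> > 0" "\<gamma> < N" using s p sp by (auto simp: \<gamma>_def N_def)
  have N: "N > 0" using \<gamma> by linarith
  have "p * (\<gamma> / (N - \<gamma>)) > 0" using p \<gamma> by auto
  moreover have "pst = p + p * (\<gamma> / (N - \<gamma>))" using \<gamma> by (simp add: pst_def field_simps)
  ultimately have pst: "pst > p" by linarith
  have pstp: "pst / p - 1 > 0" using pst p by simp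
  have pst_eq: "real DIM('a) * p / (real DIM('a) - s * p) = pst" by (simp add: pst_def N_def \<gamma>_def)
  obtain S0 where S0: "S0 > 0" and sob: "\<And>u :: 'a \<Rightarrow> real. u \<in> borel_measurable borel \<Longrightarrow> (\<integral>\<^sup>+x. ennreal (\<bar>u x\<bar> powr p) \<partial>lborel) < \<infinity> \<Longrightarrow>
      gagliardo s p u < \<infinity> \<Longrightarrow>
      (\<integral>\<^sup>+x. ennreal (\<bar>u x\<bar> powr pst) \<partial>lborel) \<le> ennreal (S0 * enn2real (gagliardo s p u) powr (pst / p))"
    by (rule fractional_sobolev[OF s p sp, unfolded pst_eq]) (rule that)
  obtain c where c: "c > 0" and cl:
    "\<And>m B (x::'a). m > 0 \<Longrightarrow> B \<in> sets borel \<Longrightarrow> emeasure lborel B \<le> ennreal m \<Longrightarrow>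
      ennreal (c * m powr (- \<gamma> / N)) \<le> (\<integral>\<^sup>+z. indicator (- B) (x + z) \<partial>kmeas \<gamma>)"
    by (rule kmeas_complement_lower[OF \<gamma>(1), where 'a='a, folded N_def]) (rule that)
  have "pst - 1 > 0" using pst p by linarith
  then obtain C1 where C1: "C1 > 0" and G1:
    "\<And>t. \<bar>prim g t - prim g (clampr \<tau> t)\<bar> \<le> C1 * (\<bar>t - clampr \<tau> t\<bar> + \<bar>t - clampr \<tau> t\<bar> powr (pst - 1 + 1))"
    using prim_clamp_growth[OF g C _ \<tau>, of "pst - 1"] gr unfolding pst_eq by metis
  define h where "h = p / 2 * (\<tau> / 2) powr (p - 1)"
  have h: "h > 0" using p \<tau> by (simp add: h_def)
  \<comment> \<open>The measure of {|u| > \<tau>/2} at which the gain coefficient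
    \<open>h * k\<close> equals exactly \<open>p * C1\<close>.\<close>
  define m0 where "m0 = (p * C1 / (h * c)) powr (- N / \<gamma>)"
  have m0: "m0 > 0" using p C1 h c by (simp add: m0_def)
  define k where "k = c * m0 powr (- \<gamma> / N)"
  have hk: "h * k = p * C1"
  proof -
    have "m0 powr (- \<gamma> / N) = p * C1 / (h * c)"
      using N \<gamma> p C1 h c by (simp add: m0_def powr_powr)
    then show ?thesis using h c by (simp add: k_def)
  qed
  \<comment> \<open>Below \<open>r1\<close> the Sobolev bound for the critical term is at most
    JS/(2p), which is 1/p times the retained half of the energy of the excess.\<close>
  obtain r1 where r1: "r1 > 0" "\<And>\<rho>. 0 \<le> \<rho> \<Longrightarrow> \<rho> \<le> r1 \<Longrightarrow> (C1 * S0) * \<rho> powr (pst / p - 1) \<le> 1 / (2 * p)"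
  proof (rule small_powr[of "C1 * S0" "pst / p - 1" "1 / (2 * p)"])
    show "0 < C1 * S0" "0 < pst / p - 1" "0 < 1 / (2 * p)" using C1 S0 pstp p by auto
  qed (rule that)
  \<comment> \<open>Below \<open>r2\<close> Chebyshev's inequality in the critical norm makes {|u| >
    \<tau>/2} smaller than \<open>m0\<close>.\<close>
  obtain r2 where r2: "r2 > 0" "\<And>\<rho>. 0 \<le> \<rho> \<Longrightarrow> \<rho> \<le> r2 \<Longrightarrow> ((2 / \<tau>) powr pst * S0) * \<rho> powr (pst / p) \<le> m0"
  proof (rule small_powr[of "(2 / \<tau>) powr pst * S0" "pst / p" m0])
    show "0 < (2 / \<tau>) powr pst * S0" using \<tau> S0 by simp
    show "0 < pst / p" "0 < m0" using pst p m0 by auto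
  qed (rule that)
  define \<rho> where "\<rho> = min r1 r2"
  have \<rho>: "\<rho> > 0" "\<rho> \<le> r1" "\<rho> \<le> r2" using r1 r2 by (auto simp: \<rho>_def)
  show ?thesis
  proof (rule that[OF \<rho>(1)])
    fix u :: "'a \<Rightarrow> real"
    assume [measurable]: "u \<in> borel_measurable borel" and up: "(\<integral>\<^sup>+x. ennreal (\<bar>u x\<bar> powr p) \<partial>lborel) < \<infinity>"
      and uJ: "gagliardo s p u \<le> ennreal \<rho>" and Gi: "set_integrable lborel \<Omega> (\<lambda>x. prim g (u x))"
    have ufin: "gagliardo s p u < \<infinity>" using uJ by (auto intro: le_less_trans)
    define T where "T x = clampr \<tau> (u x)" for x
    define v where "v x = \<bar>u x - T x\<bar>" for x
    have [measurable]: "T \<in> borel_measurable borel" unfolding T_def[abs_def] by measurable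
    have [measurable]: "v \<in> borel_measurable borel" unfolding v_def[abs_def] by measurable
    have v0: "v x \<ge> 0" for x by (simp add: v_def)
    have split: "\<bar>u x - u y\<bar> = \<bar>T x - T y\<bar> + \<bar>(u x - T x) - (u y - T y)\<bar>" for x y
      unfolding T_def by (rule clampr_abs_split[OF \<tau>])
    define J where "J = enn2real (gagliardo s p u)"
    define JT where "JT = enn2real (gagliardo s p T)"
    define JS where "JS = enn2real (gagliardo s p (\<lambda>x. u x - T x))"
    have Tle: "gagliardo s p T \<le> gagliardo s p u"
    proof (rule gagliardo_mono)
      show "\<bar>T x - T y\<bar> \<le> \<bar>u x - u y\<bar>" for x y unfolding split[of x y] by simp
    qed (use p in auto)
    have Sle: "gagliardo s p (\<lambda>x. u x - T x) \<le> gagliardo s p u"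
    proof (rule gagliardo_mono)
      show "\<bar>(u x - T x) - (u y - T y)\<bar> \<le> \<bar>u x - u y\<bar>" for x y unfolding split[of x y] by simp
    qed (use p in auto)
    have J: "gagliardo s p u = ennreal J" "J \<ge> 0" using ufin by (auto simp: J_def)
    have JT: "gagliardo s p T = ennreal JT" "JT \<ge> 0" using ufin Tle by (auto simp: JT_def intro: le_less_trans)
    have JS: "gagliardo s p (\<lambda>x. u x - T x) = ennreal JS" "JS \<ge> 0" using ufin Sle by (auto simp: JS_def intro: le_less_trans)
    have J\<rho>: "J \<le> \<rho>" using uJ J \<rho> by simp
    have JS\<rho>: "JS \<le> \<rho>" using Sle J JS J\<rho> by simp
    have low: "ennreal k \<le> (\<integral>\<^sup>+z. indicator (- {y. \<tau> / 2 < \<bar>u y\<bar>}) (x + z) \<partial>kmeas (s * p))" for x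
      unfolding k_def \<gamma>_def[symmetric]
    proof (rule cl[OF m0])
      have "emeasure lborel {y. \<tau> / 2 < \<bar>u y\<bar>} \<le> ennreal ((1 / (\<tau> / 2)) powr pst) * (\<integral>\<^sup>+x. ennreal (\<bar>u x\<bar> powr pst) \<partial>lborel)"
        by (rule emeasure_superlevel_le) (use \<tau> pst p in auto)
      also have "\<dots> \<le> ennreal ((1 / (\<tau> / 2)) powr pst) * ennreal (S0 * J powr (pst / p))"
        unfolding J_def by (intro mult_left_mono sob up ufin) auto
      also have "\<dots> = ennreal (((2 / \<tau>) powr pst * S0) * J powr (pst / p))"
        using S0 by (simp add: ennreal_mult[symmetric] mult.assoc)
      also have "\<dots> \<le> ennreal m0"
        using r2(2)[of J] J J\<rho> \<rho> by (intro ennreal_leI) auto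
      finally show "emeasure lborel {y. \<tau> / 2 < \<bar>u y\<bar>} \<le> ennreal m0" .
    qed measurable
    define V where "V = (\<integral>\<^sup>+x. ennreal (v x) \<partial>lborel)"
    have k0: "k \<ge> 0" using c by (simp add: k_def)
    have main: "gagliardo s p T + ennreal (1/2) * gagliardo s p (\<lambda>x. u x - T x) + ennreal (h * k) * V \<le> gagliardo s p u"
      unfolding V_def v_def T_def h_def
      using gagliardo_clamp[OF p \<tau> k0, of u s] low by simp
    \<comment> \<open>Integrability of the excess is read off from the energy inequality itself: its
      gain term is bounded by the finite energy of \<open>u\<close>.\<close>
    have "ennreal (h * k) * V \<le> gagliardo s p T + ennreal (1/2) * gagliardo s p (\<lambda>x. u x - T x) + ennreal (h * k) * V"
      by (rule add_increasing) auto
    then have "ennreal (h * k) * V < \<infinity>" using main ufin by (meson le_less_trans)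
    then have "V < \<infinity>" using hk p C1 by (auto simp: ennreal_mult_less_top)
    then obtain V' where V': "V = ennreal V'" "V' \<ge> 0" by (cases V) auto
    have "ennreal (JT + JS / 2 + p * C1 * V') \<le> ennreal J"
    proof -
      have "ennreal (JT + JS / 2 + p * C1 * V') = gagliardo s p T + ennreal (1/2) * gagliardo s p (\<lambda>x. u x - T x) + ennreal (h * k) * V"
      proof -
        have "ennreal (1/2) * ennreal JS = ennreal (JS / 2)" using JS by (subst ennreal_mult[symmetric]) auto
        moreover have "ennreal (h * k) * V = ennreal (p * C1 * V')" unfolding hk V'(1) using p C1 V' by (subst ennreal_mult[symmetric]) auto
        moreover have "0 \<le> p * C1 * V'" using p C1 V' by simp
        ultimately show ?thesis unfolding JT(1) JS(1) using JT JS by (simp add: ennreal_plus[symmetric] del: ennreal_plus)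
      qed
      then show ?thesis using main J by simp
    qed
    then have real_main: "JT + JS / 2 + p * C1 * V' \<le> J" using J by simp
    define W' where "W' = S0 * JS powr (pst / p)"
    have W: "(\<integral>\<^sup>+x. ennreal (v x powr pst) \<partial>lborel) \<le> ennreal W'"
      unfolding W'_def JS_def v_def
    proof (rule sob)
      have "(\<integral>\<^sup>+x. ennreal (\<bar>u x - T x\<bar> powr p) \<partial>lborel) \<le> (\<integral>\<^sup>+x. ennreal (\<bar>u x\<bar> powr p) \<partial>lborel)"
      proof (intro nn_integral_mono ennreal_leI powr_mono2)
        fix x
        show "\<bar>u x - T x\<bar> \<le> \<bar>u x\<bar>" using \<tau> by (auto simp: T_def clampr_def)
      qed (use p in auto)
      then show "(\<integral>\<^sup>+x. ennreal (\<bar>u x - T x\<bar> powr p) \<partial>lborel) < \<infinity>" using up by (rule le_less_trans)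
      show "gagliardo s p (\<lambda>x. u x - T x) < \<infinity>" using JS by simp
    qed measurable
    have W0: "W' \<ge> 0" using S0 by (simp add: W'_def)
    have CW: "C1 * W' \<le> JS / (2 * p)"
    proof -
      have "JS powr (pst / p) = JS powr (pst / p - 1) * JS"
      proof (cases "JS = 0")
        case False
        then have "JS powr (pst / p - 1) * JS powr 1 = JS powr (pst / p)" by (simp only: powr_add[symmetric]) simp
        then show ?thesis using JS False by simp
      qed (use pst p in auto)
      then have "C1 * W' = (C1 * S0) * JS powr (pst / p - 1) * JS" by (simp add: W'_def)
      also have "\<dots> \<le> 1 / (2 * p) * JS"
        using r1(2)[of JS] JS JS\<rho> \<rho> by (intro mult_right_mono) auto
      finally show ?thesis by simp
    qed
    have Gd: "(LINT x:\<Omega>|lborel. prim g (u x)) - (LINT x:\<Omega>|lborel. prim g (T x)) \<le> C1 * V' + C1 * W'"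
    proof (rule LINT_diff_le[OF Gi, where w = "\<lambda>x. C1 * (v x + v x powr pst)"])
      show "set_integrable lborel \<Omega> (\<lambda>x. prim g (T x))"
        by (rule prim_comp_integrable[OF g \<Omega>, where \<tau> = \<tau>]) (use \<tau> in \<open>auto simp: T_def clampr_def\<close>)
      show "prim g (u x) - prim g (T x) \<le> C1 * (v x + v x powr pst)" if "x \<in> \<Omega>" for x
        using G1[of "u x"] by (simp add: v_def T_def)
      have "(\<integral>\<^sup>+x. ennreal (C1 * (v x + v x powr pst)) \<partial>lborel) = (\<integral>\<^sup>+x. ennreal C1 * (ennreal (v x) + ennreal (v x powr pst)) \<partial>lborel)"
        using C1 v0 by (intro nn_integral_cong) (simp add: ennreal_mult)
      also have "\<dots> = ennreal C1 * (V + (\<integral>\<^sup>+x. ennreal (v x powr pst) \<partial>lborel))"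
        by (simp add: V_def nn_integral_cmult nn_integral_add)
      also have "\<dots> \<le> ennreal C1 * (V + ennreal W')"
        by (intro mult_left_mono add_left_mono W) auto
      also have "\<dots> = ennreal (C1 * V' + C1 * W')"
        using C1 V' W0 by (simp add: ennreal_mult[symmetric] ennreal_plus[symmetric] distrib_left del: ennreal_plus)
      finally show "(\<integral>\<^sup>+x. ennreal (C1 * (v x + v x powr pst)) \<partial>lborel) \<le> ennreal (C1 * V' + C1 * W')" .
    qed (use C1 v0 V' W0 in auto)
    have "1 / p * JT + (JS / (2 * p) + C1 * V') = 1 / p * (JT + JS / 2 + p * C1 * V')"
      using p by (simp add: field_simps)
    also have "\<dots> \<le> 1 / p * J" using real_main p by (intro mult_left_mono) auto
    finally have "1 / p * JT + (JS / (2 * p) + C1 * V') \<le> 1 / p * J" .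
    then show "energy \<Omega> s p g (\<lambda>x. clampr \<tau> (u x)) \<le> energy \<Omega> s p g u"
      using Gd CW p unfolding T_def[symmetric] by (simp add: energy_eq J_def[symmetric] JT_def[symmetric])
  qed
qed

lemma gagliardo_uminus:
  "gagliardo s p (\<lambda>x. - u x) = gagliardo s p u"
  unfolding gagliardo_def by (simp add: abs_minus_commute)

text \<open>The one-sided truncation is applied to u and then to the negative of the result. The two
  removed parts add up pointwise to |u - w|, so the gains add up as well.\<close>

lemma gagliardo_clamp_barrier:
  fixes D u :: "'a::euclidean_space \<Rightarrow> real" and B :: "real \<Rightarrow> real"
  assumes p: "p > 1" and A: "A > 0" and s: "s > 0" and F: "F \<ge> 0"
    and [measurable]: "D \<in> borel_measurable borel" "u \<in> borel_measurable borel"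
    and D: "\<And>x. D x \<ge> 0"
    and fin: "(\<integral>\<^sup>+x. ennreal \<bar>u x\<bar> \<partial>lborel) < \<infinity>"
    and key: "\<And>q x. 1/2 \<le> q \<Longrightarrow> q < 1 \<Longrightarrow> A * D x powr s < \<bar>u x\<bar> \<Longrightarrow>
       (\<integral>\<^sup>+z. ennreal (cutp s p q (D (x + z)) (D x)) \<partial>kmeas (s * p)) + ennreal F
       \<le> (\<integral>\<^sup>+z. ennreal (cutp s p q (D x) (D (x + z))) \<partial>kmeas (s * p))"
    and bd: "\<And>q x. 1/2 \<le> q \<Longrightarrow> q < 1 \<Longrightarrow> A * D x powr s < \<bar>u x\<bar> \<Longrightarrow>
       (\<integral>\<^sup>+z. ennreal (cutp s p q (D (x + z)) (D x)) \<partial>kmeas (s * p)) \<le> ennreal (B q)"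
  defines "w \<equiv> \<lambda>x. clampr (A * D x powr s) (u x)"
  shows "gagliardo s p w + ennreal (2 * p * A powr (p - 1) * F) * (\<integral>\<^sup>+x. ennreal \<bar>u x - w x\<bar> \<partial>lborel) \<le> gagliardo s p u"
proof -
  define \<eta> where "\<eta> x = A * D x powr s" for x
  have \<eta>0: "\<eta> x \<ge> 0" for x using A by (simp add: \<eta>_def)
  have [measurable]: "\<eta> \<in> borel_measurable borel" unfolding \<eta>_def[abs_def] by measurable
  define m where "m x = min (u x) (\<eta> x)" for x
  have [measurable]: "m \<in> borel_measurable borel" unfolding m_def[abs_def] by measurable
  define n where "n x = min (- m x) (\<eta> x)" for x
  have [measurable]: "n \<in> borel_measurable borel" unfolding n_def[abs_def] by measurable
  define k where "k = ennreal (2 * p * A powr (p - 1) * F)"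
  have 1: "gagliardo s p m + k * (\<integral>\<^sup>+x. ennreal (u x - m x) \<partial>lborel) \<le> gagliardo s p u"
    unfolding m_def[abs_def] \<eta>_def k_def
  proof (rule gagliardo_truncate_barrier[OF p A s F _ _ D])
    have "(\<integral>\<^sup>+x. ennreal (u x - min (u x) (A * D x powr s)) \<partial>lborel) \<le> (\<integral>\<^sup>+x. ennreal \<bar>u x\<bar> \<partial>lborel)"
    proof (intro nn_integral_mono ennreal_leI)
      fix x
      show "u x - min (u x) (A * D x powr s) \<le> \<bar>u x\<bar>" using \<eta>0[of x] unfolding \<eta>_def by linarith
    qed
    then show "(\<integral>\<^sup>+x. ennreal (u x - min (u x) (A * D x powr s)) \<partial>lborel) < \<infinity>" using fin by (rule le_less_trans)
  next
    fix q x assume q: "1/2 \<le> q" "q < (1::real)" "A * D x powr s < u x"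
    then have "A * D x powr s < \<bar>u x\<bar>" by linarith
    from key[OF q(1,2) this] bd[OF q(1,2) this]
    show "(\<integral>\<^sup>+z. ennreal (cutp s p q (D (x + z)) (D x)) \<partial>kmeas (s * p)) + ennreal F
       \<le> (\<integral>\<^sup>+z. ennreal (cutp s p q (D x) (D (x + z))) \<partial>kmeas (s * p))"
      "(\<integral>\<^sup>+z. ennreal (cutp s p q (D (x + z)) (D x)) \<partial>kmeas (s * p)) \<le> ennreal (B q)" .
  qed measurable
  have 2: "gagliardo s p n + k * (\<integral>\<^sup>+x. ennreal (- m x - n x) \<partial>lborel) \<le> gagliardo s p (\<lambda>x. - m x)"
    unfolding n_def[abs_def] \<eta>_def k_def
  proof (rule gagliardo_truncate_barrier[OF p A s F _ _ D])
    have "(\<integral>\<^sup>+x. ennreal (- m x - min (- m x) (A * D x powr s)) \<partial>lborel) \<le> (\<integral>\<^sup>+x. ennreal \<bar>u x\<bar> \<partial>lborel)"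
    proof (intro nn_integral_mono ennreal_leI)
      fix x
      show "- m x - min (- m x) (A * D x powr s) \<le> \<bar>u x\<bar>" using \<eta>0[of x] unfolding m_def \<eta>_def by linarith
    qed
    then show "(\<integral>\<^sup>+x. ennreal (- m x - min (- m x) (A * D x powr s)) \<partial>lborel) < \<infinity>" using fin by (rule le_less_trans)
  next
    fix q x assume q: "1/2 \<le> q" "q < (1::real)" "A * D x powr s < - m x"
    then have "A * D x powr s < \<bar>u x\<bar>" using \<eta>0[of x] unfolding m_def \<eta>_def by linarith
    from key[OF q(1,2) this] bd[OF q(1,2) this]
    show "(\<integral>\<^sup>+z. ennreal (cutp s p q (D (x + z)) (D x)) \<partial>kmeas (s * p)) + ennreal F
       \<le> (\<integral>\<^sup>+z. ennreal (cutp s p q (D x) (D (x + z))) \<partial>kmeas (s * p))"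
      "(\<integral>\<^sup>+z. ennreal (cutp s p q (D (x + z)) (D x)) \<partial>kmeas (s * p)) \<le> ennreal (B q)" .
  qed measurable
  have w: "w = (\<lambda>x. - n x)"
  proof
    fix x
    show "w x = - n x" using \<eta>0[of x] unfolding w_def n_def m_def clampr_def \<eta>_def[symmetric] by linarith
  qed
  have sum: "(\<integral>\<^sup>+x. ennreal \<bar>u x - w x\<bar> \<partial>lborel) = (\<integral>\<^sup>+x. ennreal (u x - m x) \<partial>lborel) + (\<integral>\<^sup>+x. ennreal (- m x - n x) \<partial>lborel)"
  proof -
    have "ennreal \<bar>u x - w x\<bar> = ennreal (u x - m x) + ennreal (- m x - n x)" for x
    proof -
      have "\<bar>u x - w x\<bar> = (u x - m x) + (- m x - n x)" "u x - m x \<ge> 0" "- m x - n x \<ge> 0"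
        using \<eta>0[of x] unfolding w n_def m_def by linarith+
      then show ?thesis by (simp add: ennreal_plus[symmetric] del: ennreal_plus)
    qed
    then show ?thesis by (simp add: nn_integral_add)
  qed
  have "gagliardo s p w + k * (\<integral>\<^sup>+x. ennreal \<bar>u x - w x\<bar> \<partial>lborel)
    = (gagliardo s p n + k * (\<integral>\<^sup>+x. ennreal (- m x - n x) \<partial>lborel)) + k * (\<integral>\<^sup>+x. ennreal (u x - m x) \<partial>lborel)"
    unfolding sum by (simp add: w gagliardo_uminus distrib_left add_ac)
  also have "\<dots> \<le> gagliardo s p m + k * (\<integral>\<^sup>+x. ennreal (u x - m x) \<partial>lborel)"
    using 2 by (intro add_right_mono) (simp add: gagliardo_uminus)
  also note 1
  finally show ?thesis by (simp add: k_def)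
qed

text \<open>The energy part drops by at least k/p times the integral of |u - w|, while the primitive
  changes by at most \<epsilon> times it; \<open>p * \<epsilon> \<le> k\<close> decides. Finiteness
  of the integral again follows from the inequality assumed.\<close>

lemma energy_barrier_le:
  fixes u w :: "'a::euclidean_space \<Rightarrow> real"
  assumes \<Omega>: "\<Omega> \<in> sets borel" "emeasure lborel \<Omega> < \<infinity>"
    and p: "p > 1" and g: "continuous_on UNIV g"
    and [measurable]: "u \<in> borel_measurable borel" "w \<in> borel_measurable borel"
    and u: "\<And>x. \<bar>u x\<bar> \<le> \<tau>" and w: "\<And>x. \<bar>w x\<bar> \<le> \<tau>"
    and small: "\<And>t. \<bar>t\<bar> \<le> \<tau> \<Longrightarrow> \<bar>g t\<bar> \<le> \<epsilon>" and k: "p * \<epsilon> \<le> k" "k > 0"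
    and ufin: "gagliardo s p u < \<infinity>"
    and le: "gagliardo s p w + ennreal k * (\<integral>\<^sup>+x. ennreal \<bar>u x - w x\<bar> \<partial>lborel) \<le> gagliardo s p u"
  shows "energy \<Omega> s p g w \<le> energy \<Omega> s p g u"
proof -
  define V where "V = (\<integral>\<^sup>+x. ennreal \<bar>u x - w x\<bar> \<partial>lborel)"
  have "0 \<le> \<tau>" using u[of 0] by linarith
  then have \<epsilon>: "\<epsilon> \<ge> 0" using small[of 0] by linarith
  have "ennreal k * V \<le> gagliardo s p w + ennreal k * V" by (rule add_increasing) auto
  then have "ennreal k * V < \<infinity>" using le ufin unfolding V_def by (meson le_less_trans)
  then have "V < \<infinity>" using k by (auto simp: ennreal_mult_less_top)
  then obtain V' where V': "V = ennreal V'" "V' \<ge> 0" by (cases V) auto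
  have wle: "gagliardo s p w \<le> gagliardo s p u"
  proof -
    have "gagliardo s p w \<le> gagliardo s p w + ennreal k * V" by (rule add_increasing2) auto
    then show ?thesis using le unfolding V_def by (rule order_trans)
  qed
  define J where "J = enn2real (gagliardo s p u)"
  define Jw where "Jw = enn2real (gagliardo s p w)"
  have J: "gagliardo s p u = ennreal J" "J \<ge> 0" using ufin by (auto simp: J_def)
  have Jw: "gagliardo s p w = ennreal Jw" "Jw \<ge> 0" using ufin wle by (auto simp: Jw_def intro: le_less_trans)
  have "ennreal (Jw + k * V') \<le> ennreal J"
    using le k Jw V' unfolding V_def[symmetric] J Jw(1) V'(1) by (simp add: ennreal_mult[symmetric] ennreal_plus[symmetric] del: ennreal_plus)
  then have "Jw + k * V' \<le> J" using J by simp
  moreover have "p * \<epsilon> * V' \<le> k * V'" using k V' by (intro mult_right_mono) auto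
  ultimately have "Jw + p * \<epsilon> * V' \<le> J" by linarith
  then have "1 / p * (Jw + p * \<epsilon> * V') \<le> 1 / p * J" using p by (intro mult_left_mono) auto
  then have main: "1 / p * Jw + \<epsilon> * V' \<le> 1 / p * J" using p by (simp add: field_simps)
  have "(LINT x:\<Omega>|lborel. prim g (u x)) - (LINT x:\<Omega>|lborel. prim g (w x)) \<le> \<epsilon> * V'"
  proof (rule LINT_diff_le[where w = "\<lambda>x. \<epsilon> * \<bar>u x - w x\<bar>"])
    show "set_integrable lborel \<Omega> (\<lambda>x. prim g (u x))" by (rule prim_comp_integrable[OF g \<Omega> _ u]) measurable
    show "set_integrable lborel \<Omega> (\<lambda>x. prim g (w x))" by (rule prim_comp_integrable[OF g \<Omega> _ w]) measurable
    show "prim g (u x) - prim g (w x) \<le> \<epsilon> * \<bar>u x - w x\<bar>" for x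
    proof -
      have "\<bar>prim g (u x) - prim g (w x)\<bar> \<le> \<epsilon> * \<bar>u x - w x\<bar>"
        by (rule prim_diff_le[OF g], rule small) (use u[of x] w[of x] in linarith)
      then show ?thesis by linarith
    qed
    have "(\<integral>\<^sup>+x. ennreal (\<epsilon> * \<bar>u x - w x\<bar>) \<partial>lborel) = ennreal \<epsilon> * V"
      unfolding V_def using \<epsilon> by (simp add: ennreal_mult nn_integral_cmult)
    then show "(\<integral>\<^sup>+x. ennreal (\<epsilon> * \<bar>u x - w x\<bar>) \<partial>lborel) \<le> ennreal (\<epsilon> * V')"
      using \<epsilon> V' by (simp add: ennreal_mult)
  qed (use \<epsilon> V' in auto)
  then show ?thesis using main p by (simp add: energy_eq J_def Jw_def)
qed

section \<open>Averaging over small balls\<close>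

lemma ball_borel [measurable]: "ball (x::'a::euclidean_space) \<epsilon> \<in> sets borel"
  by simp

text \<open>The uniform probability distribution on a small ball, encoded as a measure so that
  Jensen's inequality and Fubini's theorem apply directly. Continuous competitors are all that is
  required, so this discontinuous density suffices.\<close>

definition avgm :: "real \<Rightarrow> 'a::euclidean_space measure" where
  "avgm \<epsilon> = density lborel (\<lambda>t. ennreal (1 / (unit_ball_vol (real DIM('a)) * \<epsilon> ^ DIM('a))) * indicator (ball 0 \<epsilon>) t)"

lemma sets_avgm [measurable_cong, simp]: "sets (avgm \<epsilon>) = sets borel"
  by (simp add: avgm_def)

lemma space_avgm [simp]: "space (avgm \<epsilon>) = UNIV"
  by (simp add: avgm_def)

lemma nn_integral_avgm:
  fixes f :: "'a::euclidean_space \<Rightarrow> ennreal"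
  assumes [measurable]: "f \<in> borel_measurable borel"
  shows "(\<integral>\<^sup>+t. f t \<partial>avgm \<epsilon>) = (\<integral>\<^sup>+t. ennreal (1 / (unit_ball_vol (real DIM('a)) * \<epsilon> ^ DIM('a))) * indicator (ball 0 \<epsilon>) t * f t \<partial>lborel)"
  unfolding avgm_def by (subst nn_integral_density) auto

lemma emeasure_avgm_UNIV:
  assumes "\<epsilon> > 0"
  shows "emeasure (avgm \<epsilon>) (UNIV :: 'a::euclidean_space set) = 1"
proof -
  define V where "V = unit_ball_vol (real DIM('a)) * \<epsilon> ^ DIM('a)"
  have V: "V > 0" using assms by (simp add: V_def)
  have "emeasure (avgm \<epsilon>) (UNIV :: 'a set) = (\<integral>\<^sup>+t. ennreal (1 / V) * indicator (ball (0::'a) \<epsilon>) t * indicator UNIV t \<partial>lborel)"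
    unfolding avgm_def V_def by (rule emeasure_density) auto
  also have "\<dots> = (\<integral>\<^sup>+t. ennreal (1 / V) * indicator (ball (0::'a) \<epsilon>) t \<partial>lborel)" by simp
  also have "\<dots> = ennreal (1 / V) * emeasure lborel (ball (0::'a) \<epsilon>)"
    by (rule nn_integral_cmult_indicator) simp
  also have "\<dots> = ennreal (1 / V) * ennreal V" using assms by (simp add: emeasure_ball V_def)
  also have "\<dots> = 1" using V by (simp add: ennreal_mult[symmetric])
  finally show ?thesis .
qed

lemma finite_measure_avgm:
  assumes "\<epsilon> > 0" shows "finite_measure (avgm \<epsilon> :: 'a::euclidean_space measure)"
  using emeasure_avgm_UNIV[OF assms, where 'a='a] by (intro finite_measureI) simp

lemma AE_avgm: "AE t in (avgm \<epsilon> :: 'a::euclidean_space measure). norm t < \<epsilon>"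
  unfolding avgm_def by (subst AE_density) (auto simp: indicator_def split: if_splits)

lemma measure_avgm:
  assumes "\<epsilon> > 0" shows "measure (avgm \<epsilon>) (UNIV :: 'a::euclidean_space set) = 1"
  using emeasure_avgm_UNIV[OF assms, where 'a='a] by (simp add: measure_def)

lemma avgm_integral_const:
  assumes "\<epsilon> > 0" shows "(LINT t|(avgm \<epsilon> :: 'a::euclidean_space measure). c) = (c::real)"
  using measure_avgm[OF assms, where 'a='a] by simp

lemma avgm_integrable:
  fixes h :: "'a::euclidean_space \<Rightarrow> real"
  assumes "\<epsilon> > 0" "h \<in> borel_measurable borel" "\<And>t. \<bar>h t\<bar> \<le> B"
  shows "integrable (avgm \<epsilon>) h"
proof -
  interpret finite_measure "avgm \<epsilon> :: 'a measure" by (rule finite_measure_avgm[OF assms(1)])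
  show ?thesis by (rule integrable_const_bound[where B = B]) (use assms in auto)
qed

text \<open>Integrate the supporting-line inequality at the mean c: the linear term has integral 0
  because the total mass is 1.\<close>

lemma avgm_jensen:
  fixes h :: "'a::euclidean_space \<Rightarrow> real"
  assumes \<epsilon>: "\<epsilon> > 0" and p: "p > 1" and [measurable]: "h \<in> borel_measurable borel" and h: "\<And>t. \<bar>h t\<bar> \<le> B"
  shows "ennreal (\<bar>LINT t|avgm \<epsilon>. h t\<bar> powr p) \<le> (\<integral>\<^sup>+t. ennreal (\<bar>h t\<bar> powr p) \<partial>avgm \<epsilon>)"
proof -
  define c where "c = (LINT t|avgm \<epsilon>. h t)"
  define a where "a = p * (sgn c * \<bar>c\<bar> powr (p - 1))"
  interpret finite_measure "avgm \<epsilon> :: 'a measure" by (rule finite_measure_avgm[OF \<epsilon>])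
  have i1: "integrable (avgm \<epsilon>) h" by (rule avgm_integrable[OF \<epsilon> _ h]) measurable
  have hp: "\<bar>\<bar>h t\<bar> powr p\<bar> \<le> B powr p" for t
    using h[of t] p by (simp add: powr_mono2)
  have i2: "integrable (avgm \<epsilon>) (\<lambda>t. \<bar>h t\<bar> powr p)" by (rule avgm_integrable[OF \<epsilon> _ hp]) measurable
  have "\<bar>c\<bar> powr p = (LINT t|(avgm \<epsilon> :: 'a measure). \<bar>c\<bar> powr p + a * (h t - c))"
    using i1 by (simp add: measure_avgm[OF \<epsilon>] c_def[symmetric])
  also have "\<dots> \<le> (LINT t|avgm \<epsilon>. \<bar>h t\<bar> powr p)"
    using i1 i2 powr_above_tangent[OF p, of c] unfolding a_def by (intro integral_mono) auto
  finally have "ennreal (\<bar>c\<bar> powr p) \<le> ennreal (LINT t|avgm \<epsilon>. \<bar>h t\<bar> powr p)" by (rule ennreal_leI)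
  also have "\<dots> = (\<integral>\<^sup>+t. ennreal (\<bar>h t\<bar> powr p) \<partial>avgm \<epsilon>)"
    using i2 by (intro nn_integral_eq_integral[symmetric]) auto
  finally show ?thesis by (simp add: c_def)
qed

definition mollify :: "real \<Rightarrow> ('a::euclidean_space \<Rightarrow> real) \<Rightarrow> 'a \<Rightarrow> real" where
  "mollify \<epsilon> f x = (LINT t|avgm \<epsilon>. f (x + t))"

lemma mollify_bound:
  fixes f :: "'a::euclidean_space \<Rightarrow> real"
  assumes \<epsilon>: "\<epsilon> > 0" and [measurable]: "f \<in> borel_measurable borel" and f: "\<And>y. \<bar>f y\<bar> \<le> B"
    and b: "\<And>y. dist x y < \<epsilon> \<Longrightarrow> \<bar>f y\<bar> \<le> b"
  shows "\<bar>mollify \<epsilon> f x\<bar> \<le> b"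
proof -
  interpret finite_measure "avgm \<epsilon> :: 'a measure" by (rule finite_measure_avgm[OF \<epsilon>])
  have i: "integrable (avgm \<epsilon>) (\<lambda>t. f (x + t))" by (rule avgm_integrable[OF \<epsilon> _ f]) measurable
  have "\<bar>mollify \<epsilon> f x\<bar> \<le> (LINT t|avgm \<epsilon>. \<bar>f (x + t)\<bar>)"
    unfolding mollify_def by (rule integral_abs_bound)
  also have "\<dots> \<le> (LINT t|(avgm \<epsilon> :: 'a measure). b)"
  proof (rule integral_mono_AE)
    show "AE t in avgm \<epsilon>. \<bar>f (x + t)\<bar> \<le> b"
      using AE_avgm by eventually_elim (auto intro!: b simp: dist_norm)
  qed (use i in auto)
  also have "\<dots> = b" by (rule avgm_integral_const[OF \<epsilon>])
  finally show ?thesis .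
qed

lemma mollify_diff:
  fixes f :: "'a::euclidean_space \<Rightarrow> real"
  assumes \<epsilon>: "\<epsilon> > 0" and [measurable]: "f \<in> borel_measurable borel" and f: "\<And>y. \<bar>f y\<bar> \<le> B"
  shows "mollify \<epsilon> f x - mollify \<epsilon> f y = (LINT t|avgm \<epsilon>. f (x + t) - f (y + t))"
  unfolding mollify_def by (rule Bochner_Integration.integral_diff[symmetric]) (rule avgm_integrable[OF \<epsilon> _ f], measurable)+

text \<open>After a translation the average is an integral of \<open>f\<close> over a moving ball.
  The indicators of the moving balls converge off the limiting sphere, a null set, and
  \<open>f\<close> is bounded with support of finite measure, so dominated convergence
  applies.\<close>

lemma mollify_continuous:
  fixes f :: "'a::euclidean_space \<Rightarrow> real"
  assumes \<epsilon>: "\<epsilon> > 0" and [measurable]: "f \<in> borel_measurable borel" and f: "\<And>y. \<bar>f y\<bar> \<le> B"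
    and \<Omega>: "\<Omega> \<in> sets borel" "emeasure lborel \<Omega> < \<infinity>" "\<And>y. y \<notin> \<Omega> \<Longrightarrow> f y = 0"
  shows "continuous_on UNIV (mollify \<epsilon> f)"
proof -
  define V where "V = unit_ball_vol (real DIM('a)) * \<epsilon> ^ DIM('a)"
  have V: "V > 0" using \<epsilon> by (simp add: V_def)
  have eq: "mollify \<epsilon> f x = (LINT y|lborel. (1 / V) * indicator (ball x \<epsilon>) y * f y)" for x
  proof -
    have dens: "ennreal (1 / V) * indicator (ball 0 \<epsilon>) t = ennreal ((1 / V) * indicator (ball 0 \<epsilon>) t)" for t :: 'a
      by (auto simp: indicator_def)
    have "mollify \<epsilon> f x = (LINT t|lborel. ((1 / V) * indicator (ball 0 \<epsilon>) t) *\<^sub>R f (x + t))"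
      unfolding mollify_def avgm_def V_def[symmetric] dens
      using V by (intro integral_density) auto
    also have "\<dots> = (LINT t|lborel. (\<lambda>y. (1 / V) * indicator (ball x \<epsilon>) y * f y) (x + t))"
      by (intro Bochner_Integration.integral_cong) (auto simp: indicator_def dist_norm)
    also have "\<dots> = (LINT y|distr lborel borel ((+) x). (1 / V) * indicator (ball x \<epsilon>) y * f y)"
      by (subst integral_distr) auto
    also have "\<dots> = (LINT y|lborel. (1 / V) * indicator (ball x \<epsilon>) y * f y)" by (simp add: lborel_distr_plus)
    finally show ?thesis .
  qed
  have B: "B \<ge> 0" using f[of 0] by linarith
  show ?thesis
    unfolding continuous_on_sequentially comp_def
  proof (intro ballI allI impI)
    fix x :: 'a and X assume X: "(\<forall>n. X n \<in> UNIV) \<and> X \<longlonglongrightarrow> x"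
    show "(\<lambda>n. mollify \<epsilon> f (X n)) \<longlonglongrightarrow> mollify \<epsilon> f x"
      unfolding eq
    proof (rule integral_dominated_convergence[where w = "\<lambda>y. (B / V) * indicator \<Omega> y"])
      show "integrable lborel (\<lambda>y. (B / V) * indicator \<Omega> y)"
        using \<Omega> by (intro integrable_mult_right integrable_real_indicator) auto
      show "AE y in lborel. (\<lambda>n. (1 / V) * indicator (ball (X n) \<epsilon>) y * f y) \<longlonglongrightarrow> (1 / V) * indicator (ball x \<epsilon>) y * f y"
      proof -
        have "negligible (sphere x \<epsilon>)"
          using negligible_convex_frontier[of "cball x \<epsilon>"] \<epsilon> by simp
        then have "sphere x \<epsilon> \<in> null_sets lborel"
          by (auto simp: negligible_iff_null_sets null_sets_completion_iff)
        then have "AE y in lborel. y \<notin> sphere x \<epsilon>" by (rule AE_not_in)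
        then show ?thesis
        proof eventually_elim
          case (elim y)
          have lim: "(\<lambda>n. dist (X n) y) \<longlonglongrightarrow> dist x y" using X by (intro tendsto_intros) auto
          have "eventually (\<lambda>n. indicator (ball (X n) \<epsilon>) y = (indicator (ball x \<epsilon>) y :: real)) sequentially"
          proof (cases "dist x y < \<epsilon>")
            case True
            from order_tendstoD(2)[OF lim this] show ?thesis
              by eventually_elim (use True in auto)
          next
            case False
            then have "\<epsilon> < dist x y" using elim by auto
            from order_tendstoD(1)[OF lim this] show ?thesis
              by eventually_elim (use False in auto)
          qed
          then have "eventually (\<lambda>n. (1 / V) * indicator (ball (X n) \<epsilon>) y * f y = (1 / V) * indicator (ball x \<epsilon>) y * f y) sequentially"
            by eventually_elim simp
          then show ?case by (rule tendsto_eventually)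
        qed
      qed
      show "AE y in lborel. norm ((1 / V) * indicator (ball (X n) \<epsilon>) y * f y) \<le> (B / V) * indicator \<Omega> y" for n
      proof (rule AE_I2)
        fix y
        show "norm ((1 / V) * indicator (ball (X n) \<epsilon>) y * f y) \<le> (B / V) * indicator \<Omega> y"
        proof (cases "y \<in> \<Omega>")
          case True
          have "\<bar>f y\<bar> / V \<le> B / V" using f[of y] V by (intro divide_right_mono) auto
          then show ?thesis using True V B by (auto simp: indicator_def abs_mult)
        qed (use \<Omega>(3) in simp)
      qed
    next
      have "(\<lambda>y. (1 / V) * indicator (ball c \<epsilon>) y * f y) \<in> borel_measurable borel" for c by measurable
      then show "(\<lambda>y. (1 / V) * indicator (ball x \<epsilon>) y * f y) \<in> borel_measurable lborel"
        "\<And>n. (\<lambda>y. (1 / V) * indicator (ball (X n) \<epsilon>) y * f y) \<in> borel_measurable lborel" by simp_all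
    qed
  qed
qed

lemma gagliardo_translate:
  fixes f :: "'a::euclidean_space \<Rightarrow> real"
  assumes [measurable]: "f \<in> borel_measurable borel"
  shows "gagliardo s p (\<lambda>x. f (x + t)) = gagliardo s p f"
proof -
  define H where "H x = (\<integral>\<^sup>+z. ennreal (\<bar>f x - f (x + z)\<bar> powr p) \<partial>kmeas (s * p))" for x
  have [measurable]: "H \<in> borel_measurable borel"
    unfolding H_def[abs_def]
    by (rule sigma_finite_measure.borel_measurable_nn_integral[OF sigma_finite_kmeas]) measurable
  have "gagliardo s p (\<lambda>x. f (x + t)) = (\<integral>\<^sup>+x. H (t + x) \<partial>lborel)"
    by (subst gagliardo_kmeas) (auto simp: H_def add_ac)
  also have "\<dots> = (\<integral>\<^sup>+x. H x \<partial>distr lborel borel ((+) t))"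
    by (subst nn_integral_distr) auto
  also have "\<dots> = gagliardo s p f"
    by (simp add: lborel_distr_plus gagliardo_kmeas H_def)
  finally show ?thesis .
qed

lemma sigma_finite_pmeas: "sigma_finite_measure (pmeas \<gamma>)"
proof -
  have sf: "sigma_finite_measure (lborel \<Otimes>\<^sub>M lborel :: ('a::euclidean_space \<times> 'a) measure)"
    by (rule lborel_pair.sigma_finite_measure_axioms)
  show "sigma_finite_measure (pmeas \<gamma> :: ('a \<times> 'a) measure)"
    unfolding pmeas_def by (subst sigma_finite_measure.sigma_finite_iff_density_finite'[OF sf]) auto
qed

text \<open>Increments of the average are averages of increments; Jensen's inequality, Fubini and
  translation invariance of the energy give the bound.\<close>

lemma gagliardo_mollify_le:
  fixes f :: "'a::euclidean_space \<Rightarrow> real"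
  assumes \<epsilon>: "\<epsilon> > 0" and p: "p > 1" and [measurable]: "f \<in> borel_measurable borel" "mollify \<epsilon> f \<in> borel_measurable borel"
    and f: "\<And>y. \<bar>f y\<bar> \<le> B"
  shows "gagliardo s p (mollify \<epsilon> f) \<le> gagliardo s p f"
proof -
  interpret A: finite_measure "avgm \<epsilon> :: 'a measure" by (rule finite_measure_avgm[OF \<epsilon>])
  interpret P: sigma_finite_measure "pmeas (s * p) :: ('a \<times> 'a) measure" by (rule sigma_finite_pmeas)
  interpret PA: pair_sigma_finite "avgm \<epsilon> :: 'a measure" "pmeas (s * p) :: ('a \<times> 'a) measure" ..
  have "gagliardo s p (mollify \<epsilon> f) = (\<integral>\<^sup>+w. ennreal (\<bar>mollify \<epsilon> f (fst w) - mollify \<epsilon> f (snd w)\<bar> powr p) \<partial>pmeas (s * p))"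
    by (rule gagliardo_pmeas) measurable
  also have "\<dots> \<le> (\<integral>\<^sup>+w. \<integral>\<^sup>+t. ennreal (\<bar>f (fst w + t) - f (snd w + t)\<bar> powr p) \<partial>avgm \<epsilon> \<partial>pmeas (s * p))"
  proof (rule nn_integral_mono)
    fix w :: "'a \<times> 'a"
    have "\<bar>f (fst w + t) - f (snd w + t)\<bar> \<le> 2 * B" for t using f[of "fst w + t"] f[of "snd w + t"] by linarith
    then show "ennreal (\<bar>mollify \<epsilon> f (fst w) - mollify \<epsilon> f (snd w)\<bar> powr p) \<le> (\<integral>\<^sup>+t. ennreal (\<bar>f (fst w + t) - f (snd w + t)\<bar> powr p) \<partial>avgm \<epsilon>)"
      unfolding mollify_diff[OF \<epsilon> \<open>f \<in> borel_measurable borel\<close> f] by (intro avgm_jensen[OF \<epsilon> p, where B = "2 * B"]) measurable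
  qed
  also have "\<dots> = (\<integral>\<^sup>+t. \<integral>\<^sup>+w. ennreal (\<bar>f (fst w + t) - f (snd w + t)\<bar> powr p) \<partial>pmeas (s * p) \<partial>avgm \<epsilon>)"
    by (rule PA.Fubini') measurable
  also have "\<dots> = (\<integral>\<^sup>+t. gagliardo s p (\<lambda>x. f (x + t)) \<partial>(avgm \<epsilon> :: 'a measure))"
    by (intro nn_integral_cong gagliardo_pmeas[symmetric]) measurable
  also have "\<dots> = gagliardo s p f"
    using emeasure_avgm_UNIV[OF \<epsilon>, where 'a='a] by (simp add: gagliardo_translate)
  finally show ?thesis .
qed

text \<open>On the ball of radius \<epsilon> the uniform density is at most a multiple \<epsilon>^(s
  p) of the kernel, so after Jensen's inequality the energy itself controls the error, at an
  explicit rate.\<close>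

lemma mollify_Lp_error:
  fixes f :: "'a::euclidean_space \<Rightarrow> real"
  assumes \<epsilon>: "\<epsilon> > 0" and p: "p > 1" and s: "s > 0" and [measurable]: "f \<in> borel_measurable borel"
    and f: "\<And>y. \<bar>f y\<bar> \<le> B"
  shows "(\<integral>\<^sup>+x. ennreal (\<bar>mollify \<epsilon> f x - f x\<bar> powr p) \<partial>lborel)
    \<le> ennreal (\<epsilon> powr (s * p) / unit_ball_vol (real DIM('a))) * gagliardo s p f"
proof -
  define \<gamma> where "\<gamma> = s * p"
  define N where "N = real DIM('a)"
  define V where "V = unit_ball_vol (real DIM('a)) * \<epsilon> ^ DIM('a)"
  have V: "V > 0" using \<epsilon> by (simp add: V_def)
  have \<gamma>: "\<gamma> > 0" using s p by (simp add: \<gamma>_def)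
  define c where "c = \<epsilon> powr \<gamma> / unit_ball_vol (real DIM('a))"
  have c: "c * \<epsilon> powr (- (N + \<gamma>)) = 1 / V"
  proof -
    have "\<epsilon> powr \<gamma> * \<epsilon> powr (- (N + \<gamma>)) = \<epsilon> powr (- N)" by (simp add: powr_add[symmetric])
    also have "\<dots> = 1 / \<epsilon> ^ DIM('a)" using \<epsilon> by (simp add: powr_minus_divide powr_realpow N_def)
    finally show ?thesis by (simp add: c_def V_def field_simps)
  qed
  have c0: "c \<ge> 0" by (simp add: c_def)
  have "(\<integral>\<^sup>+x. ennreal (\<bar>mollify \<epsilon> f x - f x\<bar> powr p) \<partial>lborel)
    \<le> (\<integral>\<^sup>+x. ennreal c * (\<integral>\<^sup>+t. ennreal (\<bar>f x - f (x + t)\<bar> powr p) \<partial>kmeas \<gamma>) \<partial>lborel)"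
  proof (rule nn_integral_mono)
    fix x
    have i: "integrable (avgm \<epsilon>) (\<lambda>t. f (x + t))" by (rule avgm_integrable[OF \<epsilon> _ f]) measurable
    interpret A: finite_measure "avgm \<epsilon> :: 'a measure" by (rule finite_measure_avgm[OF \<epsilon>])
    have "mollify \<epsilon> f x - f x = (LINT t|(avgm \<epsilon> :: 'a measure). f (x + t) - f x)"
      using i by (simp add: mollify_def measure_avgm[OF \<epsilon>])
    moreover have "\<bar>f (x + t) - f x\<bar> \<le> 2 * B" for t using f[of "x + t"] f[of x] by linarith
    ultimately have "ennreal (\<bar>mollify \<epsilon> f x - f x\<bar> powr p) \<le> (\<integral>\<^sup>+t. ennreal (\<bar>f (x + t) - f x\<bar> powr p) \<partial>avgm \<epsilon>)"
      by (simp only:) (intro avgm_jensen[OF \<epsilon> p, where B = "2 * B"], measurable)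
    also have "\<dots> = (\<integral>\<^sup>+t. ennreal (1 / V) * indicator (ball 0 \<epsilon>) t * ennreal (\<bar>f (x + t) - f x\<bar> powr p) \<partial>lborel)"
      unfolding V_def by (rule nn_integral_avgm) measurable
    also have "\<dots> \<le> (\<integral>\<^sup>+t. ennreal c * (ennreal (rker \<gamma> t) * ennreal (\<bar>f x - f (x + t)\<bar> powr p)) \<partial>lborel)"
    proof (rule nn_integral_mono)
      fix t :: 'a
      show "ennreal (1 / V) * indicator (ball 0 \<epsilon>) t * ennreal (\<bar>f (x + t) - f x\<bar> powr p)
        \<le> ennreal c * (ennreal (rker \<gamma> t) * ennreal (\<bar>f x - f (x + t)\<bar> powr p))"
      proof (cases "t = 0 \<or> t \<notin> ball 0 \<epsilon>")
        case True
        then show ?thesis using p by (auto simp: indicator_def)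
      next
        case False
        then have t: "t \<noteq> 0" "norm t < \<epsilon>" by auto
        have "\<epsilon> powr (- (N + \<gamma>)) \<le> rker \<gamma> t"
          unfolding rker_def N_def using t \<gamma> by (intro powr_mono2') auto
        then have "1 / V \<le> c * rker \<gamma> t" unfolding c[symmetric] using c0 by (intro mult_left_mono) auto
        then have "ennreal (1 / V) \<le> ennreal c * ennreal (rker \<gamma> t)" using c0 by (simp add: ennreal_mult[symmetric] ennreal_leI)
        then have "ennreal (1 / V) * ennreal (\<bar>f x - f (x + t)\<bar> powr p) \<le> ennreal c * ennreal (rker \<gamma> t) * ennreal (\<bar>f x - f (x + t)\<bar> powr p)"
          by (intro mult_right_mono) auto
        then show ?thesis using False by (simp add: mult.assoc abs_minus_commute)
      qed
    qed
    also have "\<dots> = ennreal c * (\<integral>\<^sup>+t. ennreal (rker \<gamma> t) * ennreal (\<bar>f x - f (x + t)\<bar> powr p) \<partial>lborel)"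
      by (rule nn_integral_cmult) measurable
    also have "(\<integral>\<^sup>+t. ennreal (rker \<gamma> t) * ennreal (\<bar>f x - f (x + t)\<bar> powr p) \<partial>lborel) = (\<integral>\<^sup>+t. ennreal (\<bar>f x - f (x + t)\<bar> powr p) \<partial>kmeas \<gamma>)"
      by (rule nn_integral_kmeas[symmetric]) measurable
    finally show "ennreal (\<bar>mollify \<epsilon> f x - f x\<bar> powr p) \<le> ennreal c * (\<integral>\<^sup>+t. ennreal (\<bar>f x - f (x + t)\<bar> powr p) \<partial>kmeas \<gamma>)" .
  qed
  also have "\<dots> = ennreal c * gagliardo s p f"
    unfolding gagliardo_kmeas[OF \<open>f \<in> borel_measurable borel\<close>] \<gamma>_def[symmetric]
    by (intro nn_integral_cmult sigma_finite_measure.borel_measurable_nn_integral[OF sigma_finite_kmeas]) measurable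
  finally show ?thesis by (simp add: c_def \<gamma>_def)
qed

section \<open>Test functions and the local minimum property\<close>

lemma dist_bd_Lipschitz:
  assumes "frontier \<Omega> \<noteq> {}"
  shows "dist_bd \<Omega> x \<le> dist_bd \<Omega> y + dist x y"
  unfolding dist_bd_def by (rule infdist_triangle)

lemma dist_bd_nonneg [simp]: "0 \<le> dist_bd \<Omega> x"
  by (simp add: dist_bd_def infdist_nonneg)

text \<open>A ball is connected, so if it contained both x and a point outside the domain it would
  meet the frontier, at distance less than the radius.\<close>

lemma dist_bd_ball:
  fixes \<Omega> :: "'a::euclidean_space set"
  assumes "x \<in> \<Omega>" "dist x y < dist_bd \<Omega> x"
  shows "y \<in> \<Omega>"
proof (rule ccontr)
  assume y: "y \<notin> \<Omega>"
  have "connected (ball x (dist_bd \<Omega> x))" by simp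
  moreover have "x \<in> ball x (dist_bd \<Omega> x) \<inter> \<Omega>" using assms by (auto intro: le_less_trans[OF zero_le_dist])
  moreover have "y \<in> ball x (dist_bd \<Omega> x) - \<Omega>" using assms y by auto
  ultimately have "ball x (dist_bd \<Omega> x) \<inter> frontier \<Omega> \<noteq> {}"
    using connected_Int_frontier[of "ball x (dist_bd \<Omega> x)" \<Omega>] by blast
  then obtain w where "w \<in> frontier \<Omega>" "dist x w < dist_bd \<Omega> x" by auto
  then show False unfolding dist_bd_def using infdist_le[of w "frontier \<Omega>" x] by simp
qed

text \<open>Replacing \<delta> by max(d, \<delta>) changes nothing where z is nonzero and makes the
  quotient continuous on the whole space; it is the extension demanded by
  \<open>C0_delta\<close>.\<close>

lemma C0_delta_compact_support:
  fixes \<Omega> :: "'a::euclidean_space set"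
  assumes ne: "\<Omega> \<noteq> {}" and z: "continuous_on UNIV z" and d: "d > 0" and a: "a \<ge> 0"
    and supp: "\<And>x. z x \<noteq> 0 \<Longrightarrow> d \<le> dist_bd \<Omega> x"
    and bound: "\<And>x. x \<in> \<Omega> \<Longrightarrow> \<bar>z x\<bar> \<le> a * dist_bd \<Omega> x powr s"
  shows "z \<in> C0_delta \<Omega> s" "C0_delta_norm \<Omega> s z \<le> a"
proof -
  have "continuous_on UNIV (dist_bd \<Omega>)" unfolding dist_bd_def[abs_def] by (intro continuous_intros)
  then have "continuous_on UNIV (\<lambda>x. z x / max d (dist_bd \<Omega> x) powr s)"
    using z d by (intro continuous_intros) auto
  moreover have "z x / max d (dist_bd \<Omega> x) powr s = z x / dist_bd \<Omega> x powr s" for x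
    using supp[of x] by (cases "z x = 0") (auto simp: max_def)
  ultimately show "z \<in> C0_delta \<Omega> s"
    unfolding C0_delta_def using z by (auto intro: continuous_on_subset)
  show "C0_delta_norm \<Omega> s z \<le> a"
    unfolding C0_delta_norm_def
  proof (rule cSUP_least[OF ne])
    fix x assume x: "x \<in> \<Omega>"
    show "\<bar>z x / dist_bd \<Omega> x powr s\<bar> \<le> a"
    \<comment> \<open>In the case of equality the quotient is 0 by the convention for division by
      zero.\<close>
    proof (cases "dist_bd \<Omega> x powr s = 0")
      case False
      then have "dist_bd \<Omega> x powr s > 0" using powr_ge_zero[of "dist_bd \<Omega> x" s] by linarith
      then show ?thesis using bound[OF x] by (simp add: abs_divide divide_le_eq)
    qed (use a in simp)
  qed
qed

lemma X_spI_bounded: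
  fixes \<Omega> :: "'a::euclidean_space set"
  assumes [measurable]: "z \<in> borel_measurable borel" "\<Omega> \<in> sets borel" and \<Omega>: "emeasure lborel \<Omega> < \<infinity>" and p: "p > 0"
    and z: "\<And>x. \<bar>z x\<bar> \<le> \<tau>" "\<And>x. x \<notin> \<Omega> \<Longrightarrow> z x = 0" and J: "gagliardo s p z < \<infinity>"
  shows "z \<in> X_sp \<Omega> s p"
proof -
  have "(\<integral>\<^sup>+x. ennreal (\<bar>z x\<bar> powr p) \<partial>lborel) \<le> (\<integral>\<^sup>+x. ennreal (\<tau> powr p) * indicator \<Omega> x \<partial>lborel)"
  proof (rule nn_integral_mono)
    fix x
    show "ennreal (\<bar>z x\<bar> powr p) \<le> ennreal (\<tau> powr p) * indicator \<Omega> x"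
      using z[of x] p by (cases "x \<in> \<Omega>") (auto intro!: ennreal_leI powr_mono2)
  qed
  also have "\<dots> = ennreal (\<tau> powr p) * emeasure lborel \<Omega>" by (rule nn_integral_cmult_indicator) simp
  also have "\<dots> < \<infinity>" using \<Omega> by (simp add: ennreal_mult_less_top)
  finally show ?thesis using J z by (auto simp: X_sp_def W_sp_def)
qed

text \<open>The norm has tails bounded by a multiple of a^(-\<gamma>), so the tail comparison with
  \<open>powm \<gamma>\<close> applies once the integrand is cut off near 0. The bound is uniform in
  the cut-off thanks to \<gamma> < p, and the cut-off is removed by monotone convergence.\<close>

lemma kmeas_min_powr_finite:
  assumes \<gamma>: "0 < \<gamma>" "\<gamma> < p" and r: "r > 0"
  shows "(\<integral>\<^sup>+z. ennreal (min (norm z) r powr p) \<partial>(kmeas \<gamma> :: 'a::euclidean_space measure)) < \<infinity>"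
proof -
  define K0 where "K0 = 2 ^ DIM('a) * unit_ball_vol (real DIM('a)) / (1 - 2 powr (- \<gamma>))"
  have "2 powr (- \<gamma>) < 1" using \<gamma> by (simp add: powr_less_one)
  then have K0: "K0 \<ge> 0" by (simp add: K0_def)
  define H where "H n a = (if 1 / (real n + 1) \<le> a then min a r powr p else 0)" for n :: nat and a :: real
  have pos: "1 / (real n + 1) > 0" for n by simp
  have mono: "mono (H n)" for n
  proof (rule monoI)
    fix x y :: real assume xy: "x \<le> y"
    show "H n x \<le> H n y"
    proof (cases "1 / (real n + 1) \<le> x")
      case True
      then have "x > 0" using pos[of n] by linarith
      then have "min x r powr p \<le> min y r powr p" using xy r \<gamma> by (intro powr_mono2) auto
      then show ?thesis using True xy by (simp add: H_def)
    qed (auto simp: H_def)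
  qed
  have [measurable]: "H n \<in> borel_measurable borel" for n using mono by (rule borel_measurable_mono)
  have bound: "(\<integral>\<^sup>+z. ennreal (H n (norm z)) \<partial>(kmeas \<gamma> :: 'a measure)) \<le> ennreal (K0 * ((\<gamma> / (p - \<gamma>) + 1) * r powr (p - \<gamma>)))" for n
  proof -
    define L where "L = max r (1 / (real n + 1))"
    \<comment> \<open>There is no perturbation here, so the third measure of the comparison lemma
      enters with coefficient 0.\<close>
    have "1 * (\<integral>\<^sup>+z. ennreal (H n (norm z)) \<partial>(kmeas \<gamma> :: 'a measure))
      \<le> ennreal K0 * (\<integral>\<^sup>+x. ennreal (H n x) \<partial>powm \<gamma>) + 0 * (\<integral>\<^sup>+x. ennreal (H n x) \<partial>powm \<gamma>)"
    proof (rule nn_integral_mono_tails[OF sigma_finite_kmeas sigma_finite_powm sigma_finite_powm _ _ _ mono])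
      show "H n a = 0" if "a < 1 / (real n + 1)" for a using that by (simp add: H_def)
      show "H n a = H n L" if "L \<le> a" for a
        using that by (auto simp: H_def L_def)
      fix a :: real assume a: "1 / (real n + 1) \<le> a" "a \<le> L"
      then have a0: "a > 0" using pos[of n] by linarith
      have "emeasure (kmeas \<gamma> :: 'a measure) {z. a \<le> norm z} \<le> ennreal (K0 * a powr (- \<gamma>))"
        using kmeas_tail_finite[OF \<gamma>(1) a0, where 'a='a] by (simp add: K0_def mult_ac)
      also have "\<dots> = ennreal K0 * emeasure (powm \<gamma>) {a<..}"
        using K0 \<gamma> a0 by (simp add: emeasure_powm_greaterThan ennreal_mult)
      finally show "1 * emeasure (kmeas \<gamma>) {z \<in> space (kmeas \<gamma> :: 'a measure). a \<le> norm z}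
        \<le> ennreal K0 * emeasure (powm \<gamma>) {x \<in> space (powm \<gamma>). a < x} + 0 * emeasure (powm \<gamma>) {x \<in> space (powm \<gamma>). a < x}"
        by (simp add: greaterThan_def)
    qed measurable
    also have "\<dots> = ennreal K0 * (\<integral>\<^sup>+x. ennreal (H n x) \<partial>powm \<gamma>)" by simp
    also have "\<dots> \<le> ennreal K0 * ennreal ((\<gamma> / (p - \<gamma>) + 1) * r powr (p - \<gamma>))"
      using \<gamma> r by (intro mult_left_mono nn_integral_powm_bound) (auto simp: H_def)
    also have "\<dots> = ennreal (K0 * ((\<gamma> / (p - \<gamma>) + 1) * r powr (p - \<gamma>)))" using K0 by (simp add: ennreal_mult')
    finally show ?thesis by simp
  qed
  have "(\<integral>\<^sup>+z. ennreal (min (norm z) r powr p) \<partial>(kmeas \<gamma> :: 'a measure)) = (\<integral>\<^sup>+z. (SUP n. ennreal (H n (norm z))) \<partial>(kmeas \<gamma> :: 'a measure))"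
  proof (rule nn_integral_cong)
    fix z :: 'a
    have le: "ennreal (H n (norm z)) \<le> ennreal (min (norm z) r powr p)" for n
      by (auto simp: H_def intro: ennreal_leI)
    show "ennreal (min (norm z) r powr p) = (SUP n. ennreal (H n (norm z)))"
    proof (cases "z = 0")
      case True
      then show ?thesis using r pos by (simp add: H_def not_le[symmetric])
    next
      case False
      obtain n :: nat where "1 / norm z < real n" using reals_Archimedean2 by blast
      then have "1 / norm z \<le> real n + 1" by linarith
      then have "1 / (real n + 1) \<le> norm z" using False by (simp add: field_simps)
      then have "ennreal (min (norm z) r powr p) = ennreal (H n (norm z))" by (simp add: H_def)
      also have "\<dots> \<le> (SUP n. ennreal (H n (norm z)))" by (rule SUP_upper) simp
      finally show ?thesis using le by (intro antisym SUP_least) auto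
    qed
  qed
  also have "\<dots> = (SUP n. \<integral>\<^sup>+z. ennreal (H n (norm z)) \<partial>(kmeas \<gamma> :: 'a measure))"
  proof (rule nn_integral_monotone_convergence_SUP)
    have "H i a \<le> H j a" if "i \<le> j" for i j a
    proof -
      have "1 / (real j + 1) \<le> 1 / (real i + 1)" using that by (intro divide_left_mono) auto
      then show ?thesis by (auto simp: H_def)
    qed
    then show "incseq (\<lambda>n (z::'a). ennreal (H n (norm z)))"
      by (auto simp: incseq_def le_fun_def intro: ennreal_leI)
  qed measurable
  also have "\<dots> \<le> ennreal (K0 * ((\<gamma> / (p - \<gamma>) + 1) * r powr (p - \<gamma>)))" by (rule SUP_least) (rule bound)
  also have "\<dots> < \<infinity>" by simp
  finally show ?thesis .
qed

text \<open>The tent is 1-Lipschitz with height \<open>r\<close>, and a nonzero increment has one of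
  its two points in the ball. The energy is at most twice the volume of the ball times the integral
  of min(|z|, r)^p against the kernel, finite because s < 1.\<close>

lemma gagliardo_tent_finite:
  fixes x0 :: "'a::euclidean_space"
  assumes s: "0 < s" "s < 1" and p: "p > 1" and r: "r > 0"
  shows "gagliardo s p (\<lambda>x. max 0 (r - dist x0 x)) < \<infinity>"
proof -
  define \<phi> where "\<phi> x = max 0 (r - dist x0 x)" for x :: 'a
  define \<gamma> where "\<gamma> = s * p"
  have \<gamma>: "0 < \<gamma>" "\<gamma> < p" using s p by (auto simp: \<gamma>_def)
  have [measurable]: "\<phi> \<in> borel_measurable borel" unfolding \<phi>_def[abs_def] by measurable
  define F where "F w = indicator (ball x0 r) (fst w) * ennreal (min (norm (fst w - snd w)) r powr p)" for w :: "'a \<times> 'a"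
  have [measurable]: "F \<in> borel_measurable (borel \<Otimes>\<^sub>M borel)" unfolding F_def[abs_def] by measurable
  have "gagliardo s p \<phi> = (\<integral>\<^sup>+w. ennreal (\<bar>\<phi> (fst w) - \<phi> (snd w)\<bar> powr p) \<partial>pmeas \<gamma>)"
    unfolding \<gamma>_def by (rule gagliardo_pmeas) measurable
  also have "\<dots> \<le> (\<integral>\<^sup>+w. F w + F (snd w, fst w) \<partial>pmeas \<gamma>)"
  proof (rule nn_integral_mono)
    fix w :: "'a \<times> 'a"
    obtain x y where w: "w = (x, y)" by (cases w)
    show "ennreal (\<bar>\<phi> (fst w) - \<phi> (snd w)\<bar> powr p) \<le> F w + F (snd w, fst w)"
    proof (cases "x \<in> ball x0 r \<or> y \<in> ball x0 r")
      case False
      then have "\<phi> x = 0" "\<phi> y = 0" by (auto simp: \<phi>_def)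
      then show ?thesis using p by (simp add: w)
    next
      case True
      have t1: "dist x0 x \<le> dist x0 y + dist x y" "dist x0 y \<le> dist x0 x + dist x y" by metric+
      have t2: "0 \<le> dist x0 x" "0 \<le> dist x0 y" by auto
      have "\<bar>\<phi> x - \<phi> y\<bar> \<le> min (norm (x - y)) r"
        using t1 t2 r unfolding \<phi>_def dist_norm[of x y] by linarith
      then have "\<bar>\<phi> x - \<phi> y\<bar> powr p \<le> min (norm (x - y)) r powr p" using p by (intro powr_mono2) auto
      then have 1: "ennreal (\<bar>\<phi> x - \<phi> y\<bar> powr p) \<le> ennreal (min (norm (x - y)) r powr p)" by (rule ennreal_leI)
      show ?thesis
      proof (cases "x \<in> ball x0 r")
        case True
        have "ennreal (\<bar>\<phi> x - \<phi> y\<bar> powr p) \<le> F w" using 1 True by (simp add: F_def w)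
        also have "\<dots> \<le> F w + F (snd w, fst w)" by (rule add_increasing2) auto
        finally show ?thesis by (simp add: w)
      next
        case False
        then have "y \<in> ball x0 r" using True by simp
        then have "ennreal (\<bar>\<phi> x - \<phi> y\<bar> powr p) \<le> F (snd w, fst w)" using 1 by (simp add: F_def w norm_minus_commute)
        also have "\<dots> \<le> F w + F (snd w, fst w)" by (rule add_increasing) auto
        finally show ?thesis by (simp add: w)
      qed
    qed
  qed
  also have "\<dots> = (\<integral>\<^sup>+w. F w \<partial>pmeas \<gamma>) + (\<integral>\<^sup>+w. F (snd w, fst w) \<partial>pmeas \<gamma>)"
    by (rule nn_integral_add) measurable
  also have "(\<integral>\<^sup>+w. F (snd w, fst w) \<partial>pmeas \<gamma>) = (\<integral>\<^sup>+w. F w \<partial>pmeas \<gamma>)"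
    by (rule nn_integral_pmeas_swap) measurable
  also have "(\<integral>\<^sup>+w. F w \<partial>pmeas \<gamma>) = (\<integral>\<^sup>+x. \<integral>\<^sup>+z. F (x, x + z) \<partial>kmeas \<gamma> \<partial>lborel)"
    by (rule nn_integral_pmeas) measurable
  also have "\<dots> = (\<integral>\<^sup>+x. (\<integral>\<^sup>+z. ennreal (min (norm z) r powr p) \<partial>(kmeas \<gamma> :: 'a measure)) * indicator (ball x0 r) x \<partial>lborel)"
    by (intro nn_integral_cong) (simp add: F_def nn_integral_cmult mult.commute)
  also have "\<dots> = (\<integral>\<^sup>+z. ennreal (min (norm z) r powr p) \<partial>(kmeas \<gamma> :: 'a measure)) * emeasure lborel (ball x0 r)"
    by (rule nn_integral_cmult_indicator) simp
  also have "\<dots> + \<dots> < \<infinity>"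
    using kmeas_min_powr_finite[OF \<gamma> r, where 'a='a] r by (simp add: ennreal_mult_less_top emeasure_ball)
  finally show ?thesis by (simp add: \<phi>_def[abs_def])
qed

lemma gagliardo_scale:
  fixes u :: "'a::euclidean_space \<Rightarrow> real"
  assumes [measurable]: "u \<in> borel_measurable borel"
  shows "gagliardo s p (\<lambda>x. c * u x) = ennreal (\<bar>c\<bar> powr p) * gagliardo s p u"
proof -
  have "\<bar>c * u x - c * u y\<bar> powr p = \<bar>c\<bar> powr p * \<bar>u x - u y\<bar> powr p" for x y
    by (simp add: right_diff_distrib[symmetric] abs_mult powr_mult)
  then show ?thesis
    by (simp add: gagliardo_pmeas ennreal_mult nn_integral_cmult)
qed

lemma energy_zero: "p > 0 \<Longrightarrow> energy \<Omega> s p g (\<lambda>_. 0) = 0"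
  by (simp add: energy_eq gagliardo_def set_lebesgue_integral_def)

text \<open>Otherwise a small multiple t of a tent with the sign of g(0) gains a term linear in t
  from the primitive and pays only t^p, with p > 1. Being compactly supported in the domain, the
  tent is admissible for the hypothesis on \<open>C0_delta\<close>.\<close>

lemma local_min_imp_zero_at_zero:
  fixes \<Omega> :: "'a::euclidean_space set"
  assumes dom: "bounded_smooth_domain \<Omega>" and s: "0 < s" "s < 1" and p: "p > 1" and g: "continuous_on UNIV g" and r1: "r1 > 0"
    and min: "\<forall>z \<in> X_sp \<Omega> s p \<inter> C0_delta \<Omega> s. C0_delta_norm \<Omega> s z \<le> r1 \<longrightarrow> 0 \<le> energy \<Omega> s p g z"
  shows "g 0 = 0"
proof (rule ccontr)
  assume g0: "g 0 \<noteq> 0"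
  have op: "open \<Omega>" and bd: "bounded \<Omega>" and ne: "\<Omega> \<noteq> {}" using dom by (auto simp: bounded_smooth_domain_def)
  have \<Omega>m[measurable]: "\<Omega> \<in> sets borel" using op by simp
  have \<Omega>f: "emeasure lborel \<Omega> < \<infinity>" using bd by (rule emeasure_bounded_finite)
  define \<sigma> where "\<sigma> = sgn (g 0)"
  have \<sigma>: "\<sigma> * g 0 = \<bar>g 0\<bar>" "\<bar>\<sigma>\<bar> = 1" "\<sigma> * \<sigma> = 1" using g0 by (auto simp: \<sigma>_def sgn_if)
  define c where "c = \<bar>g 0\<bar> / 2"
  have c: "c > 0" using g0 by (simp add: c_def)
  have "isCont g 0" using g by (simp add: continuous_on_eq_continuous_at)
  then obtain \<tau> where \<tau>: "\<tau> > 0" "\<And>t. \<bar>t\<bar> < \<tau> \<Longrightarrow> \<bar>g t - g 0\<bar> < c"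
    using c unfolding continuous_at_eps_delta by (auto simp: dist_real_def)
  have gl: "c \<le> \<sigma> * g t" if "\<bar>t\<bar> < \<tau>" for t
  proof -
    have "\<bar>\<sigma> * (g t - g 0)\<bar> < c" using \<tau>(2)[OF that] \<sigma> by (simp add: abs_mult)
    then have "\<bar>\<sigma> * g t - 2 * c\<bar> < c" using \<sigma>(1) by (simp add: right_diff_distrib c_def)
    then show ?thesis by linarith
  qed
  have Gl: "c * y \<le> prim g (\<sigma> * y)" if y: "0 \<le> y" "y < \<tau>" for y
  proof (cases "y = 0")
    case False
    have "((\<lambda>y. prim g (\<sigma> * y)) has_real_derivative g (\<sigma> * t) * \<sigma>) (at t)" for t
    proof -
      have "((\<lambda>y. \<sigma> * y) has_real_derivative \<sigma>) (at t)" by (auto intro!: derivative_eq_intros)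
      from DERIV_chain2[OF prim_has_derivative[OF g] this] show ?thesis .
    qed
    then obtain t where t: "0 < t" "t < y" "prim g (\<sigma> * y) - prim g (\<sigma> * 0) = (y - 0) * (g (\<sigma> * t) * \<sigma>)"
      using MVT2[of 0 y "\<lambda>y. prim g (\<sigma> * y)" "\<lambda>t. g (\<sigma> * t) * \<sigma>"] y False by auto
    have "c \<le> \<sigma> * g (\<sigma> * t)" using t y \<sigma> by (intro gl) (simp add: abs_mult)
    then have "y * c \<le> y * (\<sigma> * g (\<sigma> * t))" using y by (intro mult_left_mono) auto
    then show ?thesis using t(3) by (simp add: mult_ac)
  qed simp
  obtain x0 where x0: "x0 \<in> \<Omega>" using ne by blast
  \<comment> \<open>The factor 2 leaves a margin: the tent of radius \<open>r\<close> stays at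
    distance at least \<open>r\<close> from the boundary.\<close>
  obtain r where r: "r > 0" "ball x0 (2 * r) \<subseteq> \<Omega>"
  proof -
    obtain e where "e > 0" "ball x0 e \<subseteq> \<Omega>" using op x0 open_contains_ball by metis
    then show ?thesis using that[of "e / 2"] by auto
  qed
  define \<phi> where "\<phi> x = max 0 (r - dist x0 x)" for x
  have \<phi>c: "continuous_on UNIV \<phi>" unfolding \<phi>_def[abs_def] by (intro continuous_intros)
  have [measurable]: "\<phi> \<in> borel_measurable borel" using \<phi>c by (rule borel_measurable_continuous_onI)
  have \<phi>b: "0 \<le> \<phi> x" "\<phi> x \<le> r" for x using r by (auto simp: \<phi>_def)
  have \<phi>s: "x \<in> \<Omega> \<and> r \<le> dist_bd \<Omega> x" if "\<phi> x \<noteq> 0" for x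
  proof -
    have xr: "dist x0 x < r" using that by (auto simp: \<phi>_def max_def split: if_splits)
    have fr: "frontier \<Omega> \<noteq> {}" by (rule bounded_smooth_domain_frontier_nonempty[OF dom])
    obtain w where w: "w \<in> frontier \<Omega>" "dist_bd \<Omega> x = dist x w"
      unfolding dist_bd_def using infdist_attains_inf[OF frontier_closed fr, of x] by metis
    have "w \<notin> \<Omega>" using w(1) op by (simp add: frontier_def interior_open)
    then have "w \<notin> ball x0 (2 * r)" using r by auto
    then have "2 * r \<le> dist x0 w" by simp
    also have "\<dots> \<le> dist x0 x + dist x w" by (rule dist_triangle)
    finally have "r \<le> dist_bd \<Omega> x" using xr w by simp
    moreover have "x \<in> \<Omega>" using xr r by auto
    ultimately show ?thesis by simp
  qed
  define J where "J = enn2real (gagliardo s p \<phi>)"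
  have "gagliardo s p \<phi> < \<infinity>" unfolding \<phi>_def[abs_def] by (rule gagliardo_tent_finite[OF s p r(1)])
  then have J: "gagliardo s p \<phi> = ennreal J" "J \<ge> 0" by (auto simp: J_def)
  have \<phi>i: "set_integrable lborel \<Omega> \<phi>"
    by (rule set_integrable_bounded_lborel[OF \<Omega>m \<Omega>f, where B = r]) (use \<phi>b in \<open>auto simp: abs_le_iff\<close>)
  define I where "I = (LINT x:\<Omega>|lborel. \<phi> x)"
  have I: "I > 0"
  proof -
    have "(LINT x|lborel. (r / 2) * indicator (ball x0 (r / 2)) x) \<le> (LINT x|lborel. indicator \<Omega> x *\<^sub>R \<phi> x)"
    proof (rule integral_mono)
      show "integrable lborel (\<lambda>x. (r / 2) * indicator (ball x0 (r / 2)) x)"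
        by (intro integrable_mult_right integrable_real_indicator) (use r in \<open>auto simp: emeasure_ball\<close>)
      show "integrable lborel (\<lambda>x. indicator \<Omega> x *\<^sub>R \<phi> x)" using \<phi>i unfolding set_integrable_def .
      fix x
      show "(r / 2) * indicator (ball x0 (r / 2)) x \<le> indicator \<Omega> x *\<^sub>R \<phi> x"
      proof (cases "x \<in> ball x0 (r / 2)")
        case True
        then have "dist x0 x < r / 2" by simp
        then have "\<phi> x \<ge> r / 2" unfolding \<phi>_def by linarith
        moreover have "x \<in> \<Omega>" using True r by (intro subsetD[OF r(2)]) auto
        ultimately show ?thesis using True by simp
      qed (use \<phi>b in auto)
    qed
    then have "(r / 2) * measure lborel (ball x0 (r / 2)) \<le> I"
      by (simp add: I_def set_lebesgue_integral_def)
    moreover have "(r / 2) * measure lborel (ball x0 (r / 2)) > 0" using r by (simp add: content_ball_pos)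
    ultimately show ?thesis by linarith
  qed
  obtain t0 where t0: "t0 > 0" "\<And>t. 0 \<le> t \<Longrightarrow> t \<le> t0 \<Longrightarrow> (J + 1) * t powr (p - 1) \<le> c * I / 2"
  proof (rule small_powr[of "J + 1" "p - 1" "c * I / 2"])
    show "0 < J + 1" "0 < p - 1" "0 < c * I / 2" using J p c I by auto
  qed (rule that)
  \<comment> \<open>Respectively: the energy is beaten by the linear gain, the values stay where g
    keeps its sign, and the weighted norm is at most \<open>r1\<close>, because \<delta> \<ge> r on
    the support.\<close>
  define t where "t = min t0 (min (\<tau> / (2 * r)) (r1 * r powr s / r))"
  have t: "t > 0" "t \<le> t0" "t \<le> \<tau> / (2 * r)" "t \<le> r1 * r powr s / r"
    using t0 \<tau> r r1 by (auto simp: t_def)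
  have tr: "t * r < \<tau>" "t * r \<le> r1 * r powr s"
  proof -
    have "t * r \<le> \<tau> / (2 * r) * r" using t r by (intro mult_right_mono) auto
    then show "t * r < \<tau>" using \<tau> r by simp
    have "t * r \<le> r1 * r powr s / r * r" using t r by (intro mult_right_mono) auto
    then show "t * r \<le> r1 * r powr s" using r by simp
  qed
  define z where "z x = (\<sigma> * t) * \<phi> x" for x
  have zc: "continuous_on UNIV z" unfolding z_def[abs_def] using \<phi>c by (intro continuous_intros)
  have [measurable]: "z \<in> borel_measurable borel" using zc by (rule borel_measurable_continuous_onI)
  have zabs: "\<bar>z x\<bar> = t * \<phi> x" for x using \<sigma> t \<phi>b by (simp add: z_def abs_mult)
  have zb: "\<bar>z x\<bar> \<le> t * r" for x unfolding zabs using t \<phi>b by (intro mult_left_mono) auto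
  have Jz: "gagliardo s p z = ennreal (t powr p * J)"
    unfolding z_def[abs_def] using \<sigma> t J by (subst gagliardo_scale) (auto simp: abs_mult ennreal_mult)
  have zX: "z \<in> X_sp \<Omega> s p"
  proof (rule X_spI_bounded[OF _ \<Omega>m \<Omega>f _ zb])
    show "z x = 0" if "x \<notin> \<Omega>" for x using \<phi>s[of x] that by (auto simp: z_def)
    show "gagliardo s p z < \<infinity>" by (simp add: Jz)
  qed (use p in auto)
  have zC: "z \<in> C0_delta \<Omega> s" "C0_delta_norm \<Omega> s z \<le> r1"
  proof -
    have supp: "r \<le> dist_bd \<Omega> x" if "z x \<noteq> 0" for x using \<phi>s[of x] that by (auto simp: z_def)
    have bnd: "\<bar>z x\<bar> \<le> r1 * dist_bd \<Omega> x powr s" for x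
    proof (cases "z x = 0")
      case False
      have "\<bar>z x\<bar> \<le> r1 * r powr s" using zb[of x] tr by linarith
      also have "\<dots> \<le> r1 * dist_bd \<Omega> x powr s"
        using supp[OF False] r1 r s by (intro mult_left_mono powr_mono2) auto
      finally show ?thesis .
    qed (use r1 in simp)
    show "z \<in> C0_delta \<Omega> s" by (rule C0_delta_compact_support(1)[OF ne zc r(1) less_imp_le[OF r1] supp bnd])
    show "C0_delta_norm \<Omega> s z \<le> r1" by (rule C0_delta_compact_support(2)[OF ne zc r(1) less_imp_le[OF r1] supp bnd])
  qed
  have "0 \<le> energy \<Omega> s p g z" using min zX zC by blast
  moreover have "energy \<Omega> s p g z < 0"
  proof -
    have "t * c * I \<le> (LINT x:\<Omega>|lborel. prim g (z x))"
    proof -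
      have "t * c * I = (LINT x:\<Omega>|lborel. (t * c) * \<phi> x)" by (simp add: I_def)
      also have "\<dots> \<le> (LINT x:\<Omega>|lborel. prim g (z x))"
      proof (rule set_integral_mono)
        show "set_integrable lborel \<Omega> (\<lambda>x. (t * c) * \<phi> x)" using \<phi>i by simp
        show "set_integrable lborel \<Omega> (\<lambda>x. prim g (z x))"
          by (rule prim_comp_integrable[OF g \<Omega>m \<Omega>f _ zb]) measurable
        fix x
        have "t * \<phi> x \<le> t * r" using t \<phi>b by (intro mult_left_mono) auto
        then have "t * \<phi> x < \<tau>" using tr by linarith
        then have "c * (t * \<phi> x) \<le> prim g (\<sigma> * (t * \<phi> x))" using t \<phi>b by (intro Gl) auto
        then show "(t * c) * \<phi> x \<le> prim g (z x)" by (simp add: z_def mult_ac)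
      qed
      finally show ?thesis .
    qed
    moreover have "1 / p * (t powr p * J) < t * c * I"
    proof -
      have "t powr (p - 1) * t powr 1 = t powr p" by (simp only: powr_add[symmetric]) simp
      then have tp: "t powr p = t powr (p - 1) * t" using t by simp
      have "1 / p * (t powr p * J) \<le> 1 * (t powr p * J)" using p J by (intro mult_right_mono) auto
      also have "\<dots> \<le> (J + 1) * t powr (p - 1) * t" using t J by (simp add: tp algebra_simps)
      also have "\<dots> \<le> c * I / 2 * t" using t0(2)[of t] t by (intro mult_right_mono) auto
      also have "\<dots> < c * I * t" using c I t by simp
      finally show ?thesis by (simp add: mult_ac)
    qed
    ultimately show ?thesis using p J by (simp add: energy_eq Jz)
  qed
  ultimately show False by simp
qed

section \<open>Approximation by continuous competitors\<close>

lemma abs_sub_le_powr: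
  fixes a b \<eta> p :: real
  assumes "\<eta> > 0" "p > 1"
  shows "\<bar>a - b\<bar> \<le> \<eta> + \<eta> powr (1 - p) * \<bar>a - b\<bar> powr p"
proof (cases "\<bar>a - b\<bar> \<le> \<eta>")
  case False
  define d where "d = \<bar>a - b\<bar>"
  have d: "d > \<eta>" using False by (simp add: d_def)
  have "1 \<le> (d / \<eta>) powr (p - 1)" using d assms by (intro ge_one_powr_ge_zero) (auto simp: field_simps)
  also have "(d / \<eta>) powr (p - 1) = d powr (p - 1) / \<eta> powr (p - 1)" by (rule powr_divide)
  also have "\<dots> = d powr (p - 1) * \<eta> powr (1 - p)"
    using powr_minus_divide[of \<eta> "p - 1"] by simp
  finally have "d * 1 \<le> d * (d powr (p - 1) * \<eta> powr (1 - p))" using d assms by (intro mult_left_mono) auto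
  also have "\<dots> = \<eta> powr (1 - p) * d powr p" using d assms by (simp add: powr_diff)
  finally show ?thesis using assms by (simp add: d_def)
qed (use assms in \<open>auto intro: add_increasing2\<close>)

text \<open>Averaging does not increase the energy, and the strict deficit \<open>e\<close> leaves
  room for the change of the primitive. That change is controlled by an L^1 error, obtained from the
  L^p error by splitting at size \<eta>.\<close>

lemma energy_smooth_approx:
  fixes \<Omega> :: "'a::euclidean_space set" and f :: "'a \<Rightarrow> real"
  assumes dom: "bounded_smooth_domain \<Omega>" and s: "0 < s" "s < 1" and p: "p > 1" and g: "continuous_on UNIV g" and r1: "r1 > 0"
    and [measurable]: "f \<in> borel_measurable borel" and f\<tau>: "\<And>x. \<bar>f x\<bar> \<le> \<tau>"
    and small: "\<And>t. \<bar>t\<bar> \<le> \<tau> \<Longrightarrow> \<bar>g t\<bar> \<le> \<epsilon>" and \<epsilon>: "\<epsilon> > 0"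
    and Jf: "gagliardo s p f < \<infinity>" and d0: "d0 > 0"
    and supp: "\<And>x. f x \<noteq> 0 \<Longrightarrow> x \<in> \<Omega> \<and> d0 \<le> dist_bd \<Omega> x"
    and bnd: "\<And>x. x \<in> \<Omega> \<Longrightarrow> \<bar>f x\<bar> \<le> r1 / 2 * dist_bd \<Omega> x powr s"
    and neg: "energy \<Omega> s p g f < 0"
  obtains z where "z \<in> X_sp \<Omega> s p" "z \<in> C0_delta \<Omega> s" "C0_delta_norm \<Omega> s z \<le> r1" "energy \<Omega> s p g z < 0"
proof -
  have op: "open \<Omega>" and bd: "bounded \<Omega>" and ne: "\<Omega> \<noteq> {}" using dom by (auto simp: bounded_smooth_domain_def)
  have \<Omega>m[measurable]: "\<Omega> \<in> sets borel" using op by simp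
  have \<Omega>f: "emeasure lborel \<Omega> < \<infinity>" using bd by (rule emeasure_bounded_finite)
  have fr: "frontier \<Omega> \<noteq> {}" by (rule bounded_smooth_domain_frontier_nonempty[OF dom])
  define m where "m = measure lborel \<Omega>"
  have m: "emeasure lborel \<Omega> = ennreal m" "m \<ge> 0" using \<Omega>f by (auto simp: m_def emeasure_eq_ennreal_measure)
  define J where "J = enn2real (gagliardo s p f)"
  have J: "gagliardo s p f = ennreal J" "J \<ge> 0" using Jf by (auto simp: J_def)
  define e where "e = - energy \<Omega> s p g f"
  have e: "e > 0" using neg by (simp add: e_def)
  \<comment> \<open>Differences below \<eta> contribute at most e/4; the averaging radius is then
    chosen so that the larger ones contribute at most another e/4.\<close>
  define \<eta> where "\<eta> = e / (4 * \<epsilon> * (m + 1))"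
  have \<eta>: "\<eta> > 0" using e \<epsilon> m by (simp add: \<eta>_def)
  have \<eta>m: "\<epsilon> * (\<eta> * m) \<le> e / 4"
  proof -
    have "\<epsilon> * (\<eta> * m) = e / 4 * (m / (m + 1))" using \<epsilon> m by (simp add: \<eta>_def)
    also have "\<dots> \<le> e / 4 * 1" using e m by (intro mult_left_mono) auto
    finally show ?thesis by simp
  qed
  define \<omega> where "\<omega> = unit_ball_vol (real DIM('a))"
  have \<omega>: "\<omega> > 0" by (simp add: \<omega>_def)
  define K where "K = \<epsilon> * \<eta> powr (1 - p) * J / \<omega> + 1"
  have K: "K > 0" using \<epsilon> J \<omega> by (auto simp: K_def intro!: add_nonneg_pos divide_nonneg_nonneg)
  obtain h0 where h0: "h0 > 0" "\<And>h. 0 \<le> h \<Longrightarrow> h \<le> h0 \<Longrightarrow> K * h powr (s * p) \<le> e / 4"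
  proof (rule small_powr[of K "s * p" "e / 4"])
    show "0 < K" "0 < s * p" "0 < e / 4" using K s p e by auto
  qed (rule that)
  \<comment> \<open>A radius of at most d0/2 keeps the support at distance d0/2 from the boundary,
    and within one averaging ball \<delta> is at most twice its value at the centre.\<close>
  define h where "h = min h0 (d0 / 2)"
  have h: "h > 0" "h \<le> h0" "h \<le> d0 / 2" using h0 d0 by (auto simp: h_def)
  define z where "z = mollify h f"
  have f0: "f y = 0" if "y \<notin> \<Omega>" for y using supp[of y] that by auto
  have zc: "continuous_on UNIV z" unfolding z_def
    by (rule mollify_continuous[OF h(1) _ f\<tau> \<Omega>m \<Omega>f f0]) auto
  have zm[measurable]: "z \<in> borel_measurable borel" using zc by (rule borel_measurable_continuous_onI)
  have z\<tau>: "\<bar>z x\<bar> \<le> \<tau>" for x unfolding z_def by (rule mollify_bound[OF h(1) _ f\<tau>]) (use f\<tau> in auto)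
  have zs: "x \<in> \<Omega> \<and> d0 / 2 \<le> dist_bd \<Omega> x" if "z x \<noteq> 0" for x
  proof -
    have "\<exists>y. dist x y < h \<and> f y \<noteq> 0"
    proof (rule ccontr)
      assume no: "\<not> ?thesis"
      have "\<bar>z x\<bar> \<le> 0" unfolding z_def by (rule mollify_bound[OF h(1) _ f\<tau>]) (use no in auto)
      then show False using that by simp
    qed
    then obtain y where y: "dist x y < h" "f y \<noteq> 0" by blast
    have yd: "y \<in> \<Omega>" "d0 \<le> dist_bd \<Omega> y" using supp[OF y(2)] by auto
    have "dist y x < dist_bd \<Omega> y" using y(1) yd h d0 by (simp add: dist_commute)
    then have "x \<in> \<Omega>" using dist_bd_ball[OF yd(1)] by blast
    moreover have "dist_bd \<Omega> y \<le> dist_bd \<Omega> x + dist y x" by (rule dist_bd_Lipschitz[OF fr])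
    ultimately show ?thesis using yd y(1) h by (simp add: dist_commute)
  qed
  have zb: "\<bar>z x\<bar> \<le> r1 * dist_bd \<Omega> x powr s" for x
  proof (cases "z x = 0")
    case False
    then have x: "x \<in> \<Omega>" "d0 / 2 \<le> dist_bd \<Omega> x" using zs by auto
    have "\<bar>z x\<bar> \<le> r1 / 2 * (2 * dist_bd \<Omega> x) powr s"
      unfolding z_def
    proof (rule mollify_bound[OF h(1) _ f\<tau>])
      fix y assume y: "dist x y < h"
      show "\<bar>f y\<bar> \<le> r1 / 2 * (2 * dist_bd \<Omega> x) powr s"
      proof (cases "y \<in> \<Omega>")
        case True
        have "dist_bd \<Omega> y \<le> dist_bd \<Omega> x + dist y x" by (rule dist_bd_Lipschitz[OF fr])
        then have "dist_bd \<Omega> y \<le> 2 * dist_bd \<Omega> x" using y x h by (simp add: dist_commute)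
        then have "r1 / 2 * dist_bd \<Omega> y powr s \<le> r1 / 2 * (2 * dist_bd \<Omega> x) powr s"
          using r1 s by (intro mult_left_mono powr_mono2) auto
        then show ?thesis using bnd[OF True] by linarith
      qed (use f0 r1 in simp)
    qed measurable
    also have "(2 * dist_bd \<Omega> x) powr s = 2 powr s * dist_bd \<Omega> x powr s" by (rule powr_mult)
    \<comment> \<open>The possible doubling of \<delta> costs the factor 2^s \<le> 2, which explains
      why \<open>f\<close> is assumed to lie below r1/2 times the weight.\<close>
    also have "r1 / 2 * (2 powr s * dist_bd \<Omega> x powr s) \<le> r1 / 2 * (2 powr 1 * dist_bd \<Omega> x powr s)"
      using r1 s by (intro mult_left_mono mult_right_mono powr_mono) auto
    finally show ?thesis by simp
  qed (use r1 in simp)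
  have Jz: "gagliardo s p z \<le> gagliardo s p f"
    unfolding z_def by (rule gagliardo_mollify_le[OF h(1) p _ _ f\<tau>]) (use zm in \<open>auto simp: z_def\<close>)
  have Jzf: "gagliardo s p z < \<infinity>" using Jz Jf by (rule le_less_trans)
  have zX: "z \<in> X_sp \<Omega> s p"
    by (rule X_spI_bounded[OF zm \<Omega>m \<Omega>f _ z\<tau>]) (use zs Jzf p in auto)
  have zs': "d0 / 2 \<le> dist_bd \<Omega> x" if "z x \<noteq> 0" for x using zs[OF that] by simp
  have d02: "d0 / 2 > 0" using d0 by simp
  have zC: "z \<in> C0_delta \<Omega> s"
    by (rule C0_delta_compact_support(1)[OF ne zc d02 less_imp_le[OF r1] zs' zb])
  have zN: "C0_delta_norm \<Omega> s z \<le> r1"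
    by (rule C0_delta_compact_support(2)[OF ne zc d02 less_imp_le[OF r1] zs' zb])
  define E where "E = \<eta> powr (1 - p) * (h powr (s * p) / \<omega> * J)"
  have E0: "E \<ge> 0" using J \<omega> by (simp add: E_def)
  have EK: "\<epsilon> * E \<le> e / 4"
  proof -
    have "\<epsilon> * E = (\<epsilon> * \<eta> powr (1 - p) * J / \<omega>) * h powr (s * p)" by (simp add: E_def)
    also have "\<dots> \<le> K * h powr (s * p)" by (intro mult_right_mono) (auto simp: K_def)
    also have "\<dots> \<le> e / 4" using h0(2)[of h] h by simp
    finally show ?thesis .
  qed
  have "(LINT x:\<Omega>|lborel. prim g (f x)) - (LINT x:\<Omega>|lborel. prim g (z x)) \<le> \<epsilon> * (\<eta> * m) + \<epsilon> * E"
  proof (rule LINT_diff_le[where w = "\<lambda>x. \<epsilon> * (\<eta> * indicator \<Omega> x + \<eta> powr (1 - p) * \<bar>z x - f x\<bar> powr p)"])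
    show "set_integrable lborel \<Omega> (\<lambda>x. prim g (f x))" by (rule prim_comp_integrable[OF g \<Omega>m \<Omega>f _ f\<tau>]) measurable
    show "set_integrable lborel \<Omega> (\<lambda>x. prim g (z x))" by (rule prim_comp_integrable[OF g \<Omega>m \<Omega>f _ z\<tau>]) measurable
    show "prim g (f x) - prim g (z x) \<le> \<epsilon> * (\<eta> * indicator \<Omega> x + \<eta> powr (1 - p) * \<bar>z x - f x\<bar> powr p)" if "x \<in> \<Omega>" for x
    proof -
      have "\<bar>prim g (f x) - prim g (z x)\<bar> \<le> \<epsilon> * \<bar>f x - z x\<bar>"
        by (rule prim_diff_le[OF g], rule small) (use f\<tau>[of x] z\<tau>[of x] in linarith)
      also have "\<dots> \<le> \<epsilon> * (\<eta> + \<eta> powr (1 - p) * \<bar>f x - z x\<bar> powr p)"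
        using \<epsilon> abs_sub_le_powr[OF \<eta> p] by (intro mult_left_mono) auto
      finally show ?thesis using that by (simp add: abs_minus_commute)
    qed
    have "(\<integral>\<^sup>+x. ennreal (\<epsilon> * (\<eta> * indicator \<Omega> x + \<eta> powr (1 - p) * \<bar>z x - f x\<bar> powr p)) \<partial>lborel)
      = (\<integral>\<^sup>+x. ennreal \<epsilon> * (ennreal \<eta> * indicator \<Omega> x + ennreal (\<eta> powr (1 - p)) * ennreal (\<bar>z x - f x\<bar> powr p)) \<partial>lborel)"
      using \<epsilon> \<eta> by (intro nn_integral_cong) (auto simp: indicator_def ennreal_mult)
    also have "\<dots> = ennreal \<epsilon> * (\<integral>\<^sup>+x. ennreal \<eta> * indicator \<Omega> x + ennreal (\<eta> powr (1 - p)) * ennreal (\<bar>z x - f x\<bar> powr p) \<partial>lborel)"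
      by (rule nn_integral_cmult) measurable
    also have "(\<integral>\<^sup>+x. ennreal \<eta> * indicator \<Omega> x + ennreal (\<eta> powr (1 - p)) * ennreal (\<bar>z x - f x\<bar> powr p) \<partial>lborel)
      = (\<integral>\<^sup>+x. ennreal \<eta> * indicator \<Omega> x \<partial>lborel) + (\<integral>\<^sup>+x. ennreal (\<eta> powr (1 - p)) * ennreal (\<bar>z x - f x\<bar> powr p) \<partial>lborel)"
      by (rule nn_integral_add) measurable
    also have "(\<integral>\<^sup>+x. ennreal \<eta> * indicator \<Omega> x \<partial>lborel) = ennreal (\<eta> * m)"
      using \<eta> m by (simp add: nn_integral_cmult_indicator ennreal_mult)
    also have "(\<integral>\<^sup>+x. ennreal (\<eta> powr (1 - p)) * ennreal (\<bar>z x - f x\<bar> powr p) \<partial>lborel)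
      = ennreal (\<eta> powr (1 - p)) * (\<integral>\<^sup>+x. ennreal (\<bar>z x - f x\<bar> powr p) \<partial>lborel)"
      by (rule nn_integral_cmult) measurable
    also have "\<dots> \<le> ennreal (\<eta> powr (1 - p)) * (ennreal (h powr (s * p) / \<omega>) * gagliardo s p f)"
      unfolding z_def \<omega>_def by (intro mult_left_mono mollify_Lp_error[OF h(1) p s(1) _ f\<tau>]) auto
    also have "\<dots> = ennreal E"
    proof -
      have "ennreal (h powr (s * p) / \<omega>) * ennreal J = ennreal (h powr (s * p) / \<omega> * J)"
        by (rule ennreal_mult[symmetric]) (use J \<omega> in auto)
      moreover have "ennreal (\<eta> powr (1 - p)) * ennreal (h powr (s * p) / \<omega> * J) = ennreal E"
        unfolding E_def by (rule ennreal_mult[symmetric]) (use J \<omega> in auto)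
      ultimately show ?thesis by (simp only: J(1))
    qed
    finally have "(\<integral>\<^sup>+x. ennreal (\<epsilon> * (\<eta> * indicator \<Omega> x + \<eta> powr (1 - p) * \<bar>z x - f x\<bar> powr p)) \<partial>lborel)
      \<le> ennreal \<epsilon> * (ennreal (\<eta> * m) + ennreal E)"
      by (simp add: add_left_mono mult_left_mono)
    also have "\<dots> = ennreal (\<epsilon> * (\<eta> * m) + \<epsilon> * E)"
      using \<epsilon> \<eta> m E0 by (simp add: ennreal_mult[symmetric] ennreal_plus[symmetric] distrib_left del: ennreal_plus)
    finally show "(\<integral>\<^sup>+x. ennreal (\<epsilon> * (\<eta> * indicator \<Omega> x + \<eta> powr (1 - p) * \<bar>z x - f x\<bar> powr p)) \<partial>lborel)
      \<le> ennreal (\<epsilon> * (\<eta> * m) + \<epsilon> * E)" .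
  qed (use \<epsilon> \<eta> m E0 in auto)
  then have dG: "(LINT x:\<Omega>|lborel. prim g (f x)) - (LINT x:\<Omega>|lborel. prim g (z x)) \<le> e / 2"
    using EK \<eta>m by linarith
  have "enn2real (gagliardo s p z) \<le> J" unfolding J_def using Jz Jf by (intro enn2real_mono) auto
  then have "1 / p * enn2real (gagliardo s p z) \<le> 1 / p * J" using p by (intro mult_left_mono) auto
  moreover have "- e = 1 / p * J - (LINT x:\<Omega>|lborel. prim g (f x))"
    using p by (simp add: e_def energy_eq J_def)
  moreover have "energy \<Omega> s p g z = 1 / p * enn2real (gagliardo s p z) - (LINT x:\<Omega>|lborel. prim g (z x))"
    using p by (simp add: energy_eq)
  ultimately have "energy \<Omega> s p g z < 0" using dG e by linarith
  then show ?thesis by (rule that[OF zX zC zN])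
qed

text \<open>\<open>A\<close>, \<open>k\<close>, \<epsilon>, \<tau> and \<rho> are fixed from the
  data alone, so that \<open>r2\<close> is uniform. Only then is a bad z considered, and \<kappa>0,
  \<open>h\<close> and \<open>d0\<close> may depend on its energy deficit; this is possible because
  the strictness of the barrier does not degrade as \<kappa> tends to 0.\<close>

theorem theorem3p4:
  fixes \<Omega> :: "'a::euclidean_space set" and s p q C r1 :: real and g :: "real \<Rightarrow> real"
  assumes "DIM('a) > 1"
    and "bounded_smooth_domain \<Omega>"
    and "0 < s" "s < 1" "p > 1" "real DIM('a) > s * p"
    and "continuous_on UNIV g"
    and "C > 0" "1 \<le> q" "q \<le> real DIM('a) * p / (real DIM('a) - s * p)"
    and "\<forall>t. t \<noteq> 0 \<longrightarrow> \<bar>g t\<bar> \<le> C * (1 + \<bar>t\<bar> powr (q - 1))"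
    and "r1 > 0"
    and "\<forall>z \<in> X_sp \<Omega> s p \<inter> C0_delta \<Omega> s. C0_delta_norm \<Omega> s z \<le> r1 \<longrightarrow>
           energy \<Omega> s p g (\<lambda>_. 0) \<le> energy \<Omega> s p g z"
  shows "\<exists>r2 > 0. \<forall>z \<in> X_sp \<Omega> s p. X_norm s p z \<le> r2 \<longrightarrow>
           energy \<Omega> s p g (\<lambda>_. 0) \<le> energy \<Omega> s p g z"
proof -
  note dom = assms(2) and s = assms(3,4) and p = assms(5) and sp = assms(6) and g = assms(7) and r1 = assms(12)
  have E0: "energy \<Omega> s p g (\<lambda>_. 0) = 0" using p by (intro energy_zero) auto
  have min: "\<forall>z \<in> X_sp \<Omega> s p \<inter> C0_delta \<Omega> s. C0_delta_norm \<Omega> s z \<le> r1 \<longrightarrow> 0 \<le> energy \<Omega> s p g z"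
    using assms(13) by (simp only: E0)
  have g0: "g 0 = 0" by (rule local_min_imp_zero_at_zero[OF dom s p g r1 min])
  have op: "open \<Omega>" and bd: "bounded \<Omega>" using dom by (auto simp: bounded_smooth_domain_def)
  have \<Omega>m[measurable]: "\<Omega> \<in> sets borel" using op by simp
  have \<Omega>f: "emeasure lborel \<Omega> < \<infinity>" using bd by (rule emeasure_bounded_finite)
  define m where "m = measure lborel \<Omega>"
  have m: "emeasure lborel \<Omega> = ennreal m" "m \<ge> 0" using \<Omega>f by (auto simp: m_def emeasure_eq_ennreal_measure)
  define pst where "pst = real DIM('a) * p / (real DIM('a) - s * p)"
  have C2: "2 * C > 0" using assms(8) by simp
  \<comment> \<open>The exponent is raised to the critical one at the cost of doubling the constant.
    At t = 0 the bound follows from g(0) = 0.\<close>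
  have growth: "\<bar>g t\<bar> \<le> (2 * C) * (1 + \<bar>t\<bar> powr (pst - 1))" for t
  proof (cases "t = 0")
    case True
    then show ?thesis using g0 C2 by simp
  next
    case False
    have *: "1 + X \<le> 2 * (1 + Y)" if "X \<le> 1 + Y" "0 \<le> Y" for X Y :: real
      using that by (simp add: distrib_left)
    have "\<bar>t\<bar> powr (q - 1) \<le> 1 + \<bar>t\<bar> powr (pst - 1)"
    proof (cases "\<bar>t\<bar> \<le> 1")
      case True
      then have "\<bar>t\<bar> powr (q - 1) \<le> 1" using assms(9) by (intro powr_le1) auto
      then show ?thesis by (simp add: add_increasing2)
    next
      case False
      then have "\<bar>t\<bar> powr (q - 1) \<le> \<bar>t\<bar> powr (pst - 1)" using assms(10) unfolding pst_def by (intro powr_mono) auto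
      then show ?thesis by simp
    qed
    then have "1 + \<bar>t\<bar> powr (q - 1) \<le> 2 * (1 + \<bar>t\<bar> powr (pst - 1))"
      by (rule *) simp
    then have "C * (1 + \<bar>t\<bar> powr (q - 1)) \<le> C * (2 * (1 + \<bar>t\<bar> powr (pst - 1)))"
      using assms(8) by (intro mult_left_mono) auto
    moreover have "\<bar>g t\<bar> \<le> C * (1 + \<bar>t\<bar> powr (q - 1))" using assms(11) False by blast
    ultimately show ?thesis by (simp add: mult_ac)
  qed
  obtain L F K where L: "L > 0" and F: "F > 0" and K: "K > 0" and barrier:
    "\<And>\<kappa>. \<kappa> > 0 \<Longrightarrow> \<exists>D :: 'a \<Rightarrow> real. barrier_function \<Omega> s p L F D \<and> (\<forall>x\<in>\<Omega>. D x \<le> \<kappa> + K * dist_bd \<Omega> x)"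
    by (rule barrier_exists[OF dom s p]) (rule that)
  \<comment> \<open>The slope for which the barrier is at most r1/2 times \<delta>^s, up to an
    additive A \<kappa>^s.\<close>
  define A where "A = r1 / 2 / K powr s"
  have A: "A > 0" "A * K powr s = r1 / 2" using r1 K by (auto simp: A_def)
  define k where "k = 2 * p * A powr (p - 1) * F"
  have k: "k > 0" using p A F by (simp add: k_def)
  \<comment> \<open>The largest size of g that the gain \<open>k\<close> of the barrier truncation
    can absorb.\<close>
  define \<epsilon> where "\<epsilon> = k / p"
  have \<epsilon>: "\<epsilon> > 0" "p * \<epsilon> \<le> k" using k p by (auto simp: \<epsilon>_def)
  have "isCont g 0" using g by (simp add: continuous_on_eq_continuous_at)
  then obtain t0 where t0: "t0 > 0" "\<And>t. \<bar>t\<bar> < t0 \<Longrightarrow> \<bar>g t\<bar> < \<epsilon>"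
    using \<epsilon>(1) g0 unfolding continuous_at_eps_delta by (auto simp: dist_real_def)
  \<comment> \<open>The first bound makes |g| \<le> \<epsilon> on [-\<tau>, \<tau>]. The second
    confines the barrier truncation to points with D \<le> L/2, where the barrier inequality is
    available.\<close>
  define \<tau> where "\<tau> = min (t0 / 2) (A * (L / 2) powr s)"
  have \<tau>: "\<tau> > 0" "\<tau> < t0" "\<tau> \<le> A * (L / 2) powr s" using t0 A L by (auto simp: \<tau>_def)
  have small: "\<bar>g t\<bar> \<le> \<epsilon>" if "\<bar>t\<bar> \<le> \<tau>" for t using t0(2)[of t] that \<tau> by linarith
  obtain \<rho> where \<rho>: "\<rho> > 0" and clamp:
    "\<And>u :: 'a \<Rightarrow> real. u \<in> borel_measurable borel \<Longrightarrow> (\<integral>\<^sup>+x. ennreal (\<bar>u x\<bar> powr p) \<partial>lborel) < \<infinity> \<Longrightarrow>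
      gagliardo s p u \<le> ennreal \<rho> \<Longrightarrow> set_integrable lborel \<Omega> (\<lambda>x. prim g (u x)) \<Longrightarrow>
      energy \<Omega> s p g (\<lambda>x. clampr \<tau> (u x)) \<le> energy \<Omega> s p g u"
    by (rule energy_clamp_le[OF \<Omega>m \<Omega>f s(1) p sp g C2 \<tau>(1) growth[unfolded pst_def]]) (rule that)
  have main: False if zX: "z \<in> X_sp \<Omega> s p" and z\<rho>: "X_norm s p z \<le> \<rho> powr (1 / p)" and zneg: "energy \<Omega> s p g z < 0" for z
  proof -
    have zm[measurable]: "z \<in> borel_measurable borel" and zp: "(\<integral>\<^sup>+x. ennreal (\<bar>z x\<bar> powr p) \<partial>lborel) < \<infinity>"
      and Jz: "gagliardo s p z < \<infinity>" and zae: "AE x in lborel. x \<notin> \<Omega> \<longrightarrow> z x = 0"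
      using zX by (auto simp: X_sp_def W_sp_def)
    \<comment> \<open>Members of \<open>X_sp\<close> vanish outside the domain only almost
      everywhere; this representative vanishes there pointwise and has the same energy.\<close>
    define y where "y x = indicator \<Omega> x * z x" for x
    have [measurable]: "y \<in> borel_measurable borel" unfolding y_def[abs_def] by measurable
    have yz: "AE x in lborel. y x = z x" using zae by eventually_elim (auto simp: y_def indicator_def)
    have gy: "gagliardo s p y = gagliardo s p z" by (rule gagliardo_cong_AE[OF _ _ yz]) measurable
    have Gyz: "(LINT x:\<Omega>|lborel. prim g (y x)) = (LINT x:\<Omega>|lborel. prim g (z x))"
      by (rule set_lebesgue_integral_cong) (auto simp: y_def)
    have Ey: "energy \<Omega> s p g y < 0" using zneg p by (simp add: energy_eq gy Gyz)
    have J\<rho>: "gagliardo s p y \<le> ennreal \<rho>"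
    proof -
      have "(X_norm s p z) powr p \<le> (\<rho> powr (1 / p)) powr p"
        using z\<rho> p by (intro powr_mono2) (auto simp: X_norm_def)
      then have "enn2real (gagliardo s p z) \<le> \<rho>" using p \<rho> by (simp add: X_norm_def powr_powr)
      then have "ennreal (enn2real (gagliardo s p z)) \<le> ennreal \<rho>" by (rule ennreal_leI)
      then show ?thesis using Jz by (simp add: gy)
    qed
    have yp: "(\<integral>\<^sup>+x. ennreal (\<bar>y x\<bar> powr p) \<partial>lborel) < \<infinity>"
    proof -
      have "(\<integral>\<^sup>+x. ennreal (\<bar>y x\<bar> powr p) \<partial>lborel) \<le> (\<integral>\<^sup>+x. ennreal (\<bar>z x\<bar> powr p) \<partial>lborel)"
        using p by (intro nn_integral_mono ennreal_leI powr_mono2) (auto simp: y_def indicator_def)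
      then show ?thesis using zp by (rule le_less_trans)
    qed
    \<comment> \<open>The integral of a non-integrable function is 0 by convention. The functional
      would then be nonnegative, so a negative value implies integrability.\<close>
    have Gi: "set_integrable lborel \<Omega> (\<lambda>x. prim g (y x))"
    proof (rule ccontr)
      assume "\<not> ?thesis"
      then have "(LINT x:\<Omega>|lborel. prim g (y x)) = 0"
        unfolding set_lebesgue_integral_def set_integrable_def by (rule not_integrable_integral_eq)
      then have "energy \<Omega> s p g y = 1 / p * enn2real (gagliardo s p y)" using p by (simp add: energy_eq)
      moreover have "0 \<le> 1 / p * enn2real (gagliardo s p y)" using p by simp
      ultimately show False using Ey by linarith
    qed
    define u where "u x = clampr \<tau> (y x)" for x
    have [measurable]: "u \<in> borel_measurable borel" unfolding u_def[abs_def] by measurable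
    have Eu: "energy \<Omega> s p g u < 0" using clamp[OF _ yp J\<rho> Gi] Ey unfolding u_def[abs_def] by simp
    have u\<tau>: "\<bar>u x\<bar> \<le> \<tau>" for x using \<tau> by (auto simp: u_def clampr_def)
    have u0: "u x = 0" if "x \<notin> \<Omega>" for x using that \<tau> by (simp add: u_def y_def clampr_def)
    have Ju: "gagliardo s p u < \<infinity>"
    proof -
      have "gagliardo s p u \<le> gagliardo s p y"
      proof (rule gagliardo_mono)
        show "\<bar>u x - u x'\<bar> \<le> \<bar>y x - y x'\<bar>" for x x'
          unfolding u_def using clampr_abs_split[OF \<tau>(1), of "y x" "y x'"] by linarith
      qed (use p in auto)
      then show ?thesis using Jz unfolding gy by (rule le_less_trans)
    qed
    define e where "e = - energy \<Omega> s p g u"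
    have e: "e > 0" using Eu by (simp add: e_def)
    \<comment> \<open>The later lowering by h = 2 A \<kappa>0^s may consume at most half of the
      deficit \<open>e\<close>.\<close>
    obtain \<kappa>0 where \<kappa>0: "\<kappa>0 > 0" "\<And>\<kappa>. 0 \<le> \<kappa> \<Longrightarrow> \<kappa> \<le> \<kappa>0 \<Longrightarrow> (\<epsilon> * (2 * A) * (m + 1)) * \<kappa> powr s \<le> e / 2"
    proof (rule small_powr[of "\<epsilon> * (2 * A) * (m + 1)" s "e / 2"])
      show "0 < \<epsilon> * (2 * A) * (m + 1)" "0 < s" "0 < e / 2" using \<epsilon> A m s e by auto
    qed (rule that)
    obtain D :: "'a \<Rightarrow> real" and B where [measurable]: "D \<in> borel_measurable borel" and D0: "\<And>x. 0 \<le> D x"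
      and Dle: "\<And>x. x \<in> \<Omega> \<Longrightarrow> D x \<le> \<kappa>0 + K * dist_bd \<Omega> x"
      and Dkey: "\<And>q x. 1/2 \<le> q \<Longrightarrow> q < 1 \<Longrightarrow> x \<in> \<Omega> \<Longrightarrow> D x \<le> L / 2 \<Longrightarrow>
        (\<integral>\<^sup>+z. ennreal (cutp s p q (D (x + z)) (D x)) \<partial>kmeas (s * p)) + ennreal F
       \<le> (\<integral>\<^sup>+z. ennreal (cutp s p q (D x) (D (x + z))) \<partial>kmeas (s * p))"
      and Dbd: "\<And>q x. 1/2 \<le> q \<Longrightarrow> q < 1 \<Longrightarrow> x \<in> \<Omega> \<Longrightarrow> D x \<le> L / 2 \<Longrightarrow>
        (\<integral>\<^sup>+z. ennreal (cutp s p q (D (x + z)) (D x)) \<partial>kmeas (s * p)) \<le> ennreal (B q)"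
      using barrier[OF \<kappa>0(1)] unfolding barrier_function_def by blast
    have inside: "x \<in> \<Omega> \<and> D x \<le> L / 2" if "A * D x powr s < \<bar>u x\<bar>" for x
    proof
      have "0 \<le> A * D x powr s" using A by simp
      then have "u x \<noteq> 0" using that by auto
      then show "x \<in> \<Omega>" using u0 by blast
      show "D x \<le> L / 2"
      proof (rule ccontr)
        assume "\<not> D x \<le> L / 2"
        then have "(L / 2) powr s \<le> D x powr s" using L s by (intro powr_mono2) auto
        then have "A * (L / 2) powr s \<le> A * D x powr s" using A by (intro mult_left_mono) auto
        then show False using that u\<tau>[of x] \<tau> by linarith
      qed
    qed
    define w where "w x = clampr (A * D x powr s) (u x)" for x
    have [measurable]: "w \<in> borel_measurable borel" unfolding w_def[abs_def] clampr_def by measurable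
    have ufin: "(\<integral>\<^sup>+x. ennreal \<bar>u x\<bar> \<partial>lborel) < \<infinity>"
    proof -
      have "(\<integral>\<^sup>+x. ennreal \<bar>u x\<bar> \<partial>lborel) \<le> (\<integral>\<^sup>+x. ennreal \<tau> * indicator \<Omega> x \<partial>lborel)"
      proof (rule nn_integral_mono)
        fix x
        show "ennreal \<bar>u x\<bar> \<le> ennreal \<tau> * indicator \<Omega> x"
          using u\<tau>[of x] u0[of x] by (cases "x \<in> \<Omega>") (auto intro: ennreal_leI)
      qed
      also have "\<dots> = ennreal \<tau> * emeasure lborel \<Omega>" by (rule nn_integral_cmult_indicator) simp
      also have "\<dots> < \<infinity>" using \<Omega>f by (simp add: ennreal_mult_less_top)
      finally show ?thesis .
    qed
    have wJ: "gagliardo s p w + ennreal k * (\<integral>\<^sup>+x. ennreal \<bar>u x - w x\<bar> \<partial>lborel) \<le> gagliardo s p u"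
      unfolding w_def[abs_def] k_def
    proof (rule gagliardo_clamp_barrier[OF p A(1) s(1) less_imp_le[OF F] _ _ D0 ufin])
      fix q x assume q: "1/2 \<le> q" "q < (1::real)" "A * D x powr s < \<bar>u x\<bar>"
      show "(\<integral>\<^sup>+z. ennreal (cutp s p q (D (x + z)) (D x)) \<partial>kmeas (s * p)) + ennreal F
       \<le> (\<integral>\<^sup>+z. ennreal (cutp s p q (D x) (D (x + z))) \<partial>kmeas (s * p))"
        using Dkey[OF q(1,2)] inside[OF q(3)] by blast
      show "(\<integral>\<^sup>+z. ennreal (cutp s p q (D (x + z)) (D x)) \<partial>kmeas (s * p)) \<le> ennreal (B q)"
        using Dbd[OF q(1,2)] inside[OF q(3)] by blast
    qed measurable
    have wu: "\<bar>w x\<bar> \<le> \<bar>u x\<bar>" "\<bar>w x\<bar> \<le> A * D x powr s" for x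
    proof -
      have "0 \<le> A * D x powr s" using A by simp
      then show "\<bar>w x\<bar> \<le> \<bar>u x\<bar>" "\<bar>w x\<bar> \<le> A * D x powr s" unfolding w_def clampr_def by linarith+
    qed
    have w\<tau>: "\<bar>w x\<bar> \<le> \<tau>" for x using wu(1)[of x] u\<tau>[of x] by linarith
    have w0: "w x = 0" if "x \<notin> \<Omega>" for x using wu(1)[of x] u0[OF that] by simp
    have Ew: "energy \<Omega> s p g w \<le> - e"
      unfolding e_def minus_minus
      by (rule energy_barrier_le[OF \<Omega>m \<Omega>f p g _ _ u\<tau> w\<tau> small \<epsilon>(2) k Ju wJ]) auto
    have Jw: "gagliardo s p w < \<infinity>"
    proof -
      have "gagliardo s p w \<le> gagliardo s p w + ennreal k * (\<integral>\<^sup>+x. ennreal \<bar>u x - w x\<bar> \<partial>lborel)"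
        by (rule add_increasing2) auto
      also note wJ
      finally show ?thesis using Ju by (rule le_less_trans)
    qed
    \<comment> \<open>One copy of A \<kappa>0^s cancels the offset of the barrier at the boundary;
      the second pushes the bound below zero near the boundary and makes the support compact.
      Subtracting the clamp lowers |w| by \<open>h\<close> and cuts off at 0.\<close>
    define h where "h = 2 * A * \<kappa>0 powr s"
    have h: "h > 0" using A \<kappa>0 by (simp add: h_def)
    define f where "f x = w x - clampr h (w x)" for x
    have [measurable]: "f \<in> borel_measurable borel" unfolding f_def[abs_def] by measurable
    have fw: "\<bar>f x\<bar> \<le> \<bar>w x\<bar>" "\<bar>w x - f x\<bar> \<le> h" "f x \<noteq> 0 \<Longrightarrow> \<bar>f x\<bar> = \<bar>w x\<bar> - h" for x
      using h by (auto simp: f_def clampr_def min_def max_def split: if_splits)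
    have f\<tau>: "\<bar>f x\<bar> \<le> \<tau>" for x using fw(1)[of x] w\<tau>[of x] by linarith
    have fbound: "x \<in> \<Omega> \<and> \<bar>f x\<bar> \<le> r1 / 2 * dist_bd \<Omega> x powr s - A * \<kappa>0 powr s" if "f x \<noteq> 0" for x
    proof
      have "w x \<noteq> 0" using that fw(1)[of x] by auto
      then show x: "x \<in> \<Omega>" using w0 by blast
      have "D x powr s \<le> (\<kappa>0 + K * dist_bd \<Omega> x) powr s"
        using Dle[OF x] D0 s by (intro powr_mono2) auto
      also have "\<dots> \<le> \<kappa>0 powr s + (K * dist_bd \<Omega> x) powr s"
        using \<kappa>0 K s by (intro powr_add_le) auto
      also have "(K * dist_bd \<Omega> x) powr s = K powr s * dist_bd \<Omega> x powr s" by (rule powr_mult)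
      finally have "A * D x powr s \<le> A * (\<kappa>0 powr s + K powr s * dist_bd \<Omega> x powr s)"
        using A by (intro mult_left_mono) auto
      also have "\<dots> = A * \<kappa>0 powr s + (A * K powr s) * dist_bd \<Omega> x powr s" by (simp add: algebra_simps)
      finally have "\<bar>w x\<bar> \<le> A * \<kappa>0 powr s + r1 / 2 * dist_bd \<Omega> x powr s" using wu(2)[of x] A(2) by simp
      then show "\<bar>f x\<bar> \<le> r1 / 2 * dist_bd \<Omega> x powr s - A * \<kappa>0 powr s"
        using fw(3)[OF that] by (simp add: h_def)
    qed
    \<comment> \<open>The distance at which (r1/2) \<delta>^s equals A \<kappa>0^s; closer to the
      boundary the bound on f is negative, so f vanishes.\<close>
    define d0 where "d0 = (A * \<kappa>0 powr s / (r1 / 2)) powr (1 / s)"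
    have Ak: "A * \<kappa>0 powr s > 0" using A \<kappa>0 by simp
    have d0: "d0 > 0" using A \<kappa>0 r1 by (simp add: d0_def)
    have fsupp: "x \<in> \<Omega> \<and> d0 \<le> dist_bd \<Omega> x" if "f x \<noteq> 0" for x
    proof
      show "x \<in> \<Omega>" using fbound[OF that] by simp
      have "0 \<le> r1 / 2 * dist_bd \<Omega> x powr s - A * \<kappa>0 powr s" using fbound[OF that] by linarith
      then have "A * \<kappa>0 powr s / (r1 / 2) \<le> dist_bd \<Omega> x powr s" using r1 by (simp add: field_simps)
      then have "d0 \<le> (dist_bd \<Omega> x powr s) powr (1 / s)"
        unfolding d0_def using Ak r1 s by (intro powr_mono2) auto
      also have "\<dots> = dist_bd \<Omega> x" using s by (simp add: powr_powr)
      finally show "d0 \<le> dist_bd \<Omega> x" .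
    qed
    have fb: "\<bar>f x\<bar> \<le> r1 / 2 * dist_bd \<Omega> x powr s" for x
      using fbound[of x] Ak r1 by (cases "f x = 0") auto
    have Jfw: "gagliardo s p f \<le> gagliardo s p w"
    proof (rule gagliardo_mono)
      show "\<bar>f x - f x'\<bar> \<le> \<bar>w x - w x'\<bar>" for x x'
        unfolding f_def using clampr_abs_split[OF h, of "w x" "w x'"] by linarith
    qed (use p in auto)
    have Jf: "gagliardo s p f < \<infinity>" using Jfw Jw by (rule le_less_trans)
    have "(LINT x:\<Omega>|lborel. prim g (w x)) - (LINT x:\<Omega>|lborel. prim g (f x)) \<le> \<epsilon> * h * m"
    proof (rule LINT_diff_le[where w = "\<lambda>x. (\<epsilon> * h) * indicator \<Omega> x"])
      show "set_integrable lborel \<Omega> (\<lambda>x. prim g (w x))" by (rule prim_comp_integrable[OF g \<Omega>m \<Omega>f _ w\<tau>]) measurable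
      show "set_integrable lborel \<Omega> (\<lambda>x. prim g (f x))" by (rule prim_comp_integrable[OF g \<Omega>m \<Omega>f _ f\<tau>]) measurable
      show "prim g (w x) - prim g (f x) \<le> (\<epsilon> * h) * indicator \<Omega> x" if "x \<in> \<Omega>" for x
      proof -
        have "\<bar>prim g (w x) - prim g (f x)\<bar> \<le> \<epsilon> * \<bar>w x - f x\<bar>"
          by (rule prim_diff_le[OF g], rule small) (use f\<tau>[of x] w\<tau>[of x] in linarith)
        also have "\<dots> \<le> \<epsilon> * h" using \<epsilon> fw(2) by (intro mult_left_mono) auto
        finally show ?thesis using that by simp
      qed
      have "(\<integral>\<^sup>+x. ennreal ((\<epsilon> * h) * indicator \<Omega> x) \<partial>lborel) = (\<integral>\<^sup>+x. ennreal (\<epsilon> * h) * indicator \<Omega> x \<partial>lborel)"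
        by (intro nn_integral_cong) (auto simp: indicator_def)
      also have "\<dots> = ennreal (\<epsilon> * h) * emeasure lborel \<Omega>" by (rule nn_integral_cmult_indicator) simp
      also have "\<dots> = ennreal (\<epsilon> * h * m)" unfolding m(1) using \<epsilon> h m by (intro ennreal_mult[symmetric]) auto
      finally show "(\<integral>\<^sup>+x. ennreal ((\<epsilon> * h) * indicator \<Omega> x) \<partial>lborel) \<le> ennreal (\<epsilon> * h * m)" by simp
    qed (use \<epsilon> h m in auto)
    moreover have "\<epsilon> * h * m \<le> e / 2"
    proof -
      have "\<epsilon> * h * m = (\<epsilon> * (2 * A) * m) * \<kappa>0 powr s" by (simp add: h_def)
      also have "\<dots> \<le> (\<epsilon> * (2 * A) * (m + 1)) * \<kappa>0 powr s"
        using \<epsilon> A by (intro mult_right_mono mult_left_mono) auto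
      also have "\<dots> \<le> e / 2" using \<kappa>0 by simp
      finally show ?thesis .
    qed
    moreover have "1 / p * enn2real (gagliardo s p f) \<le> 1 / p * enn2real (gagliardo s p w)"
      using p Jfw Jw by (intro mult_left_mono enn2real_mono) auto
    moreover have "energy \<Omega> s p g w = 1 / p * enn2real (gagliardo s p w) - (LINT x:\<Omega>|lborel. prim g (w x))"
      "energy \<Omega> s p g f = 1 / p * enn2real (gagliardo s p f) - (LINT x:\<Omega>|lborel. prim g (f x))"
      using p by (simp_all add: energy_eq)
    ultimately have Ef: "energy \<Omega> s p g f < 0" using Ew e by linarith
    obtain v where "v \<in> X_sp \<Omega> s p" "v \<in> C0_delta \<Omega> s" "C0_delta_norm \<Omega> s v \<le> r1" "energy \<Omega> s p g v < 0"
      by (rule energy_smooth_approx[OF dom s p g r1 _ f\<tau> small \<epsilon>(1) Jf d0 fsupp fb Ef]) auto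
    then show False using min by force
  qed
  have "\<rho> powr (1 / p) > 0" using \<rho> by simp
  then show ?thesis using main unfolding E0 by (meson not_le)
qed

end
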